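(* Let $G$ be a countable group, $A$ a finite set, and let $\mathcal{G}$ be a Gibbs structure with vertex set $G$ and all alphabets equal to $A$, having a unique Gibbs measure $\nu$. Suppose that either of these conditions holds: (i) $\mathcal{G}$ satisfies the Dobrushin condition; (ii) $\mathcal{G}$ is attractive. Then for any $S\subset G$ the $\sigma$-algebras $\widetilde{\alpha^S}$ and $\alpha^S$ are equivalent $\nu$-mod $0$, where $\alpha$ is the canonical alphabet partition of $A^G$.
   Context: A Gibbs structure consists of a finite or countable vertex set $V$, finite alphabets $(A_v)_{v\in V}$, and a potential: functions $\Phi_T:\prod_{v\in T}A_v\to\mathbb{R}$ for finite $T\subset V$, such that for every $v$ all but finitely many $\Phi_T$ with $T\ni v$ are identically zero (each $\Phi_T$ is also regarded as a function on $\Omega=\prod_{v\in V}A_v$). Here $V=G$ and $A_v=A$, so $\Omega=A^G$. For finite $\Lambda\subset V$ and $\omega\in\Omega$, $\pi_\Lambda(\omega)$ is the probability measure supported on those $\omega'$ agreeing with $\omega$ off $\Lambda$, with mass of $\omega'$ proportional to $\exp(-\sum_{T\cap\Lambda\neq\varnothing}\Phi_T(\omega'))$; $\bar\pi_\Lambda(\mu)=\int\pi_\Lambda(\omega)\,d\mu(\omega)$. A Borel probability measure $\nu$ on $\Omega$ is a Gibbs measure if $\bar\pi_\Lambda(\nu)=\nu$ for all finite $\Lambda\subset V$. Dobrushin condition: for a signed measure, $\|\mu\|=\sup_{B,C}(\mu(B)-\mu(C))$ over measurable $B,C$. For $v\neq u$ let $b_{v,u}=\sup\|\mathrm{pr}_{\{v\}}\pi_{\{v\}}(\omega_1)-\mathrm{pr}_{\{v\}}\pi_{\{v\}}(\omega_2)\|$,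 supremum over $\omega_1,\omega_2\in\Omega$ with $\omega_1(w)=\omega_2(w)$ for all $w\ne u$ ($\mathrm{pr}_{\{v\}}$: push-forward to coordinate $v$). The condition is $\sup_v\sum_{u\ne v}b_{v,u}<1$. Attractive: each $A_v$ carries a partial order having a unique maximal and a unique minimal element; $\Omega$ gets the coordinatewise order $\preceq$; $\mu_1\preceq\mu_2$ for probability measures means there is a coupling of $\mu_1$ and $\mu_2$ giving full mass to $\{(x,y):x\preceq y\}$; the structure is attractive if every $\bar\pi_\Lambda$ ($\Lambda$ finite) is monotone. $\alpha=\{B_a:a\in A\}$ with $B_a=\{x\in A^G:x(e)=a\}$; with shift action $(gx)(h)=x(hg)$ and $\alpha^g=\{g^{-1}(B):B\in\alpha\}$, $\alpha^S=\bigvee_{g\in S}\alpha^g$ is the $\sigma$-algebra generated by the coordinates in $S$. The saturation of a $\sigma$-subalgebra $\mathscr{A}$ is $\widetilde{\mathscr{A}}=\bigcap_{F\subset G\text{ finite}}(\mathscr{A}\vee\alpha^{G\setminus F})$ (intersection of $\nu$-completions). Two $\sigma$-subalgebras are equivalent $\nu$-mod $0$ if every set of either one differs from some set of the other by a $\nu$-null set. *)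

theory Defs
  imports "HOL-Probability.Probability" "HOL-Algebra.Group"
begin

text \<open>
  Configurations on the vertex set \<open>V\<close> are the extensional functions \<open>PiE V A\<close>. As \<open>V\<close> is
  countable and the alphabets are finite and discrete, the Borel \<open>\<sigma>\<close>-algebra of the product
  topology is the product \<open>\<sigma>\<close>-algebra.
\<close>

definition config_space :: "'v set \<Rightarrow> ('v \<Rightarrow> 'a set) \<Rightarrow> ('v \<Rightarrow> 'a) measure" where
  "config_space V A = PiM V (\<lambda>v. count_space (A v))"


section \<open>Gibbs structures and Gibbs measures\<close>

text \<open>
  A potential is a family \<open>\<Phi> T\<close>, for finite \<open>T \<subseteq> V\<close>, of which only the values on \<open>PiE T A\<close>
  matter; on \<open>PiE V A\<close> it acts by \<open>\<omega> \<mapsto> \<Phi> T (restrict \<omega> T)\<close>.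
\<close>

type_synonym ('v, 'a) potential = "'v set \<Rightarrow> ('v \<Rightarrow> 'a) \<Rightarrow> real"

definition interactions ::
    "'v set \<Rightarrow> ('v \<Rightarrow> 'a set) \<Rightarrow> ('v, 'a) potential \<Rightarrow> 'v set \<Rightarrow> 'v set set" where
  "interactions V A \<Phi> \<Lambda> =
     {T. finite T \<and> T \<subseteq> V \<and> T \<inter> \<Lambda> \<noteq> {} \<and> (\<exists>y\<in>PiE T A. \<Phi> T y \<noteq> 0)}"

definition gibbs_structure ::
    "'v set \<Rightarrow> ('v \<Rightarrow> 'a set) \<Rightarrow> ('v, 'a) potential \<Rightarrow> bool" where
  "gibbs_structure V A \<Phi> \<longleftrightarrow>
     countable V \<and> (\<forall>v\<in>V. finite (A v)) \<and> (\<forall>v\<in>V. finite (interactions V A \<Phi> {v}))"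

text \<open>
  The sum runs only over those \<open>T\<close> with \<open>\<Phi> T\<close> not identically zero: the set of all finite \<open>T\<close>
  meeting \<open>\<Lambda>\<close> may be infinite, and \<^const>\<open>sum\<close> is \<open>0\<close> on infinite sets.
\<close>

definition energy ::
    "'v set \<Rightarrow> ('v \<Rightarrow> 'a set) \<Rightarrow> ('v, 'a) potential \<Rightarrow> 'v set \<Rightarrow> ('v \<Rightarrow> 'a) \<Rightarrow> real" where
  "energy V A \<Phi> \<Lambda> \<omega> = (\<Sum>T\<in>interactions V A \<Phi> \<Lambda>. \<Phi> T (restrict \<omega> T))"

definition agreeing_off ::
    "'v set \<Rightarrow> ('v \<Rightarrow> 'a set) \<Rightarrow> 'v set \<Rightarrow> ('v \<Rightarrow> 'a) \<Rightarrow> ('v \<Rightarrow> 'a) set" where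
  "agreeing_off V A \<Lambda> \<omega> = {\<omega>' \<in> PiE V A. \<forall>v\<in>V - \<Lambda>. \<omega>' v = \<omega> v}"

definition gibbs_kernel ::
    "'v set \<Rightarrow> ('v \<Rightarrow> 'a set) \<Rightarrow> ('v, 'a) potential \<Rightarrow> 'v set \<Rightarrow> ('v \<Rightarrow> 'a) \<Rightarrow> ('v \<Rightarrow> 'a) measure"
  where
  "gibbs_kernel V A \<Phi> \<Lambda> \<omega> =
     (let C = agreeing_off V A \<Lambda> \<omega>;
          Z = (\<Sum>\<omega>'\<in>C. exp (- energy V A \<Phi> \<Lambda> \<omega>'))
      in distr (point_measure C (\<lambda>\<omega>'. ennreal (exp (- energy V A \<Phi> \<Lambda> \<omega>') / Z)))
           (config_space V A) (\<lambda>\<omega>'. \<omega>'))"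

text \<open>\<open>\<integral> \<pi>\<^sub>\<Lambda>(\<omega>) d\<mu>(\<omega>)\<close> is the bind of the Giry monad.\<close>

definition averaged ::
    "'v set \<Rightarrow> ('v \<Rightarrow> 'a set) \<Rightarrow> ('v, 'a) potential \<Rightarrow> 'v set \<Rightarrow> ('v \<Rightarrow> 'a) measure \<Rightarrow> ('v \<Rightarrow> 'a) measure"
  where
  "averaged V A \<Phi> \<Lambda> \<mu> = \<mu> \<bind> gibbs_kernel V A \<Phi> \<Lambda>"

definition config_measures :: "'v set \<Rightarrow> ('v \<Rightarrow> 'a set) \<Rightarrow> ('v \<Rightarrow> 'a) measure set" where
  "config_measures V A = {\<mu>. prob_space \<mu> \<and> sets \<mu> = sets (config_space V A)}"

definition gibbs_measure ::
    "'v set \<Rightarrow> ('v \<Rightarrow> 'a set) \<Rightarrow> ('v, 'a) potential \<Rightarrow> ('v \<Rightarrow> 'a) measure \<Rightarrow> bool" where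
  "gibbs_measure V A \<Phi> \<nu> \<longleftrightarrow>
     \<nu> \<in> config_measures V A \<and> (\<forall>\<Lambda>. finite \<Lambda> \<and> \<Lambda> \<subseteq> V \<longrightarrow> averaged V A \<Phi> \<Lambda> \<nu> = \<nu>)"


section \<open>The Dobrushin condition\<close>

text \<open>
  The norm, \<open>sup\<^bsub>B,C\<^esub> (\<mu>(B) - \<mu>(C))\<close>, of the signed measure \<open>\<mu> = \<mu>\<^sub>1 - \<mu>\<^sub>2\<close>, for finite measures
  \<open>\<mu>\<^sub>1\<close>, \<open>\<mu>\<^sub>2\<close> on the same \<open>\<sigma>\<close>-algebra. For probability measures this is twice the supremum of
  \<open>\<bar>\<mu>\<^sub>1(B) - \<mu>\<^sub>2(B)\<bar>\<close>.
\<close>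

definition norm_of_diff :: "'x measure \<Rightarrow> 'x measure \<Rightarrow> real" where
  "norm_of_diff \<mu>\<^sub>1 \<mu>\<^sub>2 =
     (SUP (B, C) \<in> sets \<mu>\<^sub>1 \<times> sets \<mu>\<^sub>1.
        (measure \<mu>\<^sub>1 B - measure \<mu>\<^sub>2 B) - (measure \<mu>\<^sub>1 C - measure \<mu>\<^sub>2 C))"

definition single_site ::
    "'v set \<Rightarrow> ('v \<Rightarrow> 'a set) \<Rightarrow> ('v, 'a) potential \<Rightarrow> 'v \<Rightarrow> ('v \<Rightarrow> 'a) \<Rightarrow> 'a measure" where
  "single_site V A \<Phi> v \<omega> =
     distr (gibbs_kernel V A \<Phi> {v} \<omega>) (count_space (A v)) (\<lambda>\<omega>'. \<omega>' v)"

definition influence ::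
    "'v set \<Rightarrow> ('v \<Rightarrow> 'a set) \<Rightarrow> ('v, 'a) potential \<Rightarrow> 'v \<Rightarrow> 'v \<Rightarrow> ennreal" where
  "influence V A \<Phi> v u =
     (SUP (\<omega>\<^sub>1, \<omega>\<^sub>2) \<in> {(\<omega>\<^sub>1, \<omega>\<^sub>2). \<omega>\<^sub>1 \<in> PiE V A \<and> \<omega>\<^sub>2 \<in> PiE V A \<and> (\<forall>w\<in>V - {u}. \<omega>\<^sub>1 w = \<omega>\<^sub>2 w)}.
        ennreal (norm_of_diff (single_site V A \<Phi> v \<omega>\<^sub>1) (single_site V A \<Phi> v \<omega>\<^sub>2)))"

definition dobrushin_condition ::
    "'v set \<Rightarrow> ('v \<Rightarrow> 'a set) \<Rightarrow> ('v, 'a) potential \<Rightarrow> bool" where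
  "dobrushin_condition V A \<Phi> \<longleftrightarrow>
     (SUP v\<in>V. \<Sum>\<^sub>\<infinity>u\<in>V - {v}. influence V A \<Phi> v u) < 1"


section \<open>Attractive structures\<close>

text \<open>The order \<open>R v\<close> on the alphabet \<open>A v\<close> may depend on the vertex \<open>v\<close>.\<close>

definition order_with_extremes :: "'a set \<Rightarrow> 'a rel \<Rightarrow> bool" where
  "order_with_extremes X r \<longleftrightarrow>
     partial_order_on X r \<and>
     (\<exists>!m. m \<in> X \<and> (\<forall>a\<in>X. (m, a) \<in> r \<longrightarrow> a = m)) \<and>
     (\<exists>!m. m \<in> X \<and> (\<forall>a\<in>X. (a, m) \<in> r \<longrightarrow> a = m))"

definition config_le :: "'v set \<Rightarrow> ('v \<Rightarrow> 'a rel) \<Rightarrow> ('v \<Rightarrow> 'a) \<Rightarrow> ('v \<Rightarrow> 'a) \<Rightarrow> bool" where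
  "config_le V R x y \<longleftrightarrow> (\<forall>v\<in>V. (x v, y v) \<in> R v)"

definition stochastic_le ::
    "'v set \<Rightarrow> ('v \<Rightarrow> 'a set) \<Rightarrow> ('v \<Rightarrow> 'a rel) \<Rightarrow> ('v \<Rightarrow> 'a) measure \<Rightarrow> ('v \<Rightarrow> 'a) measure \<Rightarrow> bool"
  where
  "stochastic_le V A R \<mu>\<^sub>1 \<mu>\<^sub>2 \<longleftrightarrow>
     (\<exists>\<kappa>. prob_space \<kappa> \<and>
          sets \<kappa> = sets (config_space V A \<Otimes>\<^sub>M config_space V A) \<and>
          distr \<kappa> (config_space V A) fst = \<mu>\<^sub>1 \<and>
          distr \<kappa> (config_space V A) snd = \<mu>\<^sub>2 \<and>
          (AE (x, y) in \<kappa>. config_le V R x y))"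

definition attractive ::
    "'v set \<Rightarrow> ('v \<Rightarrow> 'a set) \<Rightarrow> ('v, 'a) potential \<Rightarrow> bool" where
  "attractive V A \<Phi> \<longleftrightarrow>
     (\<exists>R. (\<forall>v\<in>V. order_with_extremes (A v) (R v)) \<and>
          (\<forall>\<Lambda>. finite \<Lambda> \<and> \<Lambda> \<subseteq> V \<longrightarrow>
             monotone_on (config_measures V A) (stochastic_le V A R) (stochastic_le V A R)
               (averaged V A \<Phi> \<Lambda>)))"


section \<open>The alphabet partition and saturations\<close>

definition shift :: "('g, 'm) monoid_scheme \<Rightarrow> 'g \<Rightarrow> ('g \<Rightarrow> 'a) \<Rightarrow> 'g \<Rightarrow> 'a" where
  "shift G g x = (\<lambda>h\<in>carrier G. x (h \<otimes>\<^bsub>G\<^esub> g))"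

definition alphabet_partition ::
    "('g, 'm) monoid_scheme \<Rightarrow> 'a set \<Rightarrow> ('g \<Rightarrow> 'a) set set" where
  "alphabet_partition G A = (\<lambda>a. {x \<in> carrier G \<rightarrow>\<^sub>E A. x \<one>\<^bsub>G\<^esub> = a}) ` A"

definition translated_partition ::
    "('g, 'm) monoid_scheme \<Rightarrow> 'a set \<Rightarrow> 'g \<Rightarrow> ('g \<Rightarrow> 'a) set set" where
  "translated_partition G A g =
     (\<lambda>B. shift G g -` B \<inter> (carrier G \<rightarrow>\<^sub>E A)) ` alphabet_partition G A"

definition alphabet_algebra ::
    "('g, 'm) monoid_scheme \<Rightarrow> 'a set \<Rightarrow> 'g set \<Rightarrow> ('g \<Rightarrow> 'a) set set" where
  "alphabet_algebra G A S =
     sigma_sets (carrier G \<rightarrow>\<^sub>E A) (\<Union>g\<in>S. translated_partition G A g)"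

text \<open>
  The completion of a \<open>\<sigma>\<close>-subalgebra is taken in the ambient space \<open>(\<Omega>, \<nu>)\<close>: it contains all
  \<open>\<nu>\<close>-negligible sets, not only those covered by a null set of the subalgebra itself.
\<close>

definition null_completion :: "'x measure \<Rightarrow> 'x set set \<Rightarrow> 'x set set" where
  "null_completion \<nu> \<B> =
     {B. B \<subseteq> space \<nu> \<and> (\<exists>C\<in>\<B>. sym_diff B C \<in> null_sets (completion \<nu>))}"

definition saturation ::
    "('g, 'm) monoid_scheme \<Rightarrow> 'a set \<Rightarrow> ('g \<Rightarrow> 'a) measure \<Rightarrow> ('g \<Rightarrow> 'a) set set
      \<Rightarrow> ('g \<Rightarrow> 'a) set set" where
  "saturation G A \<nu> \<A> =
     (\<Inter>F\<in>{F. finite F \<and> F \<subseteq> carrier G}.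
        null_completion \<nu>
          (sigma_sets (carrier G \<rightarrow>\<^sub>E A) (\<A> \<union> alphabet_algebra G A (carrier G - F))))"

definition equivalent_mod_0 :: "'x measure \<Rightarrow> 'x set set \<Rightarrow> 'x set set \<Rightarrow> bool" where
  "equivalent_mod_0 \<nu> \<A> \<B> \<longleftrightarrow>
     (\<forall>B\<in>\<A>. \<exists>C\<in>\<B>. sym_diff B C \<in> null_sets (completion \<nu>)) \<and>
     (\<forall>C\<in>\<B>. \<exists>B\<in>\<A>. sym_diff C B \<in> null_sets (completion \<nu>))"

end

theory Submission
  imports Defs
begin

text \<open>
  Write \<open>\<pi>\<^sub>\<Lambda> f\<close> for the expectation of a function \<open>f\<close> under the Gibbs kernel of a finite volume
  \<open>\<Lambda>\<close>, as a function of the boundary condition. For a Gibbs measure \<open>\<nu>\<close> it is the conditional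
  expectation of \<open>f\<close> given the configuration off \<open>\<Lambda>\<close>. Let \<open>S\<close> be a set of sites, \<open>B\<close> a set in
  the saturation, and \<open>u\<close> the conditional probability of \<open>B\<close> given the coordinates in \<open>S\<close>. For
  every finite \<open>\<Lambda>\<close> disjoint from \<open>S\<close>, the set \<open>B\<close> is up to a null set determined off \<open>\<Lambda>\<close>, and
  so is \<open>u\<close>. Hence \<open>f\<close> has the same integral as \<open>\<pi>\<^sub>\<Lambda> f\<close> against \<open>1\<^sub>B\<close>, and against \<open>u\<close> as well.
  If \<open>\<pi>\<^sub>\<Lambda> f\<close> can be made close in mean to a function of the coordinates in \<open>S\<close> alone, then \<open>1\<^sub>B\<close>
  and \<open>u\<close> have the same integral against that function, and therefore against \<open>f\<close>. This is called
  screening here. If the screened functions span all cylinder indicators, then \<open>1\<^sub>B = u\<close> almost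
  everywhere, and \<open>B\<close> agrees with a set determined by \<open>S\<close> (\<open>screening_imp_saturated\<close>). It remains
  to prove screening under each of the two hypotheses.

  Under the Dobrushin condition every local function is screened (\<open>dobrushin_screened\<close>). Composing
  \<open>\<pi>\<^sub>\<Lambda>\<close> with one-site kernels at sites of \<open>\<Lambda>\<close> does not change it. One such update at a site
  \<open>v\<close> moves the oscillation of the function at \<open>v\<close> to the other sites and multiplies the amount by
  at most \<open>c < 1\<close>. Updating again and again all relevant sites off \<open>S\<close> makes the sum of the
  oscillations off \<open>S\<close> arbitrarily small, and the expectation under \<open>\<pi>\<^sub>\<Lambda>\<close> then hardly depends
  on the boundary condition off \<open>S\<close>.

  In an attractive structure every increasing local function \<open>f\<close> is screened
  (\<open>unique_imp_screened\<close>), and these span the cylinder indicators. With the greatest configuration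
  \<open>t\<close> as boundary condition, \<open>\<pi>\<^sub>\<Lambda> f(t)\<close> decreases in \<open>\<Lambda>\<close>; the limits are the integrals
  of \<open>f\<close> for a Gibbs measure, which by uniqueness is \<open>\<nu>\<close>. Let \<open>\<Lambda> = \<Lambda>\<^sub>0 - S\<close>, and let \<open>g(x)\<close> be
  \<open>\<pi>\<^sub>\<Lambda> f\<close> at the configuration that equals \<open>x\<close> on \<open>S\<close> and \<open>t\<close> elsewhere. Then
  \<open>\<pi>\<^sub>\<Lambda> f \<le> g\<close>, and as \<open>g\<close> is increasing, its integral is at most \<open>\<pi>\<^sub>\<Lambda>\<^sub>0 g(t) = \<pi>\<^sub>\<Lambda>\<^sub>0 f(t)\<close>,
  which is close to the integral of \<open>f\<close>, that is, of \<open>\<pi>\<^sub>\<Lambda> f\<close>. Thus \<open>\<pi>\<^sub>\<Lambda> f\<close> and \<open>g\<close> are close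
  in mean.
\<close>

section \<open>Null sets, generators and finite orders\<close>

lemma null_completionD:
  assumes "X \<in> null_completion \<nu> \<B>"
  obtains C where "C \<in> \<B>" "AE x in \<nu>. x \<in> X \<longleftrightarrow> x \<in> C"
proof -
  obtain C where C: "C \<in> \<B>" "sym_diff X C \<in> null_sets (completion \<nu>)"
    using assms by (auto simp: null_completion_def)
  have "AE x in completion \<nu>. x \<in> X \<longleftrightarrow> x \<in> C"
    using AE_not_in[OF C(2)] by eventually_elim auto
  then show ?thesis using C(1) that by (simp add: AE_completion_iff)
qed

lemma sym_diff_null_iff_AE:
  assumes "X \<subseteq> space \<nu>" "Y \<subseteq> space \<nu>"
  shows "sym_diff X Y \<in> null_sets (completion \<nu>) \<longleftrightarrow> (AE x in \<nu>. x \<in> X \<longleftrightarrow> x \<in> Y)"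
proof
  assume "sym_diff X Y \<in> null_sets (completion \<nu>)"
  then have "AE x in completion \<nu>. x \<in> X \<longleftrightarrow> x \<in> Y"
    by (rule AE_not_in[THEN eventually_mono]) auto
  then show "AE x in \<nu>. x \<in> X \<longleftrightarrow> x \<in> Y" by (simp add: AE_completion_iff)
next
  assume "AE x in \<nu>. x \<in> X \<longleftrightarrow> x \<in> Y"
  then obtain N where "{x \<in> space \<nu>. \<not> (x \<in> X \<longleftrightarrow> x \<in> Y)} \<subseteq> N" "N \<in> null_sets \<nu>"
    by (auto elim!: AE_E simp: null_sets_def)
  then show "sym_diff X Y \<in> null_sets (completion \<nu>)"
    using assms unfolding null_sets_completion_iff2 by (intro bexI[of _ N]) auto
qed

lemma sigma_sets_mem_iff:
  assumes "B \<in> sigma_sets X \<G>" "x \<in> X" "y \<in> X" "\<And>B. B \<in> \<G> \<Longrightarrow> x \<in> B \<longleftrightarrow> y \<in> B"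
  shows "x \<in> B \<longleftrightarrow> y \<in> B"
  using assms(1) by induction (use assms(2-4) in auto)

text \<open>In a finite poset every element lies below a maximal one.\<close>

lemma unique_maximal_is_greatest:
  assumes X: "finite X" and r: "partial_order_on X r"
    and ex1: "\<exists>!m. m \<in> X \<and> (\<forall>a\<in>X. (m, a) \<in> r \<longrightarrow> a = m)"
  shows "\<exists>t\<in>X. \<forall>a\<in>X. (a, t) \<in> r"
proof -
  obtain m where m: "m \<in> X" and uniq: "\<And>m'. m' \<in> X \<Longrightarrow> \<forall>a\<in>X. (m', a) \<in> r \<longrightarrow> a = m' \<Longrightarrow> m' = m"
    using ex1 by blast
  note rD = partial_order_onD[OF r]
  have "finite r" using rD(4) X finite_subset by blast
  then have wf: "wf (r\<inverse> - Id)"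
    using r by (intro partial_order_on_well_order_on) auto
  have "(a, m) \<in> r" if a: "a \<in> X" for a
  proof -
    let ?U = "{b \<in> X. (a, b) \<in> r}"
    have "a \<in> ?U" using a rD(1) by (simp add: refl_on_def)
    then obtain z where z: "z \<in> ?U" "\<And>y. (y, z) \<in> r\<inverse> - Id \<Longrightarrow> y \<notin> ?U"
      by (rule wfE_min[OF wf]) blast
    have "b = z" if "b \<in> X" "(z, b) \<in> r" for b
    proof (rule ccontr)
      assume "b \<noteq> z"
      then have "b \<notin> ?U" using z(2) that(2) by blast
      moreover have "(a, b) \<in> r" using z(1) that(2) transD[OF rD(2)] by blast
      ultimately show False using that(1) by blast
    qed
    then have "z = m" using z(1) by (intro uniq) auto
    then show ?thesis using z(1) by simp
  qed
  then show ?thesis using m by blast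
qed

section \<open>Finite-volume Gibbs kernels\<close>

locale gibbs_specification =
  fixes V :: "'v set" and A :: "'v \<Rightarrow> 'a set" and \<Phi> :: "('v, 'a) potential"
  assumes gibbs_structure: "gibbs_structure V A \<Phi>"
    and alphabets_nonempty: "\<And>v. v \<in> V \<Longrightarrow> A v \<noteq> {}"
begin

abbreviation \<Omega> :: "('v \<Rightarrow> 'a) set" where "\<Omega> \<equiv> PiE V A"

abbreviation M :: "('v \<Rightarrow> 'a) measure" where "M \<equiv> config_space V A"

abbreviation agree :: "'v set \<Rightarrow> ('v \<Rightarrow> 'a) \<Rightarrow> ('v \<Rightarrow> 'a) set" where
  "agree \<equiv> agreeing_off V A"

definition weight :: "'v set \<Rightarrow> ('v \<Rightarrow> 'a) \<Rightarrow> real" where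
  "weight \<Lambda> x = exp (- energy V A \<Phi> \<Lambda> x)"

definition partition_sum :: "'v set \<Rightarrow> ('v \<Rightarrow> 'a) \<Rightarrow> real" where
  "partition_sum \<Lambda> x = (\<Sum>y\<in>agree \<Lambda> x. weight \<Lambda> y)"

text \<open>The expectation of \<open>f\<close> under the Gibbs kernel, in closed form because the class is finite.\<close>

definition spec :: "'v set \<Rightarrow> (('v \<Rightarrow> 'a) \<Rightarrow> real) \<Rightarrow> ('v \<Rightarrow> 'a) \<Rightarrow> real" where
  "spec \<Lambda> f x = (\<Sum>y\<in>agree \<Lambda> x. weight \<Lambda> y * f y) / partition_sum \<Lambda> x"

definition determined_by :: "'v set \<Rightarrow> (('v \<Rightarrow> 'a) \<Rightarrow> 'b) \<Rightarrow> bool" where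
  "determined_by W f \<longleftrightarrow> (\<forall>x\<in>\<Omega>. \<forall>y\<in>\<Omega>. (\<forall>v\<in>W. x v = y v) \<longrightarrow> f x = f y)"

lemma determined_byD:
  "determined_by W f \<Longrightarrow> x \<in> \<Omega> \<Longrightarrow> y \<in> \<Omega> \<Longrightarrow> (\<And>v. v \<in> W \<Longrightarrow> x v = y v) \<Longrightarrow> f x = f y"
  unfolding determined_by_def by blast

lemma determined_by_mono: "determined_by W f \<Longrightarrow> W \<subseteq> W' \<Longrightarrow> determined_by W' f"
  unfolding determined_by_def by blast

lemma countable_V: "countable V"
  and finite_alphabet: "v \<in> V \<Longrightarrow> finite (A v)"
  using gibbs_structure by (auto simp: gibbs_structure_def)

lemma space_M [simp]: "space M = \<Omega>"
  by (simp add: config_space_def space_PiM)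

lemma \<Omega>_nonempty: "\<Omega> \<noteq> {}"
  using alphabets_nonempty by (simp add: PiE_eq_empty_iff)

lemma finite_interactions:
  assumes "finite \<Lambda>" "\<Lambda> \<subseteq> V"
  shows "finite (interactions V A \<Phi> \<Lambda>)"
proof -
  have "interactions V A \<Phi> \<Lambda> = (\<Union>v\<in>\<Lambda>. interactions V A \<Phi> {v})"
    by (auto simp: interactions_def)
  then show ?thesis
    using assms gibbs_structure by (auto simp: gibbs_structure_def)
qed

text \<open>The sites on which the energy of \<open>\<Lambda>\<close> can depend: the weights are local functions.\<close>

definition reach :: "'v set \<Rightarrow> 'v set" where
  "reach \<Lambda> = \<Union> (interactions V A \<Phi> \<Lambda>)"

lemma reach_subset: "reach \<Lambda> \<subseteq> V"
  by (auto simp: reach_def interactions_def)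

lemma finite_reach: "finite \<Lambda> \<Longrightarrow> \<Lambda> \<subseteq> V \<Longrightarrow> finite (reach \<Lambda>)"
  unfolding reach_def using finite_interactions
  by (intro finite_Union) (auto simp: interactions_def)

lemma energy_cong:
  assumes "\<And>v. v \<in> reach \<Lambda> \<Longrightarrow> x v = y v"
  shows "energy V A \<Phi> \<Lambda> x = energy V A \<Phi> \<Lambda> y"
  unfolding energy_def
proof (rule sum.cong[OF refl])
  fix T assume "T \<in> interactions V A \<Phi> \<Lambda>"
  with assms have "restrict x T = restrict y T"
    by (fastforce simp: reach_def restrict_def)
  then show "\<Phi> T (restrict x T) = \<Phi> T (restrict y T)" by simp
qed

lemma weight_cong: "(\<And>v. v \<in> reach \<Lambda> \<Longrightarrow> x v = y v) \<Longrightarrow> weight \<Lambda> x = weight \<Lambda> y"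
  unfolding weight_def by (subst energy_cong) auto

lemma weight_pos: "weight \<Lambda> x > 0"
  by (simp add: weight_def)


subsection \<open>Classes of configurations that agree off a finite set\<close>

lemma agree_subset: "agree \<Lambda> x \<subseteq> \<Omega>"
  by (auto simp: agreeing_off_def)

lemma agree_refl: "x \<in> \<Omega> \<Longrightarrow> x \<in> agree \<Lambda> x"
  by (auto simp: agreeing_off_def)

lemma agree_mono: "y \<in> agree \<Delta> x \<Longrightarrow> \<Delta> \<subseteq> \<Lambda> \<Longrightarrow> y \<in> agree \<Lambda> x"
  by (auto simp: agreeing_off_def)

lemma agree_eq: "(\<And>v. v \<in> V - \<Lambda> \<Longrightarrow> x v = y v) \<Longrightarrow> agree \<Lambda> x = agree \<Lambda> y"
  by (auto simp: agreeing_off_def)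

lemma agree_eq': "y \<in> agree \<Lambda> x \<Longrightarrow> agree \<Lambda> y = agree \<Lambda> x"
  by (rule agree_eq) (auto simp: agreeing_off_def)

lemma override_in_\<Omega>:
  "x \<in> \<Omega> \<Longrightarrow> z \<in> PiE \<Lambda> A \<Longrightarrow> \<Lambda> \<subseteq> V \<Longrightarrow> override_on x z \<Lambda> \<in> \<Omega>"
  by (auto simp: PiE_iff override_on_def extensional_def)

lemma bij_betw_override:
  assumes "x \<in> \<Omega>" "\<Lambda> \<subseteq> V"
  shows "bij_betw (\<lambda>z. override_on x z \<Lambda>) (PiE \<Lambda> A) (agree \<Lambda> x)"
proof (rule bij_betw_byWitness[where f' = "\<lambda>y. restrict y \<Lambda>"])
  show "\<forall>z\<in>PiE \<Lambda> A. restrict (override_on x z \<Lambda>) \<Lambda> = z"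
    by (auto simp: PiE_iff extensional_def restrict_def override_on_def)
  show "\<forall>y\<in>agree \<Lambda> x. override_on x (restrict y \<Lambda>) \<Lambda> = y"
  proof
    fix y assume y: "y \<in> agree \<Lambda> x"
    then have "x v = y v" if "v \<notin> \<Lambda>" for v
      using that assms by (cases "v \<in> V") (auto simp: agreeing_off_def PiE_iff extensional_def)
    then show "override_on x (restrict y \<Lambda>) \<Lambda> = y"
      by (auto simp: override_on_def)
  qed
  show "(\<lambda>z. override_on x z \<Lambda>) ` PiE \<Lambda> A \<subseteq> agree \<Lambda> x"
    using override_in_\<Omega>[OF assms(1) _ assms(2)] by (auto simp: agreeing_off_def)
  show "(\<lambda>y. restrict y \<Lambda>) ` agree \<Lambda> x \<subseteq> PiE \<Lambda> A"
    using assms(2) by (auto simp: agreeing_off_def PiE_iff)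
qed

lemma finite_PiE_alphabets: "finite \<Lambda> \<Longrightarrow> \<Lambda> \<subseteq> V \<Longrightarrow> finite (PiE \<Lambda> A)"
  using finite_alphabet by (intro finite_PiE) auto

lemma finite_agree:
  assumes "x \<in> \<Omega>" "finite \<Lambda>" "\<Lambda> \<subseteq> V"
  shows "finite (agree \<Lambda> x)"
  using bij_betw_finite[OF bij_betw_override[OF assms(1,3)]] finite_PiE_alphabets[OF assms(2,3)]
  by simp

lemma sum_agree:
  assumes "x \<in> \<Omega>" "\<Lambda> \<subseteq> V"
  shows "(\<Sum>y\<in>agree \<Lambda> x. h y) = (\<Sum>z\<in>PiE \<Lambda> A. h (override_on x z \<Lambda>))"
  using sum.reindex_bij_betw[OF bij_betw_override[OF assms], of h] by simp

lemma partition_sum_pos: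
  assumes "x \<in> \<Omega>" "finite \<Lambda>" "\<Lambda> \<subseteq> V"
  shows "partition_sum \<Lambda> x > 0"
  unfolding partition_sum_def
  using finite_agree[OF assms] agree_refl[OF assms(1)] weight_pos by (intro sum_pos) auto

lemma spec_eq_sum: "spec \<Lambda> f x = (\<Sum>y\<in>agree \<Lambda> x. weight \<Lambda> y / partition_sum \<Lambda> x * f y)"
  by (simp add: spec_def sum_divide_distrib)

lemma sum_prob_eq_1:
  assumes "x \<in> \<Omega>" "finite \<Lambda>" "\<Lambda> \<subseteq> V"
  shows "(\<Sum>y\<in>agree \<Lambda> x. weight \<Lambda> y / partition_sum \<Lambda> x) = 1"
  using partition_sum_pos[OF assms]
  by (simp add: sum_divide_distrib[symmetric] partition_sum_def)

lemma partition_sum_cong: "(\<And>v. v \<in> V - \<Lambda> \<Longrightarrow> x v = y v) \<Longrightarrow> partition_sum \<Lambda> x = partition_sum \<Lambda> y"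
  unfolding partition_sum_def using agree_eq[of \<Lambda> x y] by simp

lemma spec_boundary_cong: "(\<And>v. v \<in> V - \<Lambda> \<Longrightarrow> x v = y v) \<Longrightarrow> spec \<Lambda> f x = spec \<Lambda> f y"
  unfolding spec_def using agree_eq[of \<Lambda> x y] partition_sum_cong[of \<Lambda> x y] by simp

lemma spec_cong:
  "(\<And>y. y \<in> \<Omega> \<Longrightarrow> f y = g y) \<Longrightarrow> spec \<Lambda> f x = spec \<Lambda> g x"
  unfolding spec_def using agree_subset[of \<Lambda> x] by (simp add: subset_eq)


subsection \<open>The kernels as operators on functions\<close>

lemma spec_diff: "spec \<Lambda> (\<lambda>x. f x - g x) x = spec \<Lambda> f x - spec \<Lambda> g x"
  by (simp add: spec_def right_diff_distrib sum_subtractf diff_divide_distrib)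

lemma spec_cmult: "spec \<Lambda> (\<lambda>x. c * f x) x = c * spec \<Lambda> f x"
  by (simp add: spec_def sum_distrib_left mult.left_commute)

lemma spec_sum: "spec \<Lambda> (\<lambda>x. \<Sum>i\<in>I. f i x) x = (\<Sum>i\<in>I. spec \<Lambda> (f i) x)"
  unfolding spec_def sum_divide_distrib[symmetric] sum_distrib_left
  by (subst sum.swap) simp

lemma spec_mono:
  assumes "x \<in> \<Omega>" "finite \<Lambda>" "\<Lambda> \<subseteq> V" "\<And>y. y \<in> agree \<Lambda> x \<Longrightarrow> f y \<le> g y"
  shows "spec \<Lambda> f x \<le> spec \<Lambda> g x"
  unfolding spec_def using partition_sum_pos[OF assms(1-3)] assms(4) weight_pos
  by (intro divide_right_mono sum_mono mult_left_mono) (auto intro: less_imp_le)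

lemma spec_const:
  assumes "x \<in> \<Omega>" "finite \<Lambda>" "\<Lambda> \<subseteq> V"
  shows "spec \<Lambda> (\<lambda>_. c) x = c"
  using partition_sum_pos[OF assms] unfolding spec_def
  by (simp add: sum_distrib_right[symmetric] partition_sum_def)

lemma spec_le_const:
  assumes "x \<in> \<Omega>" "finite \<Lambda>" "\<Lambda> \<subseteq> V" "\<And>y. y \<in> agree \<Lambda> x \<Longrightarrow> f y \<le> c"
  shows "spec \<Lambda> f x \<le> c"
  using spec_mono[OF assms(1-3), of f "\<lambda>_. c"] assms(4) spec_const[OF assms(1-3)] by simp

lemma spec_ge_const:
  assumes "x \<in> \<Omega>" "finite \<Lambda>" "\<Lambda> \<subseteq> V" "\<And>y. y \<in> agree \<Lambda> x \<Longrightarrow> c \<le> f y"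
  shows "c \<le> spec \<Lambda> f x"
  using spec_mono[OF assms(1-3), of "\<lambda>_. c" f] assms(4) spec_const[OF assms(1-3)] by simp

lemma spec_abs_le:
  assumes "x \<in> \<Omega>" "finite \<Lambda>" "\<Lambda> \<subseteq> V" "\<And>y. y \<in> agree \<Lambda> x \<Longrightarrow> \<bar>f y\<bar> \<le> c"
  shows "\<bar>spec \<Lambda> f x\<bar> \<le> c"
proof -
  have "f y \<le> c" "- c \<le> f y" if "y \<in> agree \<Lambda> x" for y
    using assms(4)[OF that] by linarith+
  then show ?thesis
    using spec_le_const[OF assms(1-3), of f c] spec_ge_const[OF assms(1-3), of "-c" f]
    by (simp add: abs_le_iff)
qed

lemma spec_mult_boundary:
  assumes "\<And>y. y \<in> agree \<Lambda> x \<Longrightarrow> g y = g x"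
  shows "spec \<Lambda> (\<lambda>y. f y * g y) x = g x * spec \<Lambda> f x"
  unfolding spec_def using assms by (simp add: sum_distrib_left mult_ac)

lemma determined_by_spec:
  assumes "\<Lambda> \<subseteq> V" "determined_by W f"
  shows "determined_by (W \<union> reach \<Lambda>) (spec \<Lambda> f)"
  unfolding determined_by_def
proof (intro ballI impI)
  fix x y assume xy: "x \<in> \<Omega>" "y \<in> \<Omega>" "\<forall>v\<in>W \<union> reach \<Lambda>. x v = y v"
  have w: "weight \<Lambda> (override_on x z \<Lambda>) = weight \<Lambda> (override_on y z \<Lambda>)" for z
    using xy(3) by (intro weight_cong) (auto simp: override_on_def)
  have f: "f (override_on x z \<Lambda>) = f (override_on y z \<Lambda>)" if "z \<in> PiE \<Lambda> A" for z
    using xy(3) override_in_\<Omega>[OF xy(1) that assms(1)] override_in_\<Omega>[OF xy(2) that assms(1)]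
    by (intro determined_byD[OF assms(2)]) (auto simp: override_on_def)
  show "spec \<Lambda> f x = spec \<Lambda> f y"
    unfolding spec_def partition_sum_def sum_agree[OF xy(1) assms(1)] sum_agree[OF xy(2) assms(1)]
    using w f by simp
qed

text \<open>
  The energies of \<open>\<Lambda>\<close> and of a smaller set \<open>\<Delta>\<close> differ by the interactions that miss \<open>\<Delta>\<close>, and
  these do not change inside a class of configurations agreeing off \<open>\<Delta>\<close>. In such a class the two
  weights are therefore proportional.
\<close>

lemma weight_proportional:
  assumes "finite \<Lambda>" "\<Lambda> \<subseteq> V" "\<Delta> \<subseteq> \<Lambda>" "x \<in> \<Omega>" "y \<in> agree \<Delta> x"
  shows "weight \<Lambda> y * weight \<Delta> x = weight \<Lambda> x * weight \<Delta> y"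
proof -
  let ?I = "interactions V A \<Phi>"
  have sub: "?I \<Delta> \<subseteq> ?I \<Lambda>" using assms(3) by (auto simp: interactions_def)
  have fin: "finite (?I \<Lambda>)" using finite_interactions assms by blast
  have split: "energy V A \<Phi> \<Lambda> z
      = energy V A \<Phi> \<Delta> z + (\<Sum>T\<in>?I \<Lambda> - ?I \<Delta>. \<Phi> T (restrict z T))" for z
    unfolding energy_def using sum.subset_diff[OF sub fin] by (metis add.commute)
  have "(\<Sum>T\<in>?I \<Lambda> - ?I \<Delta>. \<Phi> T (restrict x T)) = (\<Sum>T\<in>?I \<Lambda> - ?I \<Delta>. \<Phi> T (restrict y T))"
  proof (rule sum.cong[OF refl])
    fix T assume T: "T \<in> ?I \<Lambda> - ?I \<Delta>"
    then have "T \<subseteq> V - \<Delta>" by (auto simp: interactions_def)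
    then have "restrict x T = restrict y T"
      using assms(5) by (fastforce simp: agreeing_off_def restrict_def)
    then show "\<Phi> T (restrict x T) = \<Phi> T (restrict y T)" by simp
  qed
  then show ?thesis
    unfolding weight_def exp_add[symmetric] using split[of x] split[of y] by simp
qed

text \<open>
  Resampling a part of \<open>\<Lambda>\<close> after \<open>\<Lambda>\<close> changes nothing: exchanging the two sums over the class of
  configurations agreeing off \<open>\<Lambda>\<close> is possible because agreement off \<open>\<Delta>\<close> is a symmetric
  relation on it, and the weights match by proportionality.
\<close>

lemma spec_spec:
  assumes \<Lambda>: "finite \<Lambda>" "\<Lambda> \<subseteq> V" and "\<Delta> \<subseteq> \<Lambda>" and x: "x \<in> \<Omega>"
  shows "spec \<Lambda> (spec \<Delta> f) x = spec \<Lambda> f x"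
proof -
  have \<Delta>: "finite \<Delta>" "\<Delta> \<subseteq> V" using assms finite_subset by auto
  define D where "D = agree \<Lambda> x"
  have D: "finite D" "D \<subseteq> \<Omega>" unfolding D_def using finite_agree[OF x \<Lambda>] agree_subset by auto
  have cls: "agree \<Delta> y \<subseteq> D" if "y \<in> D" for y
    using that agree_mono[OF _ \<open>\<Delta> \<subseteq> \<Lambda>\<close>] agree_eq' unfolding D_def by blast
  define K where "K y z = (if z \<in> agree \<Delta> y then weight \<Lambda> y * (weight \<Delta> z * f z) / partition_sum \<Delta> y else 0)" for y z
  have "(\<Sum>y\<in>D. weight \<Lambda> y * spec \<Delta> f y) = (\<Sum>y\<in>D. \<Sum>z\<in>D. K y z)"
  proof (rule sum.cong[OF refl])
    fix y assume y: "y \<in> D"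
    have "(\<Sum>z\<in>D. K y z) = (\<Sum>z\<in>agree \<Delta> y. weight \<Lambda> y * (weight \<Delta> z * f z) / partition_sum \<Delta> y)"
      unfolding K_def using cls[OF y] D(1) by (simp add: sum.If_cases Int_absorb1)
    then show "weight \<Lambda> y * spec \<Delta> f y = (\<Sum>z\<in>D. K y z)"
      unfolding spec_def by (simp add: sum_distrib_left sum_divide_distrib)
  qed
  also have "\<dots> = (\<Sum>z\<in>D. \<Sum>y\<in>D. K y z)"
    by (rule sum.swap)
  also have "\<dots> = (\<Sum>z\<in>D. weight \<Lambda> z * f z)"
  proof (rule sum.cong[OF refl])
    fix z assume z: "z \<in> D"
    then have z\<Omega>: "z \<in> \<Omega>" using D by auto
    have "K y z = (if y \<in> agree \<Delta> z then weight \<Lambda> z * f z / partition_sum \<Delta> z * weight \<Delta> y else 0)"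
      if y: "y \<in> D" for y
    proof (cases "z \<in> agree \<Delta> y")
      case True
      have y\<Omega>: "y \<in> \<Omega>" using y D by auto
      have "agree \<Delta> z = agree \<Delta> y" using agree_eq'[OF True] .
      moreover have "y \<in> agree \<Delta> z" using calculation agree_refl[OF y\<Omega>] by simp
      moreover have "partition_sum \<Delta> z = partition_sum \<Delta> y"
        unfolding partition_sum_def using calculation by simp
      moreover have "weight \<Lambda> y * weight \<Delta> z = weight \<Lambda> z * weight \<Delta> y"
        using weight_proportional[OF \<Lambda> \<open>\<Delta> \<subseteq> \<Lambda>\<close> z\<Omega> \<open>y \<in> agree \<Delta> z\<close>] .
      ultimately show ?thesis
        using True unfolding K_def by (simp add: mult.assoc[symmetric])
    next
      case False
      then have "y \<notin> agree \<Delta> z"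
        using agree_eq' agree_refl[OF z\<Omega>] by blast
      then show ?thesis using False by (simp add: K_def)
    qed
    then have "(\<Sum>y\<in>D. K y z)
        = (\<Sum>y\<in>D. if y \<in> agree \<Delta> z then weight \<Lambda> z * f z / partition_sum \<Delta> z * weight \<Delta> y else 0)"
      by simp
    also have "\<dots> = (\<Sum>y\<in>agree \<Delta> z. weight \<Lambda> z * f z / partition_sum \<Delta> z * weight \<Delta> y)"
      using cls[OF z] D(1) by (simp add: sum.If_cases Int_absorb1)
    also have "\<dots> = weight \<Lambda> z * f z / partition_sum \<Delta> z * partition_sum \<Delta> z"
      by (simp only: sum_distrib_left partition_sum_def)
    also have "\<dots> = weight \<Lambda> z * f z"
      using partition_sum_pos[OF z\<Omega> \<Delta>] by simp
    finally show "(\<Sum>y\<in>D. K y z) = weight \<Lambda> z * f z" .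
  qed
  finally show ?thesis unfolding spec_def D_def by simp
qed


section \<open>Local functions and cylinders\<close>

definition cyl :: "'v set \<Rightarrow> ('v \<Rightarrow> 'a) \<Rightarrow> ('v \<Rightarrow> 'a) set" where
  "cyl W z = {x \<in> \<Omega>. \<forall>v\<in>W. x v = z v}"

definition local_fun :: "(('v \<Rightarrow> 'a) \<Rightarrow> real) \<Rightarrow> bool" where
  "local_fun f \<longleftrightarrow> (\<exists>W. finite W \<and> W \<subseteq> V \<and> determined_by W f)"

lemma measurable_coordinate:
  "v \<in> V \<Longrightarrow> (\<lambda>x. x v) \<in> M \<rightarrow>\<^sub>M count_space (A v)"
  unfolding config_space_def by (rule measurable_component_singleton)

lemma coordinate_in_sets:
  assumes "v \<in> V"
  shows "{x \<in> \<Omega>. x v = a} \<in> sets M"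
proof -
  have "(\<lambda>x. x v) -` ({a} \<inter> A v) \<inter> space M \<in> sets M"
    by (rule measurable_sets[OF measurable_coordinate[OF assms]]) simp
  moreover have "(\<lambda>x. x v) -` ({a} \<inter> A v) \<inter> space M = {x \<in> \<Omega>. x v = a}"
    using assms by auto
  ultimately show ?thesis by simp
qed

lemma cyl_in_sets:
  assumes "finite W" "W \<subseteq> V"
  shows "cyl W z \<in> sets M"
proof -
  have "{x \<in> space M. \<forall>v\<in>W. x v = z v} \<in> sets M"
    using assms coordinate_in_sets by (intro sets.sets_Collect_finite_All) auto
  then show ?thesis by (simp add: cyl_def)
qed

lemma determined_by_indicator_cyl: "determined_by W (indicator (cyl W z) :: _ \<Rightarrow> real)"
  unfolding determined_by_def cyl_def indicator_def by fastforce

lemma local_expansion: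
  fixes f :: "('v \<Rightarrow> 'a) \<Rightarrow> real"
  assumes W: "finite W" "W \<subseteq> V" and f: "determined_by W f" and x: "x \<in> \<Omega>" and t: "t \<in> \<Omega>"
  shows "f x = (\<Sum>z\<in>PiE W A. f (override_on t z W) * indicator (cyl W z) x)"
proof -
  let ?z = "restrict x W"
  have z: "?z \<in> PiE W A" using x W by (auto simp: PiE_iff)
  have "(\<Sum>z\<in>PiE W A. f (override_on t z W) * indicator (cyl W z) x)
      = (\<Sum>z\<in>{?z}. f (override_on t z W) * indicator (cyl W z) x)"
  proof (rule sum.mono_neutral_right)
    show "finite (PiE W A)" using finite_PiE_alphabets[OF W] .
    show "\<forall>z\<in>PiE W A - {?z}. f (override_on t z W) * indicator (cyl W z) x = 0"
    proof
      fix z assume z': "z \<in> PiE W A - {?z}"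
      have "x \<notin> cyl W z"
      proof
        assume "x \<in> cyl W z"
        then have "z = ?z" using z' by (auto simp: cyl_def PiE_iff extensional_def restrict_def)
        then show False using z' by simp
      qed
      then show "f (override_on t z W) * indicator (cyl W z) x = 0" by simp
    qed
  qed (use z in simp)
  also have "\<dots> = f (override_on t ?z W)" using x by (simp add: cyl_def)
  also have "\<dots> = f x"
    using override_in_\<Omega>[OF t z W(2)] x by (intro determined_byD[OF f]) auto
  finally show ?thesis by simp
qed

lemma determined_by_measurable:
  fixes f :: "('v \<Rightarrow> 'a) \<Rightarrow> real"
  assumes W: "finite W" "W \<subseteq> V" and f: "determined_by W f"
    and N: "space N = \<Omega>" "\<And>z. cyl W z \<in> sets N"
  shows "f \<in> borel_measurable N"
proof -
  obtain t where t: "t \<in> \<Omega>" using \<Omega>_nonempty by auto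
  have "(\<lambda>x. \<Sum>z\<in>PiE W A. f (override_on t z W) * indicator (cyl W z) x) \<in> borel_measurable N"
    using N(2) by simp
  then show ?thesis
    by (subst measurable_cong[OF local_expansion[OF W f _ t]]) (auto simp: N(1))
qed

lemma local_fun_measurable:
  assumes "local_fun f"
  shows "f \<in> borel_measurable M"
proof -
  obtain W where W: "finite W" "W \<subseteq> V" "determined_by W f"
    using assms by (auto simp: local_fun_def)
  then show ?thesis
    by (intro determined_by_measurable[OF W] cyl_in_sets) auto
qed

lemma local_fun_bounded:
  assumes "local_fun f"
  obtains b where "\<And>x. x \<in> \<Omega> \<Longrightarrow> \<bar>f x\<bar> \<le> b"
proof -
  obtain W where W: "finite W" "W \<subseteq> V" "determined_by W f"
    using assms by (auto simp: local_fun_def)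
  obtain t where t: "t \<in> \<Omega>" using \<Omega>_nonempty by auto
  have "\<bar>f x\<bar> \<le> (\<Sum>z\<in>PiE W A. \<bar>f (override_on t z W)\<bar>)" if "x \<in> \<Omega>" for x
    unfolding local_expansion[OF W that t]
    by (rule order.trans[OF sum_abs]) (auto intro!: sum_mono simp: indicator_def)
  then show ?thesis using that by blast
qed

lemma local_fun_spec:
  assumes "finite \<Lambda>" "\<Lambda> \<subseteq> V" "local_fun f"
  shows "local_fun (spec \<Lambda> f)"
proof -
  obtain W where "finite W" "W \<subseteq> V" "determined_by W f"
    using assms by (auto simp: local_fun_def)
  then show ?thesis
    using determined_by_spec[OF assms(2)] finite_reach[OF assms(1,2)] reach_subset
    unfolding local_fun_def by (intro exI[of _ "W \<union> reach \<Lambda>"]) auto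
qed

lemma local_fun_indicator_cyl:
  "finite W \<Longrightarrow> W \<subseteq> V \<Longrightarrow> local_fun (indicator (cyl W z))"
  unfolding local_fun_def using determined_by_indicator_cyl by blast

text \<open>
  Cylinders over a common finite set are disjoint, so every product set with finitely many
  constrained coordinates is a finite disjoint union of them, and those product sets form an
  intersection-stable generator.
\<close>

lemma measure_eqI_cyl:
  assumes sets: "sets P = sets M" "sets Q = sets M" and fin: "finite_measure P"
    and eq: "\<And>W z. finite W \<Longrightarrow> W \<subseteq> V \<Longrightarrow> z \<in> PiE W A \<Longrightarrow> emeasure P (cyl W z) = emeasure Q (cyl W z)"
  shows "P = Q"
proof (rule measure_eqI_PiM_infinite[where I = V and M = "\<lambda>v. count_space (A v)"])
  show "sets P = sets (PiM V (\<lambda>v. count_space (A v)))" "sets Q = sets (PiM V (\<lambda>v. count_space (A v)))"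
    using sets by (simp_all add: config_space_def)
  show "finite_measure P" by fact
next
  fix X J assume J: "finite J" "J \<subseteq> V" and X: "\<And>i. i \<in> J \<Longrightarrow> X i \<in> sets (count_space (A i))"
  let ?E = "prod_emb V (\<lambda>v. count_space (A v)) J (PiE J X)"
  have XA: "PiE J X \<subseteq> PiE J A" using X by (intro PiE_mono) auto
  then have finX: "finite (PiE J X)" using finite_PiE_alphabets[OF J] finite_subset by blast
  have E: "?E = (\<Union>z\<in>PiE J X. cyl J z)"
  proof (intro equalityI subsetI)
    fix x assume "x \<in> ?E"
    then have "x \<in> \<Omega>" "restrict x J \<in> PiE J X" by (auto simp: prod_emb_def)
    then show "x \<in> (\<Union>z\<in>PiE J X. cyl J z)" by (auto simp: cyl_def intro!: bexI[of _ "restrict x J"])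
  next
    fix x assume "x \<in> (\<Union>z\<in>PiE J X. cyl J z)"
    then obtain z where "z \<in> PiE J X" "x \<in> \<Omega>" "\<forall>v\<in>J. x v = z v" by (auto simp: cyl_def)
    then show "x \<in> ?E" by (auto simp: prod_emb_def PiE_iff)
  qed
  have disj: "disjoint_family_on (cyl J) (PiE J X)"
    unfolding disjoint_family_on_def
  proof (intro ballI impI)
    fix z z' assume z: "z \<in> PiE J X" "z' \<in> PiE J X" "z \<noteq> z'"
    then obtain v where "v \<in> J" "z v \<noteq> z' v" by (meson PiE_ext)
    then show "cyl J z \<inter> cyl J z' = {}" by (auto simp: cyl_def)
  qed
  have em: "emeasure N ?E = (\<Sum>z\<in>PiE J X. emeasure N (cyl J z))" if "sets N = sets M" for N
    unfolding E using cyl_in_sets[OF J] that disj finX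
    by (intro sum_emeasure[symmetric]) auto
  have "(\<Sum>z\<in>PiE J X. emeasure P (cyl J z)) = (\<Sum>z\<in>PiE J X. emeasure Q (cyl J z))"
    using eq[OF J] XA by (intro sum.cong) auto
  then show "emeasure P ?E = emeasure Q ?E"
    using em[OF sets(1)] em[OF sets(2)] by simp
qed


section \<open>Averaging against the kernels\<close>

lemma measurable_override:
  assumes "z \<in> PiE \<Lambda> A" "\<Lambda> \<subseteq> V"
  shows "(\<lambda>x. override_on x z \<Lambda>) \<in> M \<rightarrow>\<^sub>M M"
proof -
  have "(\<lambda>x. override_on x z \<Lambda>) \<in> M \<rightarrow>\<^sub>M PiM V (\<lambda>v. count_space (A v))"
  proof (rule measurable_PiM_single')
    fix v assume v: "v \<in> V"
    show "(\<lambda>x. override_on x z \<Lambda> v) \<in> M \<rightarrow>\<^sub>M count_space (A v)"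
      using measurable_coordinate[OF v] assms(1) v
      by (cases "v \<in> \<Lambda>") (auto simp: override_on_def PiE_iff)
  next
    show "(\<lambda>x. override_on x z \<Lambda>) \<in> space M \<rightarrow> (\<Pi>\<^sub>E v\<in>V. space (count_space (A v)))"
      using override_in_\<Omega>[OF _ assms] by auto
  qed
  then show ?thesis by (simp add: config_space_def)
qed

lemma determined_by_weight: "determined_by (reach \<Lambda>) (weight \<Lambda>)"
  unfolding determined_by_def
proof (intro ballI impI)
  fix x y :: "'v \<Rightarrow> 'a" assume "\<forall>v\<in>reach \<Lambda>. x v = y v"
  then show "weight \<Lambda> x = weight \<Lambda> y" by (intro weight_cong) blast
qed

lemma local_fun_weight: "finite \<Lambda> \<Longrightarrow> \<Lambda> \<subseteq> V \<Longrightarrow> local_fun (weight \<Lambda>)"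
  unfolding local_fun_def
  by (intro exI[of _ "reach \<Lambda>"] conjI finite_reach reach_subset determined_by_weight)

lemma spec_measurable:
  assumes \<Lambda>: "finite \<Lambda>" "\<Lambda> \<subseteq> V" and f: "f \<in> borel_measurable M"
  shows "spec \<Lambda> f \<in> borel_measurable M"
proof -
  let ?n = "\<lambda>x. \<Sum>z\<in>PiE \<Lambda> A. weight \<Lambda> (override_on x z \<Lambda>) * f (override_on x z \<Lambda>)"
  let ?d = "\<lambda>x. \<Sum>z\<in>PiE \<Lambda> A. weight \<Lambda> (override_on x z \<Lambda>)"
  have w: "(\<lambda>x. weight \<Lambda> (override_on x z \<Lambda>)) \<in> borel_measurable M"
    if "z \<in> PiE \<Lambda> A" for z
    by (rule measurable_compose[OF measurable_override[OF that \<Lambda>(2)]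
          local_fun_measurable[OF local_fun_weight[OF \<Lambda>]]])
  have wf: "(\<lambda>x. f (override_on x z \<Lambda>)) \<in> borel_measurable M" if "z \<in> PiE \<Lambda> A" for z
    by (rule measurable_compose[OF measurable_override[OF that \<Lambda>(2)] f])
  have "(\<lambda>x. ?n x / ?d x) \<in> borel_measurable M"
    by (intro borel_measurable_divide borel_measurable_sum borel_measurable_times w wf)
  moreover have "spec \<Lambda> f x = ?n x / ?d x" if "x \<in> space M" for x
    using that by (simp add: spec_def partition_sum_def sum_agree[OF _ \<Lambda>(2)])
  ultimately show ?thesis
    using measurable_cong[of M "spec \<Lambda> f" "\<lambda>x. ?n x / ?d x" borel] by blast
qed

abbreviation kernel :: "'v set \<Rightarrow> ('v \<Rightarrow> 'a) \<Rightarrow> ('v \<Rightarrow> 'a) measure" where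
  "kernel \<equiv> gibbs_kernel V A \<Phi>"

lemma kernel_eq:
  "kernel \<Lambda> x = distr (point_measure (agree \<Lambda> x)
      (\<lambda>y. ennreal (weight \<Lambda> y / partition_sum \<Lambda> x))) M (\<lambda>y. y)"
  by (simp add: gibbs_kernel_def Let_def weight_def partition_sum_def)

lemma sets_kernel [simp]: "sets (kernel \<Lambda> x) = sets M"
  by (simp add: kernel_eq)

lemma measurable_point_measure_agree:
  "(\<lambda>y. y) \<in> point_measure (agree \<Lambda> x) p \<rightarrow>\<^sub>M M"
  using agree_subset by (auto simp: measurable_def point_measure_def)

lemma prob_space_kernel:
  assumes x: "x \<in> \<Omega>" and \<Lambda>: "finite \<Lambda>" "\<Lambda> \<subseteq> V"
  shows "prob_space (kernel \<Lambda> x)"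
proof -
  let ?p = "\<lambda>y. weight \<Lambda> y / partition_sum \<Lambda> x"
  have "emeasure (point_measure (agree \<Lambda> x) (\<lambda>y. ennreal (?p y))) (agree \<Lambda> x)
      = (\<Sum>y\<in>agree \<Lambda> x. ennreal (?p y))"
    using finite_agree[OF assms] by (simp add: emeasure_point_measure_finite2)
  also have "\<dots> = ennreal (\<Sum>y\<in>agree \<Lambda> x. ?p y)"
    using partition_sum_pos[OF assms] weight_pos by (intro sum_ennreal) (auto intro: less_imp_le)
  also have "\<dots> = 1" using sum_prob_eq_1[OF assms] by simp
  finally have "prob_space (point_measure (agree \<Lambda> x) (\<lambda>y. ennreal (?p y)))"
    by (intro prob_spaceI) (simp add: space_point_measure)
  then show ?thesis
    unfolding kernel_eq by (rule prob_space.prob_space_distr[OF _ measurable_point_measure_agree])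
qed

lemma integral_kernel:
  assumes x: "x \<in> \<Omega>" and \<Lambda>: "finite \<Lambda>" "\<Lambda> \<subseteq> V" and f: "f \<in> borel_measurable M"
  shows "(\<integral>y. f y \<partial>kernel \<Lambda> x) = spec \<Lambda> f x"
proof -
  let ?p = "\<lambda>y. weight \<Lambda> y / partition_sum \<Lambda> x"
  have p: "0 \<le> ?p y" for y
    using partition_sum_pos[OF x \<Lambda>] weight_pos[of \<Lambda> y] by simp
  have "(\<integral>y. f y \<partial>kernel \<Lambda> x) = (\<integral>y. f y \<partial>point_measure (agree \<Lambda> x) (\<lambda>y. ennreal (?p y)))"
    unfolding kernel_eq by (rule integral_distr[OF measurable_point_measure_agree f])
  also have "\<dots> = (\<Sum>y\<in>agree \<Lambda> x. ?p y *\<^sub>R f y)"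
    using finite_agree[OF x \<Lambda>] p by (rule lebesgue_integral_point_measure_finite)
  finally show ?thesis by (simp add: spec_eq_sum)
qed

lemma emeasure_kernel:
  assumes x: "x \<in> \<Omega>" and \<Lambda>: "finite \<Lambda>" "\<Lambda> \<subseteq> V" and B: "B \<in> sets M"
  shows "emeasure (kernel \<Lambda> x) B = ennreal (spec \<Lambda> (indicator B) x)"
proof -
  interpret prob_space "kernel \<Lambda> x" by (rule prob_space_kernel[OF x \<Lambda>])
  have "spec \<Lambda> (indicator B) x = measure (kernel \<Lambda> x) B"
    using integral_kernel[OF x \<Lambda>, of "indicator B"] B by simp
  then show ?thesis by (simp add: emeasure_eq_measure)
qed

lemma kernel_measurable:
  assumes \<Lambda>: "finite \<Lambda>" "\<Lambda> \<subseteq> V"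
  shows "kernel \<Lambda> \<in> M \<rightarrow>\<^sub>M subprob_algebra M"
proof (rule measurable_subprob_algebra)
  fix B assume B: "B \<in> sets M"
  have "(\<lambda>x. ennreal (spec \<Lambda> (indicator B) x)) \<in> borel_measurable M"
    using spec_measurable[OF \<Lambda>, of "indicator B"] B by simp
  then show "(\<lambda>x. emeasure (kernel \<Lambda> x) B) \<in> borel_measurable M"
    by (subst measurable_cong[OF emeasure_kernel[OF _ \<Lambda> B]]) auto
qed (use prob_space_kernel[OF _ \<Lambda>] prob_space_imp_subprob_space in auto)

lemma config_measuresD:
  assumes "\<mu> \<in> config_measures V A"
  shows "prob_space \<mu>" "sets \<mu> = sets M" "space \<mu> = \<Omega>"
proof -
  show "prob_space \<mu>" "sets \<mu> = sets M" using assms by (auto simp: config_measures_def)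
  then show "space \<mu> = \<Omega>" using sets_eq_imp_space_eq space_M by blast
qed

lemma integrable_bounded:
  fixes f :: "('v \<Rightarrow> 'a) \<Rightarrow> real"
  assumes \<mu>: "\<mu> \<in> config_measures V A" and f: "f \<in> borel_measurable M"
    and b: "\<And>x. x \<in> \<Omega> \<Longrightarrow> \<bar>f x\<bar> \<le> b"
  shows "integrable \<mu> f"
proof -
  interpret prob_space \<mu> using config_measuresD[OF \<mu>] by simp
  have "f \<in> borel_measurable \<mu>"
    using f measurable_cong_sets[OF config_measuresD(2)[OF \<mu>] refl] by blast
  then show ?thesis
    using b config_measuresD(3)[OF \<mu>] by (intro integrable_const_bound[of _ b]) auto
qed

lemma sets_averaged:
  assumes \<mu>: "\<mu> \<in> config_measures V A" and \<Lambda>: "finite \<Lambda>" "\<Lambda> \<subseteq> V"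
  shows "sets (averaged V A \<Phi> \<Lambda> \<mu>) = sets M"
  unfolding averaged_def
  using config_measuresD[OF \<mu>] \<Omega>_nonempty by (intro sets_bind) auto

lemma emeasure_averaged:
  assumes \<mu>: "\<mu> \<in> config_measures V A" and \<Lambda>: "finite \<Lambda>" "\<Lambda> \<subseteq> V" and B: "B \<in> sets M"
  shows "emeasure (averaged V A \<Phi> \<Lambda> \<mu>) B = ennreal (\<integral>x. spec \<Lambda> (indicator B) x \<partial>\<mu>)"
proof -
  note \<mu>' = config_measuresD[OF \<mu>]
  have K: "kernel \<Lambda> \<in> \<mu> \<rightarrow>\<^sub>M subprob_algebra M"
    using kernel_measurable[OF \<Lambda>] measurable_cong_sets[OF \<mu>'(2) refl] by blast
  have bnd: "0 \<le> spec \<Lambda> (indicator B) x" "spec \<Lambda> (indicator B) x \<le> 1" if "x \<in> \<Omega>" for x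
    using that by (auto intro!: spec_ge_const spec_le_const \<Lambda> simp: indicator_def)
  have "emeasure (averaged V A \<Phi> \<Lambda> \<mu>) B = (\<integral>\<^sup>+x. emeasure (kernel \<Lambda> x) B \<partial>\<mu>)"
    unfolding averaged_def using \<Omega>_nonempty \<mu>'(3) K B by (intro emeasure_bind) auto
  also have "\<dots> = (\<integral>\<^sup>+x. ennreal (spec \<Lambda> (indicator B) x) \<partial>\<mu>)"
    using emeasure_kernel[OF _ \<Lambda> B] \<mu>'(3) by (intro nn_integral_cong) auto
  also have "\<dots> = ennreal (\<integral>x. spec \<Lambda> (indicator B) x \<partial>\<mu>)"
    using bnd \<mu>'(3) B spec_measurable[OF \<Lambda>]
    by (intro nn_integral_eq_integral integrable_bounded[OF \<mu>, of _ 1]) auto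
  finally show ?thesis .
qed

lemma integral_averaged:
  fixes f :: "('v \<Rightarrow> 'a) \<Rightarrow> real"
  assumes \<mu>: "\<mu> \<in> config_measures V A" and \<Lambda>: "finite \<Lambda>" "\<Lambda> \<subseteq> V"
    and f: "f \<in> borel_measurable M" and b: "\<And>x. x \<in> \<Omega> \<Longrightarrow> \<bar>f x\<bar> \<le> b"
  shows "(\<integral>x. f x \<partial>averaged V A \<Phi> \<Lambda> \<mu>) = (\<integral>x. spec \<Lambda> f x \<partial>\<mu>)"
proof -
  note \<mu>' = config_measuresD[OF \<mu>]
  interpret prob_space \<mu> by (rule \<mu>')
  have K: "kernel \<Lambda> \<in> \<mu> \<rightarrow>\<^sub>M subprob_algebra M"
    using kernel_measurable[OF \<Lambda>] measurable_cong_sets[OF \<mu>'(2) refl] by blast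
  have "(\<integral>x. f x \<partial>averaged V A \<Phi> \<Lambda> \<mu>) = (\<integral>x. (\<integral>y. f y \<partial>kernel \<Lambda> x) \<partial>\<mu>)"
    unfolding averaged_def
  proof (rule integral_bind[where K = M and B = b and B' = 1])
    show "AE x in \<mu>. emeasure (kernel \<Lambda> x) (space (kernel \<Lambda> x)) \<le> ennreal 1"
      using \<mu>'(3) prob_space.emeasure_space_1[OF prob_space_kernel[OF _ \<Lambda>]] by (intro AE_I2) auto
  qed (use f b K finite_measure_axioms in auto)
  also have "\<dots> = (\<integral>x. spec \<Lambda> f x \<partial>\<mu>)"
    using integral_kernel[OF _ \<Lambda> f] \<mu>'(3) by (intro Bochner_Integration.integral_cong) auto
  finally show ?thesis .
qed


section \<open>Screening by a set of sites\<close>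

definition coordinate_algebra :: "'v set \<Rightarrow> ('v \<Rightarrow> 'a) set set" where
  "coordinate_algebra S = sigma_sets \<Omega> (\<Union>v\<in>S. (\<lambda>a. {x \<in> \<Omega>. x v = a}) ` A v)"

definition saturated_sets :: "('v \<Rightarrow> 'a) measure \<Rightarrow> 'v set \<Rightarrow> ('v \<Rightarrow> 'a) set set" where
  "saturated_sets \<nu> S = (\<Inter>F\<in>{F. finite F \<and> F \<subseteq> V}. null_completion \<nu>
     (sigma_sets \<Omega> (coordinate_algebra S \<union> coordinate_algebra (V - F))))"

definition coordinate_space :: "'v set \<Rightarrow> ('v \<Rightarrow> 'a) measure" where
  "coordinate_space S = sigma \<Omega> (\<Union>v\<in>S. (\<lambda>a. {x \<in> \<Omega>. x v = a}) ` A v)"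

lemma space_coordinate_space [simp]: "space (coordinate_space S) = \<Omega>"
  unfolding coordinate_space_def by (rule space_measure_of) auto

lemma sets_coordinate_space: "sets (coordinate_space S) = coordinate_algebra S"
  unfolding coordinate_space_def coordinate_algebra_def by (rule sets_measure_of) auto

lemma coordinate_algebra_subset_sets:
  assumes "S \<subseteq> V"
  shows "coordinate_algebra S \<subseteq> sets M"
  unfolding coordinate_algebra_def space_M[symmetric]
  using assms coordinate_in_sets by (intro sets.sigma_sets_subset) auto

lemma coordinate_algebra_mem_iff:
  assumes "B \<in> coordinate_algebra S" "x \<in> \<Omega>" "y \<in> \<Omega>" "\<And>v. v \<in> S \<Longrightarrow> x v = y v"
  shows "x \<in> B \<longleftrightarrow> y \<in> B"
  using assms(1) unfolding coordinate_algebra_def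
  by (rule sigma_sets_mem_iff) (use assms(2-4) in auto)

lemma cyl_in_coordinate_algebra:
  assumes "finite W" "W \<subseteq> S" "S \<subseteq> V"
  shows "cyl W z \<in> coordinate_algebra S"
proof -
  have "{x \<in> \<Omega>. x v = z v} \<in> coordinate_algebra S" if "v \<in> W" for v
  proof (cases "z v \<in> A v")
    case True
    then show ?thesis
      using that assms(2) unfolding coordinate_algebra_def by (intro sigma_sets.Basic) auto
  next
    case False
    moreover have "v \<in> V" using that assms by auto
    ultimately have "{x \<in> \<Omega>. x v = z v} = {}" by (auto dest: PiE_mem)
    then show ?thesis unfolding coordinate_algebra_def by (metis sigma_sets.Empty)
  qed
  then have "{x \<in> space (coordinate_space S). \<forall>v\<in>W. x v = z v} \<in> sets (coordinate_space S)"
    using assms(1) by (intro sets.sets_Collect_finite_All) (auto simp: sets_coordinate_space)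
  then show ?thesis by (simp add: cyl_def sets_coordinate_space)
qed

lemma determined_by_coordinate_measurable:
  fixes u :: "('v \<Rightarrow> 'a) \<Rightarrow> real"
  assumes u: "u \<in> borel_measurable (coordinate_space S)"
  shows "determined_by S u"
  unfolding determined_by_def
proof (intro ballI impI)
  fix x y assume xy: "x \<in> \<Omega>" "y \<in> \<Omega>" "\<forall>v\<in>S. x v = y v"
  have "u -` {u x} \<inter> space (coordinate_space S) \<in> sets (coordinate_space S)"
    using u by (rule measurable_sets) simp
  then have "u -` {u x} \<inter> \<Omega> \<in> coordinate_algebra S"
    by (simp add: sets_coordinate_space)
  from coordinate_algebra_mem_iff[OF this xy(1,2)] xy show "u x = u y" by auto
qed

lemma fill_in_\<Omega>: "t \<in> \<Omega> \<Longrightarrow> x \<in> \<Omega> \<Longrightarrow> override_on t x S \<in> \<Omega>"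
  by (auto simp: PiE_iff override_on_def extensional_def)

lemma determined_by_fill:
  assumes "determined_by W h" "t \<in> \<Omega>"
  shows "determined_by (W \<inter> S) (\<lambda>x. h (override_on t x S))"
  unfolding determined_by_def
proof (intro ballI impI)
  fix x y assume xy: "x \<in> \<Omega>" "y \<in> \<Omega>" "\<forall>v\<in>W \<inter> S. x v = y v"
  show "h (override_on t x S) = h (override_on t y S)"
    using xy by (intro determined_byD[OF assms(1)] fill_in_\<Omega> assms(2)) (auto simp: override_on_def)
qed

lemma local_fun_fill:
  assumes "local_fun h" "t \<in> \<Omega>"
  shows "local_fun (\<lambda>x. h (override_on t x S))"
proof -
  obtain W where W: "finite W" "W \<subseteq> V" "determined_by W h"
    using assms(1) by (auto simp: local_fun_def)
  show ?thesis
    unfolding local_fun_def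
    using W determined_by_fill[OF W(3) assms(2), of S] by (intro exI[of _ "W \<inter> S"]) auto
qed

lemma fill_measurable:
  assumes h: "local_fun h" and t: "t \<in> \<Omega>" and S: "S \<subseteq> V"
  shows "(\<lambda>x. h (override_on t x S)) \<in> borel_measurable (coordinate_space S)"
proof -
  obtain W where W: "finite W" "W \<subseteq> V" "determined_by W h"
    using h by (auto simp: local_fun_def)
  show ?thesis
    using W S determined_by_fill[OF W(3) t, of S] by (intro determined_by_measurable[of "W \<inter> S"])
      (auto simp: sets_coordinate_space intro!: cyl_in_coordinate_algebra)
qed

text \<open>
  Screening by \<open>S\<close> means that in the mean over \<open>\<nu>\<close> the expectation of \<open>f\<close> in a suitable volume
  disjoint from \<open>S\<close> hardly notices when the configuration off \<open>S\<close> is replaced by the fixed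
  reference configuration \<open>t\<close>. The replaced expectation is measurable with respect to \<open>S\<close>.
\<close>

definition screened :: "('v \<Rightarrow> 'a) measure \<Rightarrow> 'v set \<Rightarrow> (('v \<Rightarrow> 'a) \<Rightarrow> real) \<Rightarrow> bool" where
  "screened \<nu> S f \<longleftrightarrow> (\<exists>t\<in>\<Omega>. \<forall>e>0. \<exists>\<Lambda>. finite \<Lambda> \<and> \<Lambda> \<subseteq> V - S \<and>
     (\<integral>x. \<bar>spec \<Lambda> f x - spec \<Lambda> f (override_on t x S)\<bar> \<partial>\<nu>) \<le> e)"

lemma measurable_from_coordinate:
  assumes "S \<subseteq> V" "u \<in> borel_measurable (coordinate_space S)"
  shows "u \<in> borel_measurable M"
  using assms coordinate_algebra_subset_sets[OF assms(1)]
  by (intro measurable_from_subalg[of M "coordinate_space S"])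
    (auto simp: subalgebra_def sets_coordinate_space)

text \<open>
  A version of the conditional probability with values in the unit interval everywhere, which
  makes all integrability questions about it trivial.
\<close>

lemma conditional_probability:
  assumes \<nu>: "\<nu> \<in> config_measures V A" and S: "S \<subseteq> V" and B: "B \<in> sets M"
  obtains u :: "('v \<Rightarrow> 'a) \<Rightarrow> real"
  where "u \<in> borel_measurable (coordinate_space S)" "\<And>x. 0 \<le> u x" "\<And>x. u x \<le> 1"
    "\<forall>g\<in>borel_measurable (coordinate_space S). (\<exists>b. \<forall>x\<in>\<Omega>. \<bar>g x\<bar> \<le> b)
      \<longrightarrow> (\<integral>x. g x * u x \<partial>\<nu>) = (\<integral>x. g x * indicator B x \<partial>\<nu>)"
proof -
  note \<nu>' = config_measuresD[OF \<nu>]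
  interpret prob_space \<nu> by (rule \<nu>')
  let ?F = "coordinate_space S"
  have sub: "subalgebra \<nu> ?F"
    using coordinate_algebra_subset_sets[OF S] \<nu>' by (simp add: subalgebra_def sets_coordinate_space)
  interpret sigma_finite_subalgebra \<nu> ?F
    by (rule finite_measure_subalgebra_is_sigma_finite)
      (simp add: finite_measure_subalgebra_def finite_measure_subalgebra_axioms_def sub finite_measure_axioms)
  define w where "w = real_cond_exp \<nu> ?F (indicator B)"
  define u where "u x = max 0 (min 1 (w x))" for x
  have B': "B \<in> sets \<nu>" using B \<nu>' by simp
  have int: "integrable \<nu> (indicator B :: _ \<Rightarrow> real)"
    using B' by (simp add: emeasure_eq_measure)
  have w: "w \<in> borel_measurable ?F" unfolding w_def by simp
  have "AE x in \<nu>. w x \<ge> 0"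
    unfolding w_def by (rule real_cond_exp_ge_c[OF int]) simp
  moreover have "AE x in \<nu>. w x \<le> 1"
    unfolding w_def by (rule real_cond_exp_le_c[OF int]) (simp add: indicator_def)
  ultimately have uw: "AE x in \<nu>. u x = w x" by eventually_elim (auto simp: u_def)
  show ?thesis
  proof (rule that)
    show "u \<in> borel_measurable ?F" unfolding u_def using w by measurable
    show "0 \<le> u x" "u x \<le> 1" for x by (auto simp: u_def)
    show "\<forall>g\<in>borel_measurable ?F. (\<exists>b. \<forall>x\<in>\<Omega>. \<bar>g x\<bar> \<le> b)
      \<longrightarrow> (\<integral>x. g x * u x \<partial>\<nu>) = (\<integral>x. g x * indicator B x \<partial>\<nu>)"
    proof (intro ballI impI)
      fix g :: "('v \<Rightarrow> 'a) \<Rightarrow> real"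
      assume g: "g \<in> borel_measurable ?F" and "\<exists>b. \<forall>x\<in>\<Omega>. \<bar>g x\<bar> \<le> b"
      then obtain b where b: "\<And>x. x \<in> \<Omega> \<Longrightarrow> \<bar>g x\<bar> \<le> b" by auto
      have gM: "g \<in> borel_measurable M" by (rule measurable_from_coordinate[OF S g])
      have "integrable \<nu> (\<lambda>x. g x * indicator B x)"
      proof (rule integrable_bounded[OF \<nu>, of _ b])
        show "(\<lambda>x. g x * indicator B x) \<in> borel_measurable M" using gM B by simp
        show "\<bar>g x * indicator B x\<bar> \<le> b" if "x \<in> \<Omega>" for x
          using b[OF that] by (auto simp: indicator_def)
      qed
      then have "(\<integral>x. g x * w x \<partial>\<nu>) = (\<integral>x. g x * indicator B x \<partial>\<nu>)"
        unfolding w_def using g B' by (intro real_cond_exp_intg(2)) auto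
      moreover have "(\<integral>x. g x * u x \<partial>\<nu>) = (\<integral>x. g x * w x \<partial>\<nu>)"
      proof (rule integral_cong_AE)
        have "g \<in> borel_measurable \<nu>" "w \<in> borel_measurable \<nu>"
          using measurable_from_subalg[OF sub] g w by auto
        then show "(\<lambda>x. g x * u x) \<in> borel_measurable \<nu>" "(\<lambda>x. g x * w x) \<in> borel_measurable \<nu>"
          unfolding u_def by auto
      qed (use uw in \<open>eventually_elim, simp\<close>)
      ultimately show "(\<integral>x. g x * u x \<partial>\<nu>) = (\<integral>x. g x * indicator B x \<partial>\<nu>)" by simp
    qed
  qed
qed

lemma gibbs_measureD:
  assumes "gibbs_measure V A \<Phi> \<nu>"
  shows "\<nu> \<in> config_measures V A"
    and "finite \<Lambda> \<Longrightarrow> \<Lambda> \<subseteq> V \<Longrightarrow> averaged V A \<Phi> \<Lambda> \<nu> = \<nu>"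
  using assms by (auto simp: gibbs_measure_def)

lemma gibbs_integral:
  fixes f :: "('v \<Rightarrow> 'a) \<Rightarrow> real"
  assumes \<nu>: "gibbs_measure V A \<Phi> \<nu>" and \<Lambda>: "finite \<Lambda>" "\<Lambda> \<subseteq> V"
    and f: "f \<in> borel_measurable M" "\<And>x. x \<in> \<Omega> \<Longrightarrow> \<bar>f x\<bar> \<le> b"
  shows "(\<integral>x. f x \<partial>\<nu>) = (\<integral>x. spec \<Lambda> f x \<partial>\<nu>)"
  using integral_averaged[OF gibbs_measureD(1)[OF \<nu>] \<Lambda> f] gibbs_measureD(2)[OF \<nu> \<Lambda>] by simp

text \<open>
  A factor that ignores the sites of \<open>\<Lambda>\<close> passes through the kernel; hence \<open>spec \<Lambda> f\<close> is the
  conditional expectation of \<open>f\<close> given the configuration off \<open>\<Lambda>\<close>.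
\<close>

lemma gibbs_integral_mult:
  fixes f g :: "('v \<Rightarrow> 'a) \<Rightarrow> real"
  assumes \<nu>: "gibbs_measure V A \<Phi> \<nu>" and \<Lambda>: "finite \<Lambda>" "\<Lambda> \<subseteq> V"
    and f: "f \<in> borel_measurable M" "\<And>x. x \<in> \<Omega> \<Longrightarrow> \<bar>f x\<bar> \<le> b"
    and g: "g \<in> borel_measurable M" "\<And>x. x \<in> \<Omega> \<Longrightarrow> \<bar>g x\<bar> \<le> 1"
    and inv: "\<And>x y. x \<in> \<Omega> \<Longrightarrow> y \<in> agree \<Lambda> x \<Longrightarrow> g y = g x"
  shows "(\<integral>x. f x * g x \<partial>\<nu>) = (\<integral>x. g x * spec \<Lambda> f x \<partial>\<nu>)"
proof -
  have "(\<integral>x. f x * g x \<partial>\<nu>) = (\<integral>x. spec \<Lambda> (\<lambda>x. f x * g x) x \<partial>\<nu>)"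
  proof (rule gibbs_integral[OF \<nu> \<Lambda>])
    show "(\<lambda>x. f x * g x) \<in> borel_measurable M" using f(1) g(1) by simp
    show "\<bar>f x * g x\<bar> \<le> b" if "x \<in> \<Omega>" for x
      using mult_mono[OF f(2)[OF that] g(2)[OF that]] f(2)[OF that] by (simp add: abs_mult)
  qed
  also have "\<dots> = (\<integral>x. g x * spec \<Lambda> f x \<partial>\<nu>)"
    using config_measuresD(3)[OF gibbs_measureD(1)[OF \<nu>]] inv
    by (intro Bochner_Integration.integral_cong refl spec_mult_boundary) auto
  finally show ?thesis .
qed

lemma local_spec_bounded:
  assumes "finite \<Lambda>" "\<Lambda> \<subseteq> V" "\<And>x. x \<in> \<Omega> \<Longrightarrow> \<bar>f x\<bar> \<le> b" "x \<in> \<Omega>"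
  shows "\<bar>spec \<Lambda> f x\<bar> \<le> b"
  using assms(3) agree_subset by (intro spec_abs_le assms(1,2,4)) blast

lemma saturated_setsD:
  assumes B: "B \<in> saturated_sets \<nu> S" and F: "finite F" "F \<subseteq> V" and S: "S \<subseteq> V"
  obtains C where "C \<in> sets M" "AE x in \<nu>. x \<in> B \<longleftrightarrow> x \<in> C"
    "determined_by (S \<union> (V - F)) (\<lambda>x. x \<in> C)"
proof -
  let ?G = "coordinate_algebra S \<union> coordinate_algebra (V - F)"
  have "B \<in> null_completion \<nu> (sigma_sets \<Omega> ?G)"
    using B F by (auto simp: saturated_sets_def)
  then obtain C where C: "C \<in> sigma_sets \<Omega> ?G" "AE x in \<nu>. x \<in> B \<longleftrightarrow> x \<in> C"
    by (rule null_completionD)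
  show ?thesis
  proof (rule that)
    have "sigma_sets (space M) ?G \<subseteq> sets M"
      using coordinate_algebra_subset_sets[OF S] coordinate_algebra_subset_sets[of "V - F"]
      by (intro sets.sigma_sets_subset) auto
    then show "C \<in> sets M" using C(1) by auto
    show "AE x in \<nu>. x \<in> B \<longleftrightarrow> x \<in> C" by fact
    show "determined_by (S \<union> (V - F)) (\<lambda>x. x \<in> C)"
      unfolding determined_by_def
    proof (intro ballI impI)
      fix x y assume xy: "x \<in> \<Omega>" "y \<in> \<Omega>" "\<forall>v\<in>S \<union> (V - F). x v = y v"
      from C(1) xy(1,2) show "x \<in> C \<longleftrightarrow> y \<in> C"
      proof (rule sigma_sets_mem_iff)
        fix E assume "E \<in> ?G"
        then show "x \<in> E \<longleftrightarrow> y \<in> E"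
          using coordinate_algebra_mem_iff[of E S x y] coordinate_algebra_mem_iff[of E "V - F" x y] xy
          by auto
      qed
    qed
  qed
qed

text \<open>
  Let \<open>u\<close> be the conditional probability of the saturated set \<open>B\<close> given \<open>S\<close>. Up to a null set
  \<open>B\<close> does not depend on the finite set \<open>\<Lambda>\<close>, so both \<open>B\<close> and \<open>u\<close> see \<open>f\<close> only through
  \<open>spec \<Lambda> f\<close>; if that is nearly measurable with respect to \<open>S\<close>, then \<open>B\<close> and \<open>u\<close> cannot
  be told apart by \<open>f\<close>.
\<close>

lemma screened_integral_eq:
  fixes f u :: "('v \<Rightarrow> 'a) \<Rightarrow> real"
  assumes \<nu>: "gibbs_measure V A \<Phi> \<nu>" and S: "S \<subseteq> V"
    and f: "local_fun f" and scr: "screened \<nu> S f"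
    and B: "B \<in> saturated_sets \<nu> S"
    and B0: "B\<^sub>0 \<in> sets M" "AE x in \<nu>. x \<in> B \<longleftrightarrow> x \<in> B\<^sub>0"
    and u: "u \<in> borel_measurable (coordinate_space S)" "\<And>x. 0 \<le> u x" "\<And>x. u x \<le> 1"
      "\<forall>g\<in>borel_measurable (coordinate_space S). (\<exists>b. \<forall>x\<in>\<Omega>. \<bar>g x\<bar> \<le> b)
        \<longrightarrow> (\<integral>x. g x * u x \<partial>\<nu>) = (\<integral>x. g x * indicator B\<^sub>0 x \<partial>\<nu>)"
  shows "(\<integral>x. f x * indicator B\<^sub>0 x \<partial>\<nu>) = (\<integral>x. f x * u x \<partial>\<nu>)"
proof -
  note \<nu>c = gibbs_measureD(1)[OF \<nu>]
  note \<nu>' = config_measuresD[OF \<nu>c]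
  interpret prob_space \<nu> by (rule \<nu>')
  have measD: "h \<in> borel_measurable \<nu>" if "h \<in> borel_measurable M" for h :: "_ \<Rightarrow> real"
    using that measurable_cong_sets[OF \<nu>'(2) refl] by blast
  obtain b where b: "\<And>x. x \<in> \<Omega> \<Longrightarrow> \<bar>f x\<bar> \<le> b" using local_fun_bounded[OF f] by blast
  have fM: "f \<in> borel_measurable M" by (rule local_fun_measurable[OF f])
  have uM: "u \<in> borel_measurable M" by (rule measurable_from_coordinate[OF S u(1)])
  have u1: "\<bar>u x\<bar> \<le> 1" for x using u(2,3)[of x] by simp
  obtain t where t: "t \<in> \<Omega>" and app: "\<And>e. e > 0 \<Longrightarrow> \<exists>\<Lambda>. finite \<Lambda> \<and> \<Lambda> \<subseteq> V - S \<and>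
     (\<integral>x. \<bar>spec \<Lambda> f x - spec \<Lambda> f (override_on t x S)\<bar> \<partial>\<nu>) \<le> e"
    using scr unfolding screened_def by blast
  have "\<bar>(\<integral>x. f x * indicator B\<^sub>0 x \<partial>\<nu>) - (\<integral>x. f x * u x \<partial>\<nu>)\<bar> \<le> e" if e: "e > 0" for e
  proof -
    obtain \<Lambda> where \<Lambda>: "finite \<Lambda>" "\<Lambda> \<subseteq> V" "\<Lambda> \<inter> S = {}"
      and small: "(\<integral>x. \<bar>spec \<Lambda> f x - spec \<Lambda> f (override_on t x S)\<bar> \<partial>\<nu>) \<le> e"
      using app[OF e] by blast
    let ?h = "spec \<Lambda> f"
    let ?g = "\<lambda>x. ?h (override_on t x S)"
    obtain C where C: "C \<in> sets M" "AE x in \<nu>. x \<in> B \<longleftrightarrow> x \<in> C"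
      and inv: "determined_by (S \<union> (V - \<Lambda>)) (\<lambda>x. x \<in> C)"
      using saturated_setsD[OF B \<Lambda>(1,2) S] by blast
    let ?C = "indicator C :: _ \<Rightarrow> real"
    have agD: "y v = x v" if "y \<in> agree \<Lambda> x" "v \<in> S \<union> (V - \<Lambda>)" for x y v
      using that \<Lambda>(3) S by (auto simp: agreeing_off_def)
    have hM: "?h \<in> borel_measurable M" by (rule spec_measurable[OF \<Lambda>(1,2) fM])
    have hb: "\<bar>?h x\<bar> \<le> b" if "x \<in> \<Omega>" for x by (rule local_spec_bounded[OF \<Lambda>(1,2) b that])
    have gF: "?g \<in> borel_measurable (coordinate_space S)"
      by (rule fill_measurable[OF local_fun_spec[OF \<Lambda>(1,2) f] t S])
    have gM: "?g \<in> borel_measurable M" by (rule measurable_from_coordinate[OF S gF])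
    have gb: "\<bar>?g x\<bar> \<le> b" if "x \<in> \<Omega>" for x by (rule hb[OF fill_in_\<Omega>[OF t that]])
    have BC: "AE x in \<nu>. indicator B\<^sub>0 x = ?C x"
      using B0(2) C(2) by eventually_elim (auto simp: indicator_def)
    have swap: "(\<integral>x. k x * indicator B\<^sub>0 x \<partial>\<nu>) = (\<integral>x. k x * ?C x \<partial>\<nu>)"
      if "k \<in> borel_measurable M" for k :: "_ \<Rightarrow> real"
    proof (rule integral_cong_AE)
      show "(\<lambda>x. k x * indicator B\<^sub>0 x) \<in> borel_measurable \<nu>" "(\<lambda>x. k x * ?C x) \<in> borel_measurable \<nu>"
        using that B0(1) C(1) by (auto intro!: measD)
    qed (use BC in \<open>eventually_elim, simp\<close>)
    have int: "integrable \<nu> (\<lambda>x. k x * w x)"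
      if k: "k \<in> borel_measurable M" "\<And>x. x \<in> \<Omega> \<Longrightarrow> \<bar>k x\<bar> \<le> b"
        and w: "w \<in> borel_measurable M" "\<And>x. \<bar>w x\<bar> \<le> 1" for k w :: "_ \<Rightarrow> real"
    proof (rule integrable_bounded[OF \<nu>c, of _ b])
      show "(\<lambda>x. k x * w x) \<in> borel_measurable M" using k w by simp
      show "\<bar>k x * w x\<bar> \<le> b" if "x \<in> \<Omega>" for x
        using mult_mono[OF k(2)[OF that] w(2)[of x]] k(2)[OF that] by (simp add: abs_mult)
    qed
    have CM: "?C \<in> borel_measurable M" "\<bar>?C x\<bar> \<le> 1" for x
      using C(1) by (simp_all add: indicator_def)
    have "(\<integral>x. f x * indicator B\<^sub>0 x \<partial>\<nu>) = (\<integral>x. ?C x * ?h x \<partial>\<nu>)"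
      unfolding swap[OF fM]
    proof (rule gibbs_integral_mult[OF \<nu> \<Lambda>(1,2) fM b CM(1) CM(2)])
      fix x y assume "x \<in> \<Omega>" "y \<in> agree \<Lambda> x"
      moreover have "y \<in> \<Omega>" using \<open>y \<in> agree \<Lambda> x\<close> agree_subset by blast
      ultimately have "y \<in> C \<longleftrightarrow> x \<in> C" by (intro determined_byD[OF inv] agD)
      then show "?C y = ?C x" by (simp add: indicator_def)
    qed
    moreover have "(\<integral>x. f x * u x \<partial>\<nu>) = (\<integral>x. u x * ?h x \<partial>\<nu>)"
    proof (rule gibbs_integral_mult[OF \<nu> \<Lambda>(1,2) fM b uM u1])
      fix x y assume "x \<in> \<Omega>" "y \<in> agree \<Lambda> x"
      moreover have "y \<in> \<Omega>" using \<open>y \<in> agree \<Lambda> x\<close> agree_subset by blast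
      ultimately show "u y = u x"
        by (intro determined_byD[OF determined_by_coordinate_measurable[OF u(1)]] agD UnI1)
    qed
    moreover have "(\<integral>x. ?g x * ?C x \<partial>\<nu>) = (\<integral>x. ?g x * u x \<partial>\<nu>)"
    proof -
      have "\<exists>b. \<forall>x\<in>\<Omega>. \<bar>?g x\<bar> \<le> b" using gb by blast
      then show ?thesis using bspec[OF u(4) gF] swap[OF gM] by simp
    qed
    \<comment> \<open>As \<open>?g\<close> does not distinguish \<open>?C\<close> from \<open>u\<close>, it may be subtracted from \<open>?h\<close>.\<close>
    moreover have "(\<integral>x. (?C x - u x) * (?h x - ?g x) \<partial>\<nu>)
        = (\<integral>x. ?h x * ?C x \<partial>\<nu>) - (\<integral>x. ?h x * u x \<partial>\<nu>)
          - ((\<integral>x. ?g x * ?C x \<partial>\<nu>) - (\<integral>x. ?g x * u x \<partial>\<nu>))"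
    proof -
      have "(\<lambda>x. (?C x - u x) * (?h x - ?g x))
          = (\<lambda>x. (?h x * ?C x - ?h x * u x) - (?g x * ?C x - ?g x * u x))"
        by (rule ext) algebra
      then show ?thesis
        using int[OF hM hb CM] int[OF hM hb uM u1] int[OF gM gb CM] int[OF gM gb uM u1]
        by (simp only: Bochner_Integration.integral_diff Bochner_Integration.integrable_diff)
    qed
    ultimately have "(\<integral>x. f x * indicator B\<^sub>0 x \<partial>\<nu>) - (\<integral>x. f x * u x \<partial>\<nu>)
        = (\<integral>x. (?C x - u x) * (?h x - ?g x) \<partial>\<nu>)"
      by (simp add: mult.commute)
    also have "\<bar>\<dots>\<bar> \<le> (\<integral>x. \<bar>(?C x - u x) * (?h x - ?g x)\<bar> \<partial>\<nu>)"
      by (rule integral_abs_bound)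
    also have "\<dots> \<le> (\<integral>x. \<bar>?h x - ?g x\<bar> \<partial>\<nu>)"
    proof (rule integral_mono')
      show "integrable \<nu> (\<lambda>x. \<bar>?h x - ?g x\<bar>)"
        using integrable_bounded[OF \<nu>c hM hb] integrable_bounded[OF \<nu>c gM gb] by auto
      fix x
      have "\<bar>?C x - u x\<bar> \<le> 1" using u(2,3)[of x] by (auto simp: indicator_def)
      then show "\<bar>(?C x - u x) * (?h x - ?g x)\<bar> \<le> \<bar>?h x - ?g x\<bar>"
        by (simp add: abs_mult mult_left_le_one_le)
    qed simp
    also have "\<dots> \<le> e" by (rule small)
    finally show ?thesis .
  qed
  then have "\<bar>(\<integral>x. f x * indicator B\<^sub>0 x \<partial>\<nu>) - (\<integral>x. f x * u x \<partial>\<nu>)\<bar> \<le> 0"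
    by (rule field_le_epsilon[where y = "0::real", simplified])
  then show ?thesis by simp
qed

text \<open>
  When the screened functions span the cylinder indicators, the measures with densities \<open>1\<^sub>B\<close> and
  \<open>u\<close> agree on cylinders, hence everywhere; then \<open>B\<close> is the set where \<open>u\<close> takes the value \<open>1\<close>.
\<close>

proposition screening_imp_saturated:
  assumes \<nu>: "gibbs_measure V A \<Phi> \<nu>" and S: "S \<subseteq> V"
    and scr: "\<And>W z. finite W \<Longrightarrow> W \<subseteq> V \<Longrightarrow> z \<in> PiE W A \<Longrightarrow>
      \<exists>f g. local_fun f \<and> local_fun g \<and> screened \<nu> S f \<and> screened \<nu> S g \<and>
        (\<forall>x\<in>\<Omega>. indicator (cyl W z) x = f x - g x)"
  shows "equivalent_mod_0 \<nu> (saturated_sets \<nu> S) (coordinate_algebra S)"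
proof -
  note \<nu>c = gibbs_measureD(1)[OF \<nu>]
  note \<nu>' = config_measuresD[OF \<nu>c]
  interpret prob_space \<nu> by (rule \<nu>')
  have measD: "h \<in> borel_measurable \<nu>" if "h \<in> borel_measurable M" for h :: "_ \<Rightarrow> real"
    using that measurable_cong_sets[OF \<nu>'(2) refl] by blast
  have coord_sub: "C \<subseteq> \<Omega>" if "C \<in> coordinate_algebra S" for C
    using that coordinate_algebra_subset_sets[OF S] sets.sets_into_space[of C M] by auto
  have "\<exists>C\<in>coordinate_algebra S. sym_diff B C \<in> null_sets (completion \<nu>)"
    if B: "B \<in> saturated_sets \<nu> S" for B
  proof -
    have B\<Omega>: "B \<subseteq> space \<nu>" using B by (auto simp: saturated_sets_def null_completion_def)
    obtain B\<^sub>0 where B0: "B\<^sub>0 \<in> sets M" "AE x in \<nu>. x \<in> B \<longleftrightarrow> x \<in> B\<^sub>0"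
      using saturated_setsD[OF B finite.emptyI empty_subsetI S] by blast
    obtain u where u: "u \<in> borel_measurable (coordinate_space S)" "\<And>x. 0 \<le> u x" "\<And>x. u x \<le> (1::real)"
      "\<forall>g\<in>borel_measurable (coordinate_space S). (\<exists>b. \<forall>x\<in>\<Omega>. \<bar>g x\<bar> \<le> b)
        \<longrightarrow> (\<integral>x. g x * u x \<partial>\<nu>) = (\<integral>x. g x * indicator B\<^sub>0 x \<partial>\<nu>)"
      using conditional_probability[OF \<nu>c S B0(1)] by blast
    have uM: "u \<in> borel_measurable M" by (rule measurable_from_coordinate[OF S u(1)])
    have B0\<nu>: "B\<^sub>0 \<in> sets \<nu>" using B0(1) \<nu>' by simp
    let ?P = "density \<nu> (\<lambda>x. ennreal (indicator B\<^sub>0 x))" and ?Q = "density \<nu> (\<lambda>x. ennreal (u x))"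
    have dens: "emeasure (density \<nu> (\<lambda>x. ennreal (h x))) X = ennreal (\<integral>x. indicator X x * h x \<partial>\<nu>)"
      if h: "h \<in> borel_measurable M" "\<And>x. 0 \<le> h x" "\<And>x. h x \<le> 1" and X: "X \<in> sets M"
      for h :: "('v \<Rightarrow> 'a) \<Rightarrow> real" and X
    proof -
      have "emeasure (density \<nu> (\<lambda>x. ennreal (h x))) X = (\<integral>\<^sup>+x. ennreal (h x) * indicator X x \<partial>\<nu>)"
        using measD[OF h(1)] X \<nu>'(2) by (intro emeasure_density) auto
      also have "\<dots> = (\<integral>\<^sup>+x. ennreal (indicator X x * h x) \<partial>\<nu>)"
        by (intro nn_integral_cong) (auto simp: indicator_def)
      also have "\<dots> = ennreal (\<integral>x. indicator X x * h x \<partial>\<nu>)"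
      proof (rule nn_integral_eq_integral)
        show "integrable \<nu> (\<lambda>x. indicator X x * h x)"
        proof (rule integrable_bounded[OF \<nu>c, of _ 1])
          show "(\<lambda>x. indicator X x * h x) \<in> borel_measurable M" using h(1) X by simp
          show "\<bar>indicator X x * h x\<bar> \<le> 1" for x
            using h(2,3)[of x] by (simp add: indicator_def)
        qed
        show "AE x in \<nu>. 0 \<le> indicator X x * h x" using h(2) by simp
      qed
      finally show ?thesis .
    qed
    have IB: "(indicator B\<^sub>0 :: _ \<Rightarrow> real) \<in> borel_measurable M" "0 \<le> (indicator B\<^sub>0 x :: real)"
      "(indicator B\<^sub>0 x :: real) \<le> 1" for x
      using B0(1) by simp_all
    have "?P = ?Q"
    proof (rule measure_eqI_cyl)
      have "emeasure ?P (space ?P) \<noteq> \<infinity>"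
        using dens[OF IB sets.top[of M]] \<nu>'(3) by simp
      then show "finite_measure ?P" by (rule finite_measureI)
      fix W z assume W: "finite W" "W \<subseteq> V" "z \<in> PiE W A"
      obtain f g where fg: "local_fun f" "local_fun g" "screened \<nu> S f" "screened \<nu> S g"
        "\<And>x. x \<in> \<Omega> \<Longrightarrow> indicator (cyl W z) x = f x - g x"
        using scr[OF W] by blast
      have split: "(\<integral>x. indicator (cyl W z) x * h x \<partial>\<nu>) = (\<integral>x. f x * h x \<partial>\<nu>) - (\<integral>x. g x * h x \<partial>\<nu>)"
        if h: "h \<in> borel_measurable M" "\<And>x. \<bar>h x\<bar> \<le> 1" for h :: "_ \<Rightarrow> real"
      proof -
        have int: "integrable \<nu> (\<lambda>x. k x * h x)" if k: "local_fun k" for k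
        proof -
          obtain b where b: "\<And>x. x \<in> \<Omega> \<Longrightarrow> \<bar>k x\<bar> \<le> b" using local_fun_bounded[OF k] by blast
          show ?thesis
          proof (rule integrable_bounded[OF \<nu>c, of _ b])
            show "(\<lambda>x. k x * h x) \<in> borel_measurable M" using local_fun_measurable[OF k] h by simp
            show "\<bar>k x * h x\<bar> \<le> b" if "x \<in> \<Omega>" for x
              using mult_mono[OF b[OF that] h(2)[of x]] b[OF that] by (simp add: abs_mult)
          qed
        qed
        have "(\<integral>x. indicator (cyl W z) x * h x \<partial>\<nu>) = (\<integral>x. f x * h x - g x * h x \<partial>\<nu>)"
          using fg(5) \<nu>'(3) by (intro Bochner_Integration.integral_cong) (auto simp: left_diff_distrib)
        then show ?thesis using int[OF fg(1)] int[OF fg(2)] by simp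
      qed
      have "(\<integral>x. indicator (cyl W z) x * indicator B\<^sub>0 x \<partial>\<nu>) = (\<integral>x. indicator (cyl W z) x * u x \<partial>\<nu>)"
        using split[OF IB(1)] split[OF uM] u(2,3)
          screened_integral_eq[OF \<nu> S fg(1) fg(3) B B0 u] screened_integral_eq[OF \<nu> S fg(2) fg(4) B B0 u]
        by simp
      then show "emeasure ?P (cyl W z) = emeasure ?Q (cyl W z)"
        using dens[OF IB cyl_in_sets[OF W(1,2)]] dens[OF uM u(2,3) cyl_in_sets[OF W(1,2)]] by simp
    qed (use \<nu>'(2) in auto)
    then have "AE x in \<nu>. ennreal (indicator B\<^sub>0 x) = ennreal (u x)"
      using measD[OF uM] B0\<nu> by (intro density_unique) auto
    then have AE: "AE x in \<nu>. x \<in> B \<longleftrightarrow> x \<in> u -` {1} \<inter> \<Omega>"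
      using B0(2) AE_space
    proof eventually_elim
      case (elim x)
      then have "indicator B\<^sub>0 x = u x" using u(2)[of x] by (simp add: indicator_def split: if_splits)
      then show ?case using elim \<nu>'(3) by (auto simp: indicator_def split: if_splits)
    qed
    have "u -` {1} \<inter> space (coordinate_space S) \<in> sets (coordinate_space S)"
      using u(1) by (rule measurable_sets) simp
    then have "u -` {1} \<inter> \<Omega> \<in> coordinate_algebra S" by (simp add: sets_coordinate_space)
    moreover have "sym_diff B (u -` {1} \<inter> \<Omega>) \<in> null_sets (completion \<nu>)"
      using AE sym_diff_null_iff_AE[OF B\<Omega>, of "u -` {1} \<inter> \<Omega>"] \<nu>'(3) by auto
    ultimately show ?thesis by blast
  qed
  moreover have "\<exists>B\<in>saturated_sets \<nu> S. sym_diff C B \<in> null_sets (completion \<nu>)"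
    if C: "C \<in> coordinate_algebra S" for C
  proof
    have "sym_diff C C \<in> null_sets (completion \<nu>)" by simp
    then have "C \<in> null_completion \<nu> (sigma_sets \<Omega> (coordinate_algebra S \<union> coordinate_algebra (V - F)))" for F
      using coord_sub[OF C] C \<nu>'(3) unfolding null_completion_def
      by (intro CollectI conjI bexI[of _ C] sigma_sets.Basic) auto
    then show "C \<in> saturated_sets \<nu> S" unfolding saturated_sets_def by blast
  qed simp
  ultimately show ?thesis
    unfolding equivalent_mod_0_def by blast
qed


section \<open>Screening under the Dobrushin condition\<close>

definition site_prob :: "'v \<Rightarrow> ('v \<Rightarrow> 'a) \<Rightarrow> 'a \<Rightarrow> real" where
  "site_prob v x a = weight {v} (x(v := a)) / partition_sum {v} x"

lemma update_in_\<Omega>: "x \<in> \<Omega> \<Longrightarrow> v \<in> V \<Longrightarrow> a \<in> A v \<Longrightarrow> x(v := a) \<in> \<Omega>"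
  by (auto simp: PiE_iff extensional_def)

lemma agree_single:
  assumes "x \<in> \<Omega>" "v \<in> V"
  shows "bij_betw (\<lambda>a. x(v := a)) (A v) (agree {v} x)"
proof (rule bij_betw_byWitness[where f' = "\<lambda>y. y v"])
  show "\<forall>y\<in>agree {v} x. x(v := y v) = y"
  proof
    fix y assume y: "y \<in> agree {v} x"
    have "x w = y w" if "w \<noteq> v" for w
      using that assms y by (cases "w \<in> V") (auto simp: agreeing_off_def PiE_iff extensional_def)
    then show "x(v := y v) = y" by auto
  qed
  show "(\<lambda>a. x(v := a)) ` A v \<subseteq> agree {v} x"
    using update_in_\<Omega>[OF assms] by (auto simp: agreeing_off_def split: if_splits)
  show "(\<lambda>y. y v) ` agree {v} x \<subseteq> A v"
    using assms by (auto simp: agreeing_off_def)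
qed simp

lemma spec_single:
  assumes "x \<in> \<Omega>" "v \<in> V"
  shows "spec {v} f x = (\<Sum>a\<in>A v. site_prob v x a * f (x(v := a)))"
  unfolding spec_eq_sum site_prob_def
  using sum.reindex_bij_betw[OF agree_single[OF assms],
      of "\<lambda>y. weight {v} y / partition_sum {v} x * f y"] by simp

lemma site_prob_nonneg:
  assumes "x \<in> \<Omega>" "v \<in> V"
  shows "0 \<le> site_prob v x a"
  using partition_sum_pos[OF assms(1), of "{v}"] weight_pos[of "{v}" "x(v := a)"] assms(2)
  by (simp add: site_prob_def)

lemma sum_site_prob:
  assumes "x \<in> \<Omega>" "v \<in> V"
  shows "(\<Sum>a\<in>A v. site_prob v x a) = 1"
  using spec_single[OF assms, of "\<lambda>_. 1"] spec_const[OF assms(1), of "{v}" 1] assms(2) by simp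

lemma measure_single_site:
  assumes "x \<in> \<Omega>" "v \<in> V" "B \<subseteq> A v"
  shows "measure (single_site V A \<Phi> v x) B = (\<Sum>a\<in>B. site_prob v x a)"
proof -
  interpret prob_space "kernel {v} x" using prob_space_kernel[OF assms(1)] assms(2) by simp
  have sp: "space (kernel {v} x) = \<Omega>" using sets_eq_imp_space_eq[OF sets_kernel] by simp
  let ?E = "(\<lambda>y. y v) -` B \<inter> \<Omega>"
  have meas: "(\<lambda>y. y v) \<in> kernel {v} x \<rightarrow>\<^sub>M count_space (A v)"
    using measurable_coordinate[OF assms(2)] measurable_cong_sets[OF sets_kernel refl] by blast
  have E: "?E \<in> sets M"
    using measurable_sets[OF measurable_coordinate[OF assms(2)], of B] assms(3) by simp
  have "measure (single_site V A \<Phi> v x) B = measure (kernel {v} x) ?E"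
    unfolding single_site_def using measure_distr[OF meas, of B] assms(3) sp by simp
  also have "\<dots> = (\<integral>y. indicator ?E y \<partial>kernel {v} x)" using E by simp
  also have "\<dots> = spec {v} (indicator ?E) x"
    using assms(2) E by (intro integral_kernel[OF assms(1)]) auto
  also have "\<dots> = (\<Sum>a\<in>A v. site_prob v x a * indicator B a)"
    unfolding spec_single[OF assms(1,2)]
    using update_in_\<Omega>[OF assms(1,2)] by (intro sum.cong) (auto simp: indicator_def)
  also have "\<dots> = (\<Sum>a\<in>B. site_prob v x a)"
    using assms(3) finite_alphabet[OF assms(2)]
    by (simp add: indicator_def if_distrib sum.If_cases Int_absorb1 cong: if_cong)
  finally show ?thesis .
qed

text \<open>
  The norm of a difference of two measures is attained at the positive and the negative part of a
  Hahn decomposition, where it becomes the \<open>\<ell>\<^sub>1\<close> distance of the probabilities.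
\<close>

lemma site_prob_diff_le_norm:
  assumes "x \<in> \<Omega>" "y \<in> \<Omega>" "v \<in> V"
  shows "(\<Sum>a\<in>A v. \<bar>site_prob v x a - site_prob v y a\<bar>)
    \<le> norm_of_diff (single_site V A \<Phi> v x) (single_site V A \<Phi> v y)"
proof -
  let ?p = "site_prob v x" and ?q = "site_prob v y"
  let ?P = "single_site V A \<Phi> v x" and ?Q = "single_site V A \<Phi> v y"
  define B where "B = {a \<in> A v. ?q a \<le> ?p a}"
  define C where "C = A v - B"
  have sub: "B \<subseteq> A v" "C \<subseteq> A v" by (auto simp: B_def C_def)
  have sets: "sets ?P = Pow (A v)" by (simp add: single_site_def)
  have fin: "finite (A v)" by (rule finite_alphabet[OF assms(3)])
  have "(\<Sum>a\<in>A v. \<bar>?p a - ?q a\<bar>) = (\<Sum>a\<in>B. \<bar>?p a - ?q a\<bar>) + (\<Sum>a\<in>C. \<bar>?p a - ?q a\<bar>)"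
    using sum.subset_diff[OF sub(1) fin, of "\<lambda>a. \<bar>?p a - ?q a\<bar>"] by (simp add: C_def)
  also have "\<dots> = (\<Sum>a\<in>B. ?p a - ?q a) + (\<Sum>a\<in>C. ?q a - ?p a)"
    by (intro arg_cong2[of _ _ _ _ "(+)"] sum.cong) (auto simp: B_def C_def)
  also have "\<dots> = (measure ?P B - measure ?Q B) - (measure ?P C - measure ?Q C)"
    using measure_single_site[OF assms(1,3)] measure_single_site[OF assms(2,3)] sub
    by (simp add: sum_subtractf)
  also have "\<dots> \<le> norm_of_diff ?P ?Q"
  proof -
    let ?f = "\<lambda>(B, C). (measure ?P B - measure ?Q B) - (measure ?P C - measure ?Q C)"
    have "bdd_above (?f ` (sets ?P \<times> sets ?P))" using sets fin by (intro bdd_above_finite) simp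
    moreover have "(B, C) \<in> sets ?P \<times> sets ?P" using sub sets by simp
    ultimately have "?f (B, C) \<le> (SUP z\<in>sets ?P \<times> sets ?P. ?f z)" by (intro cSUP_upper)
    then show ?thesis unfolding norm_of_diff_def by simp
  qed
  finally show ?thesis .
qed

lemma site_prob_diff_le_influence:
  assumes "x \<in> \<Omega>" "y \<in> \<Omega>" "v \<in> V" "\<forall>w\<in>V - {u}. x w = y w" "influence V A \<Phi> v u < \<infinity>"
  shows "(\<Sum>a\<in>A v. \<bar>site_prob v x a - site_prob v y a\<bar>) \<le> enn2real (influence V A \<Phi> v u)"
proof -
  let ?n = "norm_of_diff (single_site V A \<Phi> v x) (single_site V A \<Phi> v y)"
  have "0 \<le> ?n"
    using site_prob_diff_le_norm[OF assms(1-3)] by (rule order.trans[rotated]) (simp add: sum_nonneg)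
  have "ennreal ?n \<le> influence V A \<Phi> v u"
    unfolding influence_def
    by (rule SUP_upper2[of "(x, y)"]) (use assms in auto)
  then have "?n \<le> enn2real (influence V A \<Phi> v u)"
    using enn2real_mono[OF _ assms(5)[unfolded infinity_ennreal_def]] \<open>0 \<le> ?n\<close> by fastforce
  then show ?thesis using site_prob_diff_le_norm[OF assms(1-3)] by simp
qed

text \<open>The Dobrushin condition in the form of finite real sums, as the oscillation bounds use it.\<close>

definition influence_bound :: "real \<Rightarrow> bool" where
  "influence_bound c \<longleftrightarrow> 0 \<le> c \<and> c < 1 \<and>
     (\<forall>v\<in>V. \<forall>u\<in>V - {v}. influence V A \<Phi> v u < \<infinity>) \<and>
     (\<forall>v\<in>V. \<forall>W. finite W \<and> W \<subseteq> V - {v} \<longrightarrow> (\<Sum>u\<in>W. enn2real (influence V A \<Phi> v u)) \<le> c)"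

lemma influence_boundD:
  assumes "influence_bound c"
  shows "0 \<le> c" "c < 1" "v \<in> V \<Longrightarrow> u \<in> V - {v} \<Longrightarrow> influence V A \<Phi> v u < \<infinity>"
    "v \<in> V \<Longrightarrow> finite W \<Longrightarrow> W \<subseteq> V - {v} \<Longrightarrow> (\<Sum>u\<in>W. enn2real (influence V A \<Phi> v u)) \<le> c"
  using assms unfolding influence_bound_def by blast+

lemma dobrushin_influence_bound:
  assumes "dobrushin_condition V A \<Phi>"
  shows "\<exists>c. influence_bound c"
proof -
  let ?i = "influence V A \<Phi>"
  let ?s = "SUP v\<in>V. \<Sum>\<^sub>\<infinity>u\<in>V - {v}. ?i v u"
  have s: "?s < 1" using assms by (simp add: dobrushin_condition_def)
  have fin: "?s < \<infinity>" using s by (rule order.strict_trans) simp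
  have part: "(\<Sum>u\<in>W. ?i v u) \<le> ?s" if "v \<in> V" "finite W" "W \<subseteq> V - {v}" for v W
  proof -
    have "(\<Sum>u\<in>W. ?i v u) \<le> (\<Sum>\<^sub>\<infinity>u\<in>V - {v}. ?i v u)"
      unfolding nonneg_infsum_complete[of "V - {v}" "?i v", OF zero_le]
      using that(2,3) by (intro SUP_upper) simp
    also have "\<dots> \<le> ?s" using that(1) by (rule SUP_upper)
    finally show ?thesis .
  qed
  have inf: "?i v u < \<infinity>" if "v \<in> V" "u \<in> V - {v}" for v u
    using part[OF that(1), of "{u}"] that(2) fin by (simp add: order.strict_trans1)
  have "enn2real ?s < 1"
    using s fin by (cases ?s) (auto simp: ennreal_less_one_iff)
  moreover have "(\<Sum>u\<in>W. enn2real (?i v u)) \<le> enn2real ?s"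
    if "v \<in> V" "finite W" "W \<subseteq> V - {v}" for v W
  proof -
    have "(\<Sum>u\<in>W. enn2real (?i v u)) = enn2real (\<Sum>u\<in>W. ?i v u)"
      using inf[OF that(1)] that(3) by (subst enn2real_sum) (auto simp: subset_eq)
    also have "\<dots> \<le> enn2real ?s" using part[OF that] fin[unfolded infinity_ennreal_def] by (rule enn2real_mono)
    finally show ?thesis .
  qed
  ultimately have "influence_bound (enn2real ?s)"
    unfolding influence_bound_def using inf by simp
  then show ?thesis by blast
qed

text \<open>
  \<open>d u\<close> bounds the oscillation of \<open>f\<close> at \<open>u\<close>. It is a bound and not the supremum itself, so that
  updates can be followed by explicit formulas; the finite support keeps the total a finite sum.
\<close>

definition osc_bound :: "'v set \<Rightarrow> (('v \<Rightarrow> 'a) \<Rightarrow> real) \<Rightarrow> ('v \<Rightarrow> real) \<Rightarrow> bool" where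
  "osc_bound W f d \<longleftrightarrow> finite W \<and> W \<subseteq> V \<and> determined_by W f \<and> (\<forall>u. 0 \<le> d u) \<and> (\<forall>u. u \<notin> W \<longrightarrow> d u = 0) \<and>
     (\<forall>u\<in>V. \<forall>x\<in>\<Omega>. \<forall>y\<in>\<Omega>. (\<forall>w\<in>V - {u}. x w = y w) \<longrightarrow> \<bar>f x - f y\<bar> \<le> d u)"

lemma osc_boundD:
  assumes "osc_bound W f d"
  shows "finite W" "W \<subseteq> V" "determined_by W f" "0 \<le> d u" "u \<notin> W \<Longrightarrow> d u = 0"
    and "u \<in> V \<Longrightarrow> x \<in> \<Omega> \<Longrightarrow> y \<in> \<Omega> \<Longrightarrow> \<forall>w\<in>V - {u}. x w = y w \<Longrightarrow> \<bar>f x - f y\<bar> \<le> d u"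
  using assms unfolding osc_bound_def by blast+

lemma local_fun_osc_bound:
  assumes "local_fun f"
  obtains W d where "osc_bound W f d"
proof -
  obtain W where W: "finite W" "W \<subseteq> V" "determined_by W f"
    using assms by (auto simp: local_fun_def)
  obtain b where b: "\<And>x. x \<in> \<Omega> \<Longrightarrow> \<bar>f x\<bar> \<le> b" using local_fun_bounded[OF assms] by blast
  obtain t where "t \<in> \<Omega>" using \<Omega>_nonempty by auto
  then have "0 \<le> b" using b[of t] by simp
  have "osc_bound W f (\<lambda>u. if u \<in> W then 2 * b else 0)"
    unfolding osc_bound_def
  proof (intro conjI W allI impI ballI)
    fix u x y assume u: "u \<in> V" and xy: "x \<in> \<Omega>" "y \<in> \<Omega>" "\<forall>w\<in>V - {u}. x w = y w"
    show "\<bar>f x - f y\<bar> \<le> (if u \<in> W then 2 * b else 0)"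
    proof (cases "u \<in> W")
      case True
      then show ?thesis using b[OF xy(1)] b[OF xy(2)] by simp
    next
      case False
      then have "x w = y w" if "w \<in> W" for w using that xy(3) W(2) by blast
      then have "f x = f y" using determined_byD[OF W(3) xy(1,2)] by blast
      then show ?thesis using False by simp
    qed
  qed (use \<open>0 \<le> b\<close> in auto)
  then show ?thesis by (rule that)
qed

text \<open>Two configurations are joined by changing the sites of \<open>U\<close> one at a time.\<close>

lemma osc_bound_difference:
  assumes f: "osc_bound W f d" and "finite U" and "U \<subseteq> V" and xy: "x \<in> \<Omega>" "y \<in> \<Omega>"
    and "\<And>w. w \<in> W - U \<Longrightarrow> x w = y w"
  shows "\<bar>f x - f y\<bar> \<le> (\<Sum>u\<in>U. d u)"
  using assms(2,3) xy(1) assms(6)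
proof (induction U arbitrary: x rule: finite_induct)
  case empty
  have "f x = f y"
    by (rule determined_byD[OF osc_boundD(3)[OF f] empty(2) xy(2)]) (rule empty(3), simp)
  then show ?case by simp
next
  case (insert u U)
  let ?x = "x(u := y u)"
  have x': "?x \<in> \<Omega>" using insert.prems(1) xy(2) by (intro update_in_\<Omega> insert.prems(2)) auto
  have "\<bar>f x - f ?x\<bar> \<le> d u"
    using insert.prems(1) by (intro osc_boundD(6)[OF f _ insert.prems(2) x']) auto
  moreover have "\<bar>f ?x - f y\<bar> \<le> (\<Sum>u\<in>U. d u)"
  proof (rule insert.IH[OF _ x'])
    show "U \<subseteq> V" using insert.prems(1) by simp
    show "?x w = y w" if "w \<in> W - U" for w
      using that insert.prems(3)[of w] by (cases "w = u") auto
  qed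
  ultimately show ?case using insert.hyps by simp
qed

text \<open>
  Comparing two one-site kernels whose boundary conditions differ at \<open>u\<close>: either the resampled
  symbol is the same and \<open>f\<close> changes through \<open>u\<close>, or it differs, which has a probability bounded
  by the influence and changes \<open>f\<close> through \<open>v\<close>. So the oscillation of \<open>f\<close> at \<open>v\<close> is passed on to the neighbours,
  reduced by the influences.
\<close>

lemma osc_bound_spec_single:
  assumes f: "osc_bound W f d" and v: "v \<in> V"
    and fin: "\<And>u. u \<in> V - {v} \<Longrightarrow> influence V A \<Phi> v u < \<infinity>"
  defines "W' \<equiv> W \<union> reach {v}"
  shows "osc_bound W' (spec {v} f)
    (\<lambda>u. if u = v \<or> u \<notin> W' then 0 else d u + enn2real (influence V A \<Phi> v u) * d v)"
    (is "osc_bound _ _ ?d")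
  unfolding osc_bound_def
proof (intro conjI allI impI ballI)
  note fD = osc_boundD[OF f]
  show "finite W'" "W' \<subseteq> V"
    using fD(1,2) finite_reach[of "{v}"] reach_subset v by (auto simp: W'_def)
  show det: "determined_by W' (spec {v} f)"
    unfolding W'_def using determined_by_spec[OF _ fD(3), of "{v}"] v by simp
  show "0 \<le> ?d u" for u using fD(4) by simp
  show "?d u = 0" if "u \<notin> W'" for u using that by simp
  fix u x y assume u: "u \<in> V" and xy: "x \<in> \<Omega>" "y \<in> \<Omega>" "\<forall>w\<in>V - {u}. x w = y w"
  show "\<bar>spec {v} f x - spec {v} f y\<bar> \<le> ?d u"
  proof (cases "u = v \<or> u \<notin> W'")
    case True
    have "spec {v} f x = spec {v} f y"
    proof (cases "u = v")
      case True
      then show ?thesis using xy(3) by (intro spec_boundary_cong) blast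
    next
      case False
      with True have "x w = y w" if "w \<in> W'" for w
        using that xy(3) \<open>W' \<subseteq> V\<close> by blast
      then show ?thesis using determined_byD[OF det xy(1,2)] by blast
    qed
    then show ?thesis using True by simp
  next
    case False
    then have uv: "u \<in> V - {v}" using u by simp
    let ?p = "site_prob v x" and ?q = "site_prob v y"
    have "spec {v} f x - spec {v} f y
        = (\<Sum>a\<in>A v. ?p a * f (x(v := a))) - (\<Sum>a\<in>A v. ?q a * f (y(v := a)))"
      using spec_single xy v by simp
    \<comment> \<open>Both families of probabilities sum to \<open>1\<close>, so the constant \<open>f y\<close> may be subtracted.\<close>
    also have "\<dots> = (\<Sum>a\<in>A v. ?p a * (f (x(v := a)) - f (y(v := a))))
        + (\<Sum>a\<in>A v. (?p a - ?q a) * (f (y(v := a)) - f y))"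
    proof -
      have "(\<Sum>a\<in>A v. (?p a - ?q a) * f y) = 0"
        using sum_site_prob[OF xy(1) v] sum_site_prob[OF xy(2) v]
        by (simp add: sum_distrib_right[symmetric] sum_subtractf)
      then show ?thesis
        by (simp add: left_diff_distrib right_diff_distrib sum_subtractf)
    qed
    finally have "\<bar>spec {v} f x - spec {v} f y\<bar>
        \<le> \<bar>\<Sum>a\<in>A v. ?p a * (f (x(v := a)) - f (y(v := a)))\<bar>
          + \<bar>\<Sum>a\<in>A v. (?p a - ?q a) * (f (y(v := a)) - f y)\<bar>" by simp
    also have "\<dots> \<le> (\<Sum>a\<in>A v. ?p a * d u) + (\<Sum>a\<in>A v. \<bar>?p a - ?q a\<bar> * d v)"
    proof (intro add_mono order.trans[OF sum_abs] sum_mono)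
      fix a assume a: "a \<in> A v"
      have "\<bar>f (x(v := a)) - f (y(v := a))\<bar> \<le> d u"
        using xy(3) by (intro fD(6)[OF u update_in_\<Omega>[OF xy(1) v a] update_in_\<Omega>[OF xy(2) v a]]) simp
      then show "\<bar>?p a * (f (x(v := a)) - f (y(v := a)))\<bar> \<le> ?p a * d u"
        using site_prob_nonneg[OF xy(1) v] by (simp add: abs_mult mult_left_mono)
      have "\<bar>f (y(v := a)) - f y\<bar> \<le> d v"
        by (intro fD(6)[OF v update_in_\<Omega>[OF xy(2) v a] xy(2)]) simp
      then show "\<bar>(?p a - ?q a) * (f (y(v := a)) - f y)\<bar> \<le> \<bar>?p a - ?q a\<bar> * d v"
        by (simp add: abs_mult mult_left_mono)
    qed
    also have "\<dots> = d u + (\<Sum>a\<in>A v. \<bar>?p a - ?q a\<bar>) * d v"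
      using sum_site_prob[OF xy(1) v] by (simp add: sum_distrib_right[symmetric])
    also have "\<dots> \<le> d u + enn2real (influence V A \<Phi> v u) * d v"
      using site_prob_diff_le_influence[OF xy(1,2) v xy(3) fin[OF uv]] fD(4)[of v]
      by (intro add_left_mono mult_right_mono)
    finally show ?thesis using False by simp
  qed
qed

text \<open>
  Resampling once every site of a finite set \<open>U\<close> moves each oscillation \<open>d u\<close> with \<open>u \<in> U\<close> to
  other sites and loses at least the fraction \<open>1 - c\<close> of it. When a site is reached its oscillation is at
  least the original one, as the other updates can only have increased it.
\<close>

lemma osc_bound_sweep:
  assumes c: "influence_bound c" and f: "osc_bound W f d" and U: "finite U" "U \<subseteq> V - S"
  shows "\<exists>W' h d'. osc_bound W' h d' \<and>
    (\<forall>\<Lambda> x. finite \<Lambda> \<longrightarrow> U \<subseteq> \<Lambda> \<longrightarrow> \<Lambda> \<subseteq> V \<longrightarrow> x \<in> \<Omega> \<longrightarrow> spec \<Lambda> h x = spec \<Lambda> f x) \<and>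
    (\<forall>u. u \<notin> U \<longrightarrow> d u \<le> d' u) \<and>
    (\<Sum>u\<in>W' - S. d' u) \<le> (\<Sum>u\<in>W - S. d u) - (1 - c) * (\<Sum>u\<in>U. d u)"
  using U
proof (induction U rule: finite_induct)
  case empty
  show ?case by (intro exI[of _ W] exI[of _ f] exI[of _ d]) (simp add: f)
next
  case (insert v U)
  then have v: "v \<in> V" "v \<notin> S" by auto
  obtain W1 h d1 where h: "osc_bound W1 h d1"
    and spec_h: "\<And>\<Lambda> x. finite \<Lambda> \<Longrightarrow> U \<subseteq> \<Lambda> \<Longrightarrow> \<Lambda> \<subseteq> V \<Longrightarrow> x \<in> \<Omega> \<Longrightarrow> spec \<Lambda> h x = spec \<Lambda> f x"
    and d1: "\<And>u. u \<notin> U \<Longrightarrow> d u \<le> d1 u"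
    and total: "(\<Sum>u\<in>W1 - S. d1 u) \<le> (\<Sum>u\<in>W - S. d u) - (1 - c) * (\<Sum>u\<in>U. d u)"
    using insert by auto
  note hD = osc_boundD[OF h]
  let ?b = "\<lambda>u. enn2real (influence V A \<Phi> v u)"
  define W2 where "W2 = W1 \<union> reach {v}"
  define d2 where "d2 = (\<lambda>u. if u = v \<or> u \<notin> W2 then 0 else d1 u + ?b u * d1 v)"
  have new: "osc_bound W2 (spec {v} h) d2"
    unfolding W2_def d2_def by (rule osc_bound_spec_single[OF h v(1) influence_boundD(3)[OF c v(1)]])
  have "finite W2" "W2 \<subseteq> V" using osc_boundD(1,2)[OF new] .
  have "(\<Sum>u\<in>W2 - S. d2 u) = (\<Sum>u\<in>W2 - S - {v}. d2 u)"
    using \<open>finite W2\<close> by (intro sum.mono_neutral_right) (auto simp: d2_def)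
  also have "\<dots> = (\<Sum>u\<in>W2 - S - {v}. d1 u) + (\<Sum>u\<in>W2 - S - {v}. ?b u) * d1 v"
    unfolding sum_distrib_right sum.distrib[symmetric] by (intro sum.cong) (auto simp: d2_def)
  \<comment> \<open>The site \<open>v\<close> loses all of its oscillation and the others receive at most \<open>c\<close> times as much.\<close>
  also have "\<dots> \<le> ((\<Sum>u\<in>W1 - S. d1 u) - d1 v) + c * d1 v"
  proof (intro add_mono mult_right_mono)
    have "(\<Sum>u\<in>W2 - S - {v}. d1 u) + d1 v = (\<Sum>u\<in>insert v (W2 - S). d1 u)"
      using \<open>finite W2\<close> by (simp add: sum.insert_remove add.commute)
    also have "\<dots> = (\<Sum>u\<in>W1 - S. d1 u)"
      using \<open>finite W2\<close> v hD(5) by (intro sum.mono_neutral_right) (auto simp: W2_def)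
    finally show "(\<Sum>u\<in>W2 - S - {v}. d1 u) \<le> (\<Sum>u\<in>W1 - S. d1 u) - d1 v" by simp
    show "(\<Sum>u\<in>W2 - S - {v}. ?b u) \<le> c"
      using \<open>finite W2\<close> \<open>W2 \<subseteq> V\<close> by (intro influence_boundD(4)[OF c v(1)]) auto
  qed (rule hD(4))
  also have "\<dots> = (\<Sum>u\<in>W1 - S. d1 u) - (1 - c) * d1 v" by (simp add: algebra_simps)
  also have "\<dots> \<le> (\<Sum>u\<in>W1 - S. d1 u) - (1 - c) * d v"
    using d1[OF insert.hyps(2)] influence_boundD(2)[OF c] by (simp add: mult_left_mono)
  finally have total': "(\<Sum>u\<in>W2 - S. d2 u) \<le> (\<Sum>u\<in>W - S. d u) - (1 - c) * (\<Sum>u\<in>insert v U. d u)"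
    using total insert.hyps by (simp add: distrib_left)
  show ?case
  proof (intro exI conjI allI impI)
    show "osc_bound W2 (spec {v} h) d2" by (rule new)
    show "spec \<Lambda> (spec {v} h) x = spec \<Lambda> f x"
      if "finite \<Lambda>" "insert v U \<subseteq> \<Lambda>" "\<Lambda> \<subseteq> V" "x \<in> \<Omega>" for \<Lambda> x
      using spec_spec[OF that(1,3) _ that(4), of "{v}" h] spec_h[OF that(1) _ that(3,4)] that(2) by simp
    show "d u \<le> d2 u" if "u \<notin> insert v U" for u
    proof -
      have "d u \<le> d1 u" using d1 that by simp
      also have "\<dots> \<le> d2 u"
        using that hD(4)[of v] hD(5)[of u] by (auto simp: d2_def W2_def)
      finally show ?thesis .
    qed
    show "(\<Sum>u\<in>W2 - S. d2 u) \<le> (\<Sum>u\<in>W - S. d u) - (1 - c) * (\<Sum>u\<in>insert v U. d u)"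
      by (rule total')
  qed
qed

text \<open>
  Each sweep updates all sites off \<open>S\<close> that then carry oscillation, and so multiplies the total
  by at most \<open>c\<close>. The set of sites to be updated may grow from sweep to sweep but stays finite.
\<close>

lemma osc_bound_iterate:
  assumes c: "influence_bound c" and f: "osc_bound W f d"
  shows "\<exists>W' h d' L. osc_bound W' h d' \<and> finite L \<and> L \<subseteq> V - S \<and>
    (\<forall>x\<in>\<Omega>. \<forall>\<Lambda>. finite \<Lambda> \<longrightarrow> L \<subseteq> \<Lambda> \<longrightarrow> \<Lambda> \<subseteq> V \<longrightarrow> spec \<Lambda> h x = spec \<Lambda> f x) \<and>
    (\<Sum>u\<in>W' - S. d' u) \<le> c ^ k * (\<Sum>u\<in>W - S. d u)"
proof (induction k)
  case 0
  show ?case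
    by (rule exI[of _ W], rule exI[of _ f], rule exI[of _ d], rule exI[of _ "{}"]) (simp add: f)
next
  case (Suc k)
  then obtain W1 h d1 L where h: "osc_bound W1 h d1" and L: "finite L" "L \<subseteq> V - S"
    and spec_h: "\<forall>x\<in>\<Omega>. \<forall>\<Lambda>. finite \<Lambda> \<longrightarrow> L \<subseteq> \<Lambda> \<longrightarrow> \<Lambda> \<subseteq> V \<longrightarrow> spec \<Lambda> h x = spec \<Lambda> f x"
    and total: "(\<Sum>u\<in>W1 - S. d1 u) \<le> c ^ k * (\<Sum>u\<in>W - S. d u)"
    by (elim exE conjE) (rule that; assumption)
  have U: "finite (W1 - S)" "W1 - S \<subseteq> V - S" using osc_boundD(1,2)[OF h] by auto
  obtain W2 g d2 where g: "osc_bound W2 g d2"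
    and spec_g: "\<forall>\<Lambda> x. finite \<Lambda> \<longrightarrow> W1 - S \<subseteq> \<Lambda> \<longrightarrow> \<Lambda> \<subseteq> V \<longrightarrow> x \<in> \<Omega> \<longrightarrow> spec \<Lambda> g x = spec \<Lambda> h x"
    and total2: "(\<Sum>u\<in>W2 - S. d2 u) \<le> (\<Sum>u\<in>W1 - S. d1 u) - (1 - c) * (\<Sum>u\<in>W1 - S. d1 u)"
    using osc_bound_sweep[OF c h U] by (elim exE conjE) (rule that; assumption)
  have "(\<Sum>u\<in>W2 - S. d2 u) \<le> c * (\<Sum>u\<in>W1 - S. d1 u)"
    using total2 by (simp add: algebra_simps)
  also have "\<dots> \<le> c ^ Suc k * (\<Sum>u\<in>W - S. d u)"
    using mult_left_mono[OF total influence_boundD(1)[OF c]] by simp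
  finally have total3: "(\<Sum>u\<in>W2 - S. d2 u) \<le> c ^ Suc k * (\<Sum>u\<in>W - S. d u)" .
  have "spec \<Lambda> g x = spec \<Lambda> f x"
    if "x \<in> \<Omega>" "finite \<Lambda>" "L \<union> (W1 - S) \<subseteq> \<Lambda>" "\<Lambda> \<subseteq> V" for x \<Lambda>
  proof -
    have "spec \<Lambda> g x = spec \<Lambda> h x" using spec_g that by blast
    also have "\<dots> = spec \<Lambda> f x" using spec_h that by blast
    finally show ?thesis .
  qed
  moreover have "finite (L \<union> (W1 - S))" "L \<union> (W1 - S) \<subseteq> V - S" using L U by auto
  ultimately show ?case
    using g total3
    by - (rule exI[of _ W2], rule exI[of _ g], rule exI[of _ d2], rule exI[of _ "L \<union> (W1 - S)"], simp)
qed

text \<open>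
  Once the oscillations of \<open>h\<close> off \<open>S\<close> have a small sum, the expectations of \<open>h\<close> under any two
  boundary conditions that agree on \<open>S\<close> are close. This gives screening, uniformly in the
  configuration, whatever the measure.
\<close>

proposition dobrushin_screened:
  assumes "dobrushin_condition V A \<Phi>" and \<nu>: "\<nu> \<in> config_measures V A" and f: "local_fun f" and S: "S \<subseteq> V"
  shows "screened \<nu> S f"
proof -
  note \<nu>' = config_measuresD[OF \<nu>]
  interpret prob_space \<nu> by (rule \<nu>')
  obtain c where c: "influence_bound c" using dobrushin_influence_bound[OF assms(1)] by blast
  obtain W d where d: "osc_bound W f d" using local_fun_osc_bound[OF f] by blast
  obtain t where t: "t \<in> \<Omega>" using \<Omega>_nonempty by auto
  let ?D = "\<Sum>u\<in>W - S. d u"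
  have "\<exists>\<Lambda>. finite \<Lambda> \<and> \<Lambda> \<subseteq> V - S \<and>
     (\<integral>x. \<bar>spec \<Lambda> f x - spec \<Lambda> f (override_on t x S)\<bar> \<partial>\<nu>) \<le> e" if e: "e > 0" for e
  proof -
    have "(\<lambda>k. c ^ k * ?D) \<longlonglongrightarrow> 0 * ?D"
      using influence_boundD(1,2)[OF c] by (intro tendsto_mult LIMSEQ_power_zero tendsto_const) auto
    then have "\<forall>\<^sub>F k in sequentially. c ^ k * ?D < e"
      using e by (intro order_tendstoD(2)[of _ "0 * ?D"]) auto
    then obtain k where k: "c ^ k * ?D < e" by (auto simp: eventually_sequentially)
    obtain W' h d' L where h: "osc_bound W' h d'" and L: "finite L" "L \<subseteq> V - S"
      and spec_h: "\<forall>x\<in>\<Omega>. \<forall>\<Lambda>. finite \<Lambda> \<longrightarrow> L \<subseteq> \<Lambda> \<longrightarrow> \<Lambda> \<subseteq> V \<longrightarrow> spec \<Lambda> h x = spec \<Lambda> f x"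
      and total: "(\<Sum>u\<in>W' - S. d' u) \<le> c ^ k * ?D"
      using osc_bound_iterate[OF c d, of S k] by (elim exE conjE) (rule that; assumption)
    have LV: "L \<subseteq> V" using L by blast
    have one_sided: "spec L f x \<le> spec L f y + e"
      if xy: "x \<in> \<Omega>" "y \<in> \<Omega>" "\<And>v. v \<in> S \<Longrightarrow> x v = y v" for x y
    proof -
      have "h a \<le> h b + e" if ab: "a \<in> agree L x" "b \<in> agree L y" for a b
      proof -
        have "a v = b v" if "v \<in> W' - (W' - S)" for v
        proof -
          have "v \<in> S" "v \<in> V - L" using that L(2) S by auto
          then show ?thesis using ab xy(3)[of v] by (simp add: agreeing_off_def)
        qed
        moreover have "a \<in> \<Omega>" "b \<in> \<Omega>" using ab agree_subset by blast+
        ultimately have "\<bar>h a - h b\<bar> \<le> (\<Sum>u\<in>W' - S. d' u)"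
          using osc_boundD(1,2)[OF h] by (intro osc_bound_difference[OF h]) blast+
        then show ?thesis using total k by linarith
      qed
      then have "spec L h x \<le> h b + e" if "b \<in> agree L y" for b
        using that by (intro spec_le_const xy L LV) auto
      then have "spec L h x - e \<le> h b" if "b \<in> agree L y" for b
        using that by (simp add: le_diff_eq diff_le_eq)
      then have "spec L h x - e \<le> spec L h y" by (intro spec_ge_const xy L LV) auto
      then show ?thesis using spec_h xy L LV by simp
    qed
    have close: "\<bar>spec L f x - spec L f (override_on t x S)\<bar> \<le> e" if x: "x \<in> \<Omega>" for x
    proof -
      let ?x = "override_on t x S"
      have "spec L f x \<le> spec L f ?x + e" by (rule one_sided[OF x fill_in_\<Omega>[OF t x]]) simp
      moreover have "spec L f ?x \<le> spec L f x + e" by (rule one_sided[OF fill_in_\<Omega>[OF t x] x]) simp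
      ultimately show ?thesis by (simp add: abs_le_iff)
    qed
    have "(\<integral>x. \<bar>spec L f x - spec L f (override_on t x S)\<bar> \<partial>\<nu>) \<le> (\<integral>x. e \<partial>\<nu>)"
      using close \<nu>'(3) e by (intro integral_mono') auto
    then have "(\<integral>x. \<bar>spec L f x - spec L f (override_on t x S)\<bar> \<partial>\<nu>) \<le> e"
      by (simp add: prob_space)
    then show ?thesis using L by blast
  qed
  then show ?thesis unfolding screened_def using t by blast
qed


section \<open>A projective limit over the configuration space\<close>

text \<open>\<open>p W z\<close> is to be the probability of the cylinder of configurations equal to \<open>z\<close> on \<open>W\<close>.\<close>

definition consistent_marginals :: "('v set \<Rightarrow> ('v \<Rightarrow> 'a) \<Rightarrow> real) \<Rightarrow> bool" where
  "consistent_marginals p \<longleftrightarrow>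
     (\<forall>W z. finite W \<and> W \<subseteq> V \<and> z \<in> PiE W A \<longrightarrow> 0 \<le> p W z) \<and>
     (\<forall>W. finite W \<and> W \<subseteq> V \<longrightarrow> (\<Sum>z\<in>PiE W A. p W z) = 1) \<and>
     (\<forall>J W y. finite W \<and> W \<subseteq> V \<and> J \<subseteq> W \<and> y \<in> PiE J A \<longrightarrow>
        p J y = (\<Sum>z\<in>{z \<in> PiE W A. restrict z J = y}. p W z))"

lemma consistent_marginalsD:
  assumes "consistent_marginals p"
  shows "finite W \<Longrightarrow> W \<subseteq> V \<Longrightarrow> z \<in> PiE W A \<Longrightarrow> 0 \<le> p W z"
    and "finite W \<Longrightarrow> W \<subseteq> V \<Longrightarrow> (\<Sum>z\<in>PiE W A. p W z) = 1"
    and "finite W \<Longrightarrow> W \<subseteq> V \<Longrightarrow> J \<subseteq> W \<Longrightarrow> y \<in> PiE J A \<Longrightarrow>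
      p J y = (\<Sum>z\<in>{z \<in> PiE W A. restrict z J = y}. p W z)"
proof -
  note c = assms[unfolded consistent_marginals_def]
  show "finite W \<Longrightarrow> W \<subseteq> V \<Longrightarrow> z \<in> PiE W A \<Longrightarrow> 0 \<le> p W z"
    using conjunct1[OF c] by blast
  show "finite W \<Longrightarrow> W \<subseteq> V \<Longrightarrow> (\<Sum>z\<in>PiE W A. p W z) = 1"
    using conjunct1[OF conjunct2[OF c]] by blast
  show "finite W \<Longrightarrow> W \<subseteq> V \<Longrightarrow> J \<subseteq> W \<Longrightarrow> y \<in> PiE J A \<Longrightarrow>
      p J y = (\<Sum>z\<in>{z \<in> PiE W A. restrict z J = y}. p W z)"
    using conjunct2[OF conjunct2[OF c]] by blast
qed

lemma point_measure_marginal: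
  assumes p: "consistent_marginals p" and W: "finite W" "W \<subseteq> V" "J \<subseteq> W"
  shows "point_measure (PiE J A) (\<lambda>z. ennreal (p J z))
    = distr (point_measure (PiE W A) (\<lambda>z. ennreal (p W z))) (count_space (PiE J A)) (\<lambda>z. restrict z J)"
    (is "?Q = distr ?R _ _")
proof (rule measure_eqI_finite)
  have J: "finite J" "J \<subseteq> V" using W finite_subset by auto
  have restr: "(\<lambda>z. restrict z J) \<in> ?R \<rightarrow>\<^sub>M count_space (PiE J A)"
    using W(3) by (auto simp: PiE_iff)
  have finW: "finite (PiE W A)" by (rule finite_PiE_alphabets[OF W(1,2)])
  show "sets ?Q = Pow (PiE J A)" by (simp add: sets_point_measure)
  show "sets (distr ?R (count_space (PiE J A)) (\<lambda>z. restrict z J)) = Pow (PiE J A)" by simp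
  show "finite (PiE J A)" by (rule finite_PiE_alphabets[OF J])
  fix y assume y: "y \<in> PiE J A"
  have pre: "(\<lambda>z. restrict z J) -` {y} \<inter> space ?R = {z \<in> PiE W A. restrict z J = y}"
    by (auto simp: space_point_measure)
  have "emeasure (distr ?R (count_space (PiE J A)) (\<lambda>z. restrict z J)) {y}
      = emeasure ?R {z \<in> PiE W A. restrict z J = y}"
    using emeasure_distr[OF restr, of "{y}"] y pre by simp
  also have "\<dots> = (\<Sum>z\<in>{z \<in> PiE W A. restrict z J = y}. ennreal (p W z))"
    using finW by (intro emeasure_point_measure_finite2) auto
  also have "\<dots> = ennreal (\<Sum>z\<in>{z \<in> PiE W A. restrict z J = y}. p W z)"
    using consistent_marginalsD(1)[OF p W(1,2)] by (intro sum_ennreal) auto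
  also have "\<dots> = ennreal (p J y)" using consistent_marginalsD(3)[OF p W y] by simp
  also have "\<dots> = emeasure ?Q {y}"
    using y finite_PiE_alphabets[OF J] by (simp add: emeasure_point_measure_finite2)
  finally show "emeasure ?Q {y} = emeasure (distr ?R (count_space (PiE J A)) (\<lambda>z. restrict z J)) {y}"
    by simp
qed

lemma prob_space_point_measure:
  assumes p: "consistent_marginals p" and W: "finite W" "W \<subseteq> V"
  shows "prob_space (point_measure (PiE W A) (\<lambda>z. ennreal (p W z)))"
proof (rule prob_spaceI)
  have "emeasure (point_measure (PiE W A) (\<lambda>z. ennreal (p W z))) (PiE W A)
      = (\<Sum>z\<in>PiE W A. ennreal (p W z))"
    using finite_PiE_alphabets[OF W] by (simp add: emeasure_point_measure_finite2)
  also have "\<dots> = ennreal (\<Sum>z\<in>PiE W A. p W z)"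
    using consistent_marginalsD(1)[OF p W] by (intro sum_ennreal) auto
  finally show "emeasure (point_measure (PiE W A) (\<lambda>z. ennreal (p W z)))
      (space (point_measure (PiE W A) (\<lambda>z. ennreal (p W z)))) = 1"
    using consistent_marginalsD(2)[OF p W] by (simp add: space_point_measure)
qed

text \<open>
  The Kolmogorov extension theorem concerns Polish spaces. To apply it, the alphabets are encoded
  injectively by real numbers, and the limit measure is decoded again.
\<close>

lemma projective_limit:
  assumes p: "consistent_marginals p"
  obtains \<mu> where "\<mu> \<in> config_measures V A"
    "\<forall>W z. finite W \<longrightarrow> W \<subseteq> V \<longrightarrow> z \<in> PiE W A \<longrightarrow> emeasure \<mu> (cyl W z) = ennreal (p W z)"
proof -
  have "\<exists>e::'a \<Rightarrow> real. inj_on e (A v)" if v: "v \<in> V" for v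
  proof -
    obtain f :: "'a \<Rightarrow> nat" where "inj_on f (A v)"
      using finite_imp_inj_to_nat_seg[OF finite_alphabet[OF v]] by blast
    then have "inj_on (\<lambda>a. real (f a)) (A v)" by (auto simp: inj_on_def)
    then show ?thesis by blast
  qed
  then obtain e :: "'v \<Rightarrow> 'a \<Rightarrow> real" where e: "\<And>v. v \<in> V \<Longrightarrow> inj_on (e v) (A v)"
    by metis
  \<comment> \<open>The default symbol off the code makes \<open>dec v\<close> a total map into the alphabet.\<close>
  define dec where "dec v r = (if r \<in> e v ` A v then inv_into (A v) (e v) r else (SOME a. a \<in> A v))" for v r
  have dec_A: "dec v r \<in> A v" if "v \<in> V" for v r
    using alphabets_nonempty[OF that] by (auto simp: dec_def some_in_eq inv_into_into)
  have dec_e: "dec v (e v a) = a" if "v \<in> V" "a \<in> A v" for v a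
    using that e by (simp add: dec_def)
  have dec_meas: "dec v \<in> borel \<rightarrow>\<^sub>M count_space (A v)" if v: "v \<in> V" for v
  proof (rule measurable_count_space_eq2[THEN iffD2, OF finite_alphabet[OF v]], intro conjI ballI)
    show "dec v \<in> space borel \<rightarrow> A v" using dec_A[OF v] by auto
    fix a assume a: "a \<in> A v"
    have finE: "finite (e v ` A v)" using finite_alphabet[OF v] by simp
    have "dec v -` {a} = {e v a} \<union> (if a = (SOME a. a \<in> A v) then - (e v ` A v) else {})"
    proof (intro equalityI subsetI)
      fix r assume "r \<in> dec v -` {a}"
      then show "r \<in> {e v a} \<union> (if a = (SOME a. a \<in> A v) then - (e v ` A v) else {})"
        using dec_e[OF v] by (cases "r \<in> e v ` A v") (auto simp: dec_def)
    next
      fix r assume "r \<in> {e v a} \<union> (if a = (SOME a. a \<in> A v) then - (e v ` A v) else {})"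
      then consider "r = e v a" | "r \<notin> e v ` A v" "a = (SOME a. a \<in> A v)"
        by (auto split: if_splits)
      then show "r \<in> dec v -` {a}"
      proof cases
        case 1
        then show ?thesis using dec_e[OF v a] by simp
      next
        case 2
        then show ?thesis by (simp add: dec_def)
      qed
    qed
    moreover have "{e v a} \<in> sets borel" "- (e v ` A v) \<in> sets (borel :: real measure)"
      using finE by (auto intro!: borel_open open_Compl finite_imp_closed)
    ultimately show "dec v -` {a} \<inter> space borel \<in> sets borel" by simp
  qed
  define Q where "Q W = point_measure (PiE W A) (\<lambda>z. ennreal (p W z))" for W
  define enc where "enc W z = (\<lambda>v\<in>W. e v (z v))" for W and z :: "'v \<Rightarrow> 'a"
  define P where "P W = distr (Q W) (PiM W (\<lambda>_. borel :: real measure)) (enc W)" for W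
  have enc_space: "enc W z \<in> space (PiM W (\<lambda>_. borel :: real measure))" for W z
    by (simp add: enc_def space_PiM)
  have enc_meas: "enc W \<in> Q W \<rightarrow>\<^sub>M PiM W (\<lambda>_. borel)" for W
    using enc_space by (simp add: Q_def)
  interpret K: polish_projective V P
  proof (intro polish_projective.intro projective_family.intro)
    fix J H assume JH: "J \<subseteq> H" "finite H" "H \<subseteq> V"
    have enc_J: "enc J \<in> count_space (PiE J A) \<rightarrow>\<^sub>M PiM J (\<lambda>_. borel)" using enc_space by simp
    have restr: "(\<lambda>z. restrict z J) \<in> Q H \<rightarrow>\<^sub>M count_space (PiE J A)"
      using JH(1) by (auto simp: PiE_iff Q_def)
    have restr': "(\<lambda>f. restrict f J) \<in> PiM H (\<lambda>_. borel) \<rightarrow>\<^sub>M PiM J (\<lambda>_. borel :: real measure)"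
      using JH(1) by (rule measurable_restrict_subset)
    have "P J = distr (distr (Q H) (count_space (PiE J A)) (\<lambda>z. restrict z J)) (PiM J (\<lambda>_. borel)) (enc J)"
      unfolding P_def Q_def using point_measure_marginal[OF p JH(2,3,1)] by simp
    also have "\<dots> = distr (Q H) (PiM J (\<lambda>_. borel)) (enc J \<circ> (\<lambda>z. restrict z J))"
      by (rule distr_distr[OF enc_J restr])
    also have "enc J \<circ> (\<lambda>z. restrict z J) = (\<lambda>f. restrict f J) \<circ> enc H"
      using JH(1) by (auto simp: fun_eq_iff enc_def restrict_def)
    also have "distr (Q H) (PiM J (\<lambda>_. borel)) ((\<lambda>f. restrict f J) \<circ> enc H)
        = distr (P H) (PiM J (\<lambda>_. borel)) (\<lambda>f. restrict f J)"
      unfolding P_def by (rule distr_distr[OF restr' enc_meas, symmetric])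
    finally show "P J = distr (P H) (PiM J (\<lambda>_. borel)) (\<lambda>f. restrict f J)" .
  next
    fix J assume "finite J" "J \<subseteq> V"
    then show "prob_space (P J)"
      unfolding P_def using prob_space_point_measure[OF p] enc_meas
      by (intro prob_space.prob_space_distr) (auto simp: Q_def)
  qed
  have dec_coord: "(\<lambda>g. dec v (g v)) \<in> PiM I (\<lambda>_. borel) \<rightarrow>\<^sub>M count_space (A v)"
    if "v \<in> V" "v \<in> I" for I v
  proof (rule measurable_compose[where f = "\<lambda>g. g v" and g = "dec v"])
    show "(\<lambda>g. g v) \<in> PiM I (\<lambda>_. borel) \<rightarrow>\<^sub>M (borel :: real measure)"
      by (rule measurable_component_singleton[OF that(2)])
  qed (rule dec_meas[OF that(1)])
  let ?dec = "\<lambda>x. \<lambda>v\<in>V. dec v (x v)"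
  have dec_M: "?dec \<in> K.lim \<rightarrow>\<^sub>M M"
  proof -
    have "?dec \<in> PiM V (\<lambda>_. borel :: real measure) \<rightarrow>\<^sub>M PiM V (\<lambda>v. count_space (A v))"
      by (intro measurable_restrict dec_coord)
    then show ?thesis
      using measurable_cong_sets[OF K.sets_lim refl] unfolding config_space_def by blast
  qed
  define \<mu> where "\<mu> = distr K.lim M ?dec"
  have "prob_space \<mu>" unfolding \<mu>_def by (rule K.P.prob_space_distr[OF dec_M])
  then have \<mu>: "\<mu> \<in> config_measures V A" by (simp add: config_measures_def \<mu>_def)
  have "emeasure \<mu> (cyl W z) = ennreal (p W z)" if W: "finite W" "W \<subseteq> V" and z: "z \<in> PiE W A" for W z
  proof -
    let ?B = "PiM W (\<lambda>_. borel :: real measure)"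
    define X where "X = {g \<in> space ?B. \<forall>v\<in>W. dec v (g v) = z v}"
    have X: "X \<in> sets ?B"
      unfolding X_def
    proof (rule sets.sets_Collect_finite_All[OF _ W(1)])
      fix v assume v: "v \<in> W"
      have "(\<lambda>g. dec v (g v)) \<in> ?B \<rightarrow>\<^sub>M count_space (A v)"
        using v W(2) by (intro dec_coord) auto
      then have "(\<lambda>g. dec v (g v)) -` {z v} \<inter> space ?B \<in> sets ?B"
        by (rule measurable_sets) (use v z in auto)
      moreover have "(\<lambda>g. dec v (g v)) -` {z v} \<inter> space ?B = {g \<in> space ?B. dec v (g v) = z v}"
        by auto
      ultimately show "{g \<in> space ?B. dec v (g v) = z v} \<in> sets ?B" by simp
    qed
    have "emeasure \<mu> (cyl W z) = emeasure K.lim (?dec -` cyl W z \<inter> space K.lim)"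
      unfolding \<mu>_def by (rule emeasure_distr[OF dec_M cyl_in_sets[OF W]])
    also have "?dec -` cyl W z \<inter> space K.lim = prod_emb V (\<lambda>_. borel) W X"
    proof (intro equalityI subsetI)
      fix x assume x: "x \<in> ?dec -` cyl W z \<inter> space K.lim"
      have "dec v (x v) = z v" if "v \<in> W" for v
      proof -
        have "?dec x v = z v" using x that by (simp add: cyl_def)
        then show ?thesis using that W(2) by auto
      qed
      then show "x \<in> prod_emb V (\<lambda>_. borel) W X"
        using x by (auto simp: X_def prod_emb_def space_PiM PiE_iff)
    next
      fix x assume x: "x \<in> prod_emb V (\<lambda>_. borel) W X"
      have "?dec x \<in> \<Omega>" using dec_A by simp
      moreover have "?dec x v = z v" if "v \<in> W" for v
        using x that W(2) by (auto simp: X_def prod_emb_def)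
      ultimately show "x \<in> ?dec -` cyl W z \<inter> space K.lim"
        using x by (auto simp: cyl_def prod_emb_def space_PiM)
    qed
    also have "emeasure K.lim (prod_emb V (\<lambda>_. borel) W X) = emeasure (P W) X"
      by (rule K.emeasure_lim_emb[OF W(2,1) X])
    also have "\<dots> = emeasure (Q W) (enc W -` X \<inter> space (Q W))"
      unfolding P_def by (rule emeasure_distr[OF enc_meas X])
    also have "enc W -` X \<inter> space (Q W) = {z}"
    proof (intro equalityI subsetI)
      fix y assume "y \<in> enc W -` X \<inter> space (Q W)"
      then have y: "y \<in> PiE W A" "enc W y \<in> X" by (auto simp: Q_def space_point_measure)
      have "y v = z v" if v: "v \<in> W" for v
      proof -
        have "dec v (enc W y v) = z v" using y(2) v by (simp add: X_def)
        moreover have "dec v (enc W y v) = y v"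
          using v W(2) y(1) by (simp add: enc_def, intro dec_e) auto
        ultimately show ?thesis by simp
      qed
      then show "y \<in> {z}" using PiE_ext[OF y(1) z] by blast
    next
      fix y assume "y \<in> {z}"
      moreover have "dec v (enc W z v) = z v" if "v \<in> W" for v
        using that W(2) z by (simp add: enc_def, intro dec_e) auto
      ultimately show "y \<in> enc W -` X \<inter> space (Q W)"
        using z enc_space by (simp add: X_def Q_def space_point_measure)
    qed
    also have "emeasure (Q W) {z} = ennreal (p W z)"
      unfolding Q_def using z by (simp add: emeasure_point_measure_finite2)
    finally show ?thesis .
  qed
  then show ?thesis using \<mu> that by blast
qed


section \<open>Screening in attractive structures\<close>

definition increasing :: "('v \<Rightarrow> 'a rel) \<Rightarrow> (('v \<Rightarrow> 'a) \<Rightarrow> real) \<Rightarrow> bool" where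
  "increasing R f \<longleftrightarrow> (\<forall>x\<in>\<Omega>. \<forall>y\<in>\<Omega>. config_le V R x y \<longrightarrow> f x \<le> f y)"

lemma increasingD: "increasing R f \<Longrightarrow> x \<in> \<Omega> \<Longrightarrow> y \<in> \<Omega> \<Longrightarrow> config_le V R x y \<Longrightarrow> f x \<le> f y"
  unfolding increasing_def by blast

definition spec_preserves_increasing :: "('v \<Rightarrow> 'a rel) \<Rightarrow> bool" where
  "spec_preserves_increasing R \<longleftrightarrow>
     (\<forall>\<Lambda> f. finite \<Lambda> \<and> \<Lambda> \<subseteq> V \<and> local_fun f \<and> increasing R f \<longrightarrow> increasing R (spec \<Lambda> f))"

lemma spec_preserves_increasingD:
  "spec_preserves_increasing R \<Longrightarrow> finite \<Lambda> \<Longrightarrow> \<Lambda> \<subseteq> V \<Longrightarrow> local_fun f \<Longrightarrow> increasing R f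
    \<Longrightarrow> increasing R (spec \<Lambda> f)"
  unfolding spec_preserves_increasing_def by blast

lemma stochastic_le_integral:
  fixes f :: "('v \<Rightarrow> 'a) \<Rightarrow> real"
  assumes le: "stochastic_le V A R \<mu>\<^sub>1 \<mu>\<^sub>2" and f: "f \<in> borel_measurable M"
    and b: "\<And>x. x \<in> \<Omega> \<Longrightarrow> \<bar>f x\<bar> \<le> b" and inc: "increasing R f"
  shows "(\<integral>x. f x \<partial>\<mu>\<^sub>1) \<le> (\<integral>x. f x \<partial>\<mu>\<^sub>2)"
proof -
  obtain \<kappa> where \<kappa>: "prob_space \<kappa>" "sets \<kappa> = sets (M \<Otimes>\<^sub>M M)"
    and marg: "distr \<kappa> M fst = \<mu>\<^sub>1" "distr \<kappa> M snd = \<mu>\<^sub>2"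
    and AE: "AE (x, y) in \<kappa>. config_le V R x y"
    using le unfolding stochastic_le_def by blast
  interpret prob_space \<kappa> by fact
  have sp: "space \<kappa> = \<Omega> \<times> \<Omega>"
    using sets_eq_imp_space_eq[OF \<kappa>(2)] by (simp add: space_pair_measure)
  have proj: "fst \<in> \<kappa> \<rightarrow>\<^sub>M M" "snd \<in> \<kappa> \<rightarrow>\<^sub>M M"
    using measurable_cong_sets[OF \<kappa>(2) refl] measurable_fst measurable_snd by blast+
  have meas: "(\<lambda>z. f (fst z)) \<in> borel_measurable \<kappa>" "(\<lambda>z. f (snd z)) \<in> borel_measurable \<kappa>"
    by (rule measurable_compose[OF proj(1) f], rule measurable_compose[OF proj(2) f])
  have "(\<integral>x. f x \<partial>\<mu>\<^sub>1) = (\<integral>z. f (fst z) \<partial>\<kappa>)"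
    unfolding marg[symmetric] by (rule integral_distr[OF proj(1) f])
  also have "\<dots> \<le> (\<integral>z. f (snd z) \<partial>\<kappa>)"
  proof (rule integral_mono_AE)
    show "integrable \<kappa> (\<lambda>z. f (fst z))" "integrable \<kappa> (\<lambda>z. f (snd z))"
      using b sp by (auto intro!: integrable_const_bound[of _ b] AE_I2 meas)
    show "AE z in \<kappa>. f (fst z) \<le> f (snd z)"
      using AE AE_space
    proof eventually_elim
      case (elim z)
      then show ?case using sp by (intro increasingD[OF inc]) auto
    qed
  qed
  also have "\<dots> = (\<integral>x. f x \<partial>\<mu>\<^sub>2)"
    unfolding marg[symmetric] by (rule integral_distr[OF proj(2) f, symmetric])
  finally show ?thesis .
qed

lemma config_le_in_sets:
  "{z \<in> space (M \<Otimes>\<^sub>M M). config_le V R (fst z) (snd z)} \<in> sets (M \<Otimes>\<^sub>M M)"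
proof -
  have "{z \<in> space (M \<Otimes>\<^sub>M M). (fst z v, snd z v) \<in> R v} \<in> sets (M \<Otimes>\<^sub>M M)" if v: "v \<in> V" for v
  proof -
    let ?I = "R v \<inter> A v \<times> A v"
    have "finite ?I" using finite_alphabet[OF v] by blast
    moreover have "{x \<in> \<Omega>. x v = a} \<times> {y \<in> \<Omega>. y v = b} \<in> sets (M \<Otimes>\<^sub>M M)" for a b
      using coordinate_in_sets[OF v] by (intro pair_measureI)
    ultimately have "(\<Union>(a, b)\<in>?I. {x \<in> \<Omega>. x v = a} \<times> {y \<in> \<Omega>. y v = b}) \<in> sets (M \<Otimes>\<^sub>M M)"
      by (intro sets.finite_UN) auto
    also have "(\<Union>(a, b)\<in>?I. {x \<in> \<Omega>. x v = a} \<times> {y \<in> \<Omega>. y v = b})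
        = {z \<in> space (M \<Otimes>\<^sub>M M). (fst z v, snd z v) \<in> R v}"
      using v by (auto simp: space_pair_measure)
    finally show ?thesis .
  qed
  then show ?thesis
    unfolding config_le_def using countable_V by (intro sets.sets_Collect_countable_All') auto
qed

lemma return_stochastic_le:
  assumes "x \<in> \<Omega>" "y \<in> \<Omega>" "config_le V R x y"
  shows "stochastic_le V A R (return M x) (return M y)"
  unfolding stochastic_le_def
proof (intro exI conjI)
  let ?\<kappa> = "return (M \<Otimes>\<^sub>M M) (x, y)"
  have xy: "(x, y) \<in> space (M \<Otimes>\<^sub>M M)" using assms by (simp add: space_pair_measure)
  show "prob_space ?\<kappa>" by (rule prob_space_return[OF xy])
  show "sets ?\<kappa> = sets (M \<Otimes>\<^sub>M M)" by simp
  show "distr ?\<kappa> M fst = return M x" "distr ?\<kappa> M snd = return M y"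
    using distr_return[OF measurable_fst xy] distr_return[OF measurable_snd xy] by auto
  have "AE z in ?\<kappa>. config_le V R (fst z) (snd z)"
    using config_le_in_sets assms(3) by (subst AE_return[OF xy]) (auto simp: pred_def)
  then show "AE (x, y) in ?\<kappa>. config_le V R x y" by (simp add: case_prod_beta')
qed

lemma averaged_return:
  assumes "x \<in> \<Omega>" "finite \<Lambda>" "\<Lambda> \<subseteq> V"
  shows "averaged V A \<Phi> \<Lambda> (return M x) = kernel \<Lambda> x"
  unfolding averaged_def using kernel_measurable[OF assms(2,3)] assms(1) by (intro bind_return) auto

text \<open>
  Monotonicity of averaging is applied to point masses only: for \<open>x \<preceq> y\<close> it couples the kernels
  with boundary conditions \<open>x\<close> and \<open>y\<close>.
\<close>

lemma attractive_imp_spec_preserves_increasing: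
  assumes mono: "\<And>\<Lambda>. finite \<Lambda> \<Longrightarrow> \<Lambda> \<subseteq> V \<Longrightarrow>
    monotone_on (config_measures V A) (stochastic_le V A R) (stochastic_le V A R) (averaged V A \<Phi> \<Lambda>)"
  shows "spec_preserves_increasing R"
  unfolding spec_preserves_increasing_def
proof (intro allI impI, elim conjE)
  fix \<Lambda> f assume \<Lambda>: "finite \<Lambda>" "\<Lambda> \<subseteq> V" and f: "local_fun f" "increasing R f"
  show "increasing R (spec \<Lambda> f)"
    unfolding increasing_def
  proof (intro ballI impI)
    fix x y assume xy: "x \<in> \<Omega>" "y \<in> \<Omega>" "config_le V R x y"
    obtain b where b: "\<And>x. x \<in> \<Omega> \<Longrightarrow> \<bar>f x\<bar> \<le> b" using local_fun_bounded[OF f(1)] by blast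
    note fM = local_fun_measurable[OF f(1)]
    have "return M x \<in> config_measures V A" "return M y \<in> config_measures V A"
      using xy by (simp_all add: config_measures_def prob_space_return)
    then have "stochastic_le V A R (averaged V A \<Phi> \<Lambda> (return M x)) (averaged V A \<Phi> \<Lambda> (return M y))"
      using monotone_onD[OF mono[OF \<Lambda>]] return_stochastic_le[OF xy] by blast
    then have "(\<integral>z. f z \<partial>kernel \<Lambda> x) \<le> (\<integral>z. f z \<partial>kernel \<Lambda> y)"
      using averaged_return[OF _ \<Lambda>] xy stochastic_le_integral[OF _ fM b f(2)] by simp
    then show "spec \<Lambda> f x \<le> spec \<Lambda> f y"
      using integral_kernel[OF xy(1) \<Lambda> fM] integral_kernel[OF xy(2) \<Lambda> fM] by simp
  qed
qed

text \<open>
  On a finite poset, indicators of up-sets span all functions; a cylinder is the difference of the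
  up-set above it and the part of that up-set strictly above it.
\<close>

lemma cyl_diff_increasing:
  assumes R: "\<And>v. v \<in> V \<Longrightarrow> partial_order_on (A v) (R v)" and W: "finite W" "W \<subseteq> V"
  obtains f g where "local_fun f" "local_fun g" "increasing R f" "increasing R g"
    "\<And>x. x \<in> \<Omega> \<Longrightarrow> indicator (cyl W z) x = f x - g x"
proof -
  note RD = partial_order_onD[OF R]
  define U where "U = {x \<in> \<Omega>. \<forall>v\<in>W. (z v, x v) \<in> R v}"
  let ?f = "indicator U :: _ \<Rightarrow> real" and ?g = "indicator (U - cyl W z) :: _ \<Rightarrow> real"
  have U_up: "y \<in> U" if "x \<in> U" "y \<in> \<Omega>" "config_le V R x y" for x y
    unfolding U_def
  proof (intro CollectI conjI ballI)
    fix v assume v: "v \<in> W"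
    then have "(z v, x v) \<in> R v" "(x v, y v) \<in> R v" using that W(2) by (auto simp: U_def config_le_def)
    then show "(z v, y v) \<in> R v" using transD[OF RD(2)] v W(2) by blast
  qed fact
  have cyl_down: "x \<in> cyl W z" if "x \<in> U" "y \<in> cyl W z" "config_le V R x y" for x y
    unfolding cyl_def
  proof (intro CollectI conjI ballI)
    show "x \<in> \<Omega>" using that by (simp add: U_def)
    fix v assume v: "v \<in> W"
    then have "v \<in> V" using W(2) by blast
    then have "(x v, y v) \<in> R v" using that(3) by (simp add: config_le_def)
    moreover have "(z v, x v) \<in> R v" using that(1) v by (simp add: U_def)
    moreover have "y v = z v" using that(2) v by (simp add: cyl_def)
    ultimately show "x v = z v" using antisymD[OF RD(3)[OF \<open>v \<in> V\<close>]] by simp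
  qed
  have det: "determined_by W ?f"
    unfolding determined_by_def by (auto simp: U_def indicator_def)
  have lf: "local_fun ?f" using det W unfolding local_fun_def by blast
  have eq: "?g x = ?f x - indicator (cyl W z) x" if "x \<in> \<Omega>" for x
  proof -
    have "x \<in> U" if "x \<in> cyl W z"
      using that W(2) RD(1) \<open>x \<in> \<Omega>\<close> unfolding U_def cyl_def refl_on_def by fastforce
    then show ?thesis by (auto simp: indicator_def)
  qed
  have "determined_by W ?g"
    unfolding determined_by_def
  proof (intro ballI impI)
    fix x y assume xy: "x \<in> \<Omega>" "y \<in> \<Omega>" "\<forall>v\<in>W. x v = y v"
    then show "?g x = ?g y"
      using determined_byD[OF det xy(1,2)] determined_byD[OF determined_by_indicator_cyl xy(1,2), of W z]
        eq by simp
  qed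
  then have lg: "local_fun ?g" using W unfolding local_fun_def by blast
  show ?thesis
  proof (rule that[OF lf lg])
    show "increasing R ?f"
      unfolding increasing_def using U_up by (auto simp: indicator_def)
    show "increasing R ?g"
      unfolding increasing_def using U_up cyl_down by (auto simp: indicator_def)
    show "indicator (cyl W z) x = ?f x - ?g x" if "x \<in> \<Omega>" for x using eq[OF that] by simp
  qed
qed

end

text \<open>
  Fixing the greatest configuration as boundary condition makes the expectations of an increasing
  function decrease when the volume grows. So they converge along the net of finite volumes.
\<close>

locale attractive_specification = gibbs_specification V A \<Phi>
  for V :: "'v set" and A :: "'v \<Rightarrow> 'a set" and \<Phi> :: "('v, 'a) potential" +
  fixes R :: "'v \<Rightarrow> 'a rel" and top :: "'v \<Rightarrow> 'a"
  assumes order: "\<And>v. v \<in> V \<Longrightarrow> partial_order_on (A v) (R v)"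
    and top: "top \<in> \<Omega>" and le_top: "\<And>x. x \<in> \<Omega> \<Longrightarrow> config_le V R x top"
    and preserves: "spec_preserves_increasing R"
begin

lemma spec_increasing:
  "finite \<Lambda> \<Longrightarrow> \<Lambda> \<subseteq> V \<Longrightarrow> local_fun f \<Longrightarrow> increasing R f \<Longrightarrow> increasing R (spec \<Lambda> f)"
  using spec_preserves_increasingD[OF preserves] .

lemma spec_top_decreasing:
  assumes \<Lambda>: "finite \<Lambda>'" "\<Lambda>' \<subseteq> V" "\<Lambda> \<subseteq> \<Lambda>'" and f: "local_fun f" "increasing R f"
  shows "spec \<Lambda>' f top \<le> spec \<Lambda> f top"
proof -
  have "finite \<Lambda>" "\<Lambda> \<subseteq> V" using \<Lambda> finite_subset by auto
  note inc = spec_increasing[OF this f]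
  have "spec \<Lambda>' (spec \<Lambda> f) top \<le> spec \<Lambda> f top"
  proof (rule spec_le_const[OF top \<Lambda>(1,2)])
    fix y assume "y \<in> agree \<Lambda>' top"
    then have "y \<in> \<Omega>" using agree_subset by blast
    then show "spec \<Lambda> f y \<le> spec \<Lambda> f top" by (intro increasingD[OF inc] top le_top)
  qed
  then show ?thesis using spec_spec[OF \<Lambda> top] by simp
qed

lemma spec_top_converges_increasing:
  assumes f: "local_fun f" "increasing R f"
  shows "\<exists>l. ((\<lambda>\<Lambda>. spec \<Lambda> f top) \<longlongrightarrow> l) (finite_subsets_at_top V)"
proof -
  obtain b where b: "\<And>x. x \<in> \<Omega> \<Longrightarrow> \<bar>f x\<bar> \<le> b" using local_fun_bounded[OF f(1)] by blast
  let ?F = "{\<Lambda>. finite \<Lambda> \<and> \<Lambda> \<subseteq> V}"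
  let ?a = "\<lambda>\<Lambda>. spec \<Lambda> f top"
  have "- b \<le> ?a \<Lambda>" if "\<Lambda> \<in> ?F" for \<Lambda>
  proof -
    have "\<bar>?a \<Lambda>\<bar> \<le> b" using that by (intro local_spec_bounded b top) auto
    then show ?thesis by simp
  qed
  then have bdd: "bdd_below (?a ` ?F)" by (intro bdd_belowI[of _ "- b"]) auto
  have "(?a \<longlongrightarrow> (INF \<Lambda>\<in>?F. ?a \<Lambda>)) (finite_subsets_at_top V)"
  proof (rule order_tendstoI)
    fix c assume c: "c < (INF \<Lambda>\<in>?F. ?a \<Lambda>)"
    have "c < ?a \<Lambda>" if "finite \<Lambda>" "\<Lambda> \<subseteq> V" for \<Lambda>
      using c cINF_lower[OF bdd, of \<Lambda>] that by auto
    then show "\<forall>\<^sub>F \<Lambda> in finite_subsets_at_top V. c < ?a \<Lambda>"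
      by (auto simp: eventually_finite_subsets_at_top)
  next
    fix c assume c: "(INF \<Lambda>\<in>?F. ?a \<Lambda>) < c"
    have "?F \<noteq> {}" by blast
    then obtain \<Lambda>\<^sub>0 where \<Lambda>0: "\<Lambda>\<^sub>0 \<in> ?F" "?a \<Lambda>\<^sub>0 < c" using c bdd by (auto simp: cINF_less_iff)
    have "?a \<Lambda> < c" if "finite \<Lambda>" "\<Lambda>\<^sub>0 \<subseteq> \<Lambda>" "\<Lambda> \<subseteq> V" for \<Lambda>
      using spec_top_decreasing[OF that(1,3,2) f] \<Lambda>0(2) by simp
    then show "\<forall>\<^sub>F \<Lambda> in finite_subsets_at_top V. ?a \<Lambda> < c"
      using \<Lambda>0(1) unfolding eventually_finite_subsets_at_top by blast
  qed
  then show ?thesis by blast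
qed

definition top_limit :: "(('v \<Rightarrow> 'a) \<Rightarrow> real) \<Rightarrow> real" where
  "top_limit f = Lim (finite_subsets_at_top V) (\<lambda>\<Lambda>. spec \<Lambda> f top)"

lemma top_limitI:
  "((\<lambda>\<Lambda>. spec \<Lambda> f top) \<longlongrightarrow> l) (finite_subsets_at_top V) \<Longrightarrow> top_limit f = l"
  unfolding top_limit_def by (rule tendsto_Lim) auto

lemma spec_eq_sum_cyl:
  assumes \<Lambda>: "finite \<Lambda>" "\<Lambda> \<subseteq> V" and W: "finite W" "W \<subseteq> V" and f: "determined_by W f"
  shows "spec \<Lambda> f x = (\<Sum>z\<in>PiE W A. f (override_on top z W) * spec \<Lambda> (indicator (cyl W z)) x)"
proof -
  have "spec \<Lambda> f x = spec \<Lambda> (\<lambda>x. \<Sum>z\<in>PiE W A. f (override_on top z W) * indicator (cyl W z) x) x"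
    by (rule spec_cong) (rule local_expansion[OF W f _ top])
  then show ?thesis by (simp add: spec_sum spec_cmult)
qed

lemma top_limit_cyl:
  assumes "finite W" "W \<subseteq> V"
  shows "((\<lambda>\<Lambda>. spec \<Lambda> (indicator (cyl W z)) top) \<longlongrightarrow> top_limit (indicator (cyl W z))) (finite_subsets_at_top V)"
proof -
  obtain f g where fg: "local_fun f" "local_fun g" "increasing R f" "increasing R g"
    "\<And>x. x \<in> \<Omega> \<Longrightarrow> indicator (cyl W z) x = f x - g x"
    using cyl_diff_increasing[OF order assms] by blast
  have "spec \<Lambda> (indicator (cyl W z)) top = spec \<Lambda> f top - spec \<Lambda> g top" for \<Lambda>
    using spec_cong[of "indicator (cyl W z)" "\<lambda>x. f x - g x" \<Lambda> top] fg(5) by (simp add: spec_diff)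
  moreover obtain l m where "((\<lambda>\<Lambda>. spec \<Lambda> f top) \<longlongrightarrow> l) (finite_subsets_at_top V)"
    "((\<lambda>\<Lambda>. spec \<Lambda> g top) \<longlongrightarrow> m) (finite_subsets_at_top V)"
    using spec_top_converges_increasing[OF fg(1,3)] spec_top_converges_increasing[OF fg(2,4)] by blast
  ultimately have lim: "((\<lambda>\<Lambda>. spec \<Lambda> (indicator (cyl W z)) top) \<longlongrightarrow> l - m) (finite_subsets_at_top V)"
    by (simp add: tendsto_diff)
  then show ?thesis using top_limitI[OF lim] by simp
qed

lemma eventually_finite_superset:
  assumes "finite W" "W \<subseteq> V" "\<And>\<Lambda>. finite \<Lambda> \<Longrightarrow> W \<subseteq> \<Lambda> \<Longrightarrow> \<Lambda> \<subseteq> V \<Longrightarrow> P \<Lambda>"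
  shows "\<forall>\<^sub>F \<Lambda> in finite_subsets_at_top V. P \<Lambda>"
  unfolding eventually_finite_subsets_at_top using assms by blast

lemma top_limit_sum_cyl:
  assumes W: "finite W" "W \<subseteq> V" and f: "determined_by W f"
  shows "((\<lambda>\<Lambda>. spec \<Lambda> f top) \<longlongrightarrow> (\<Sum>z\<in>PiE W A. f (override_on top z W) * top_limit (indicator (cyl W z))))
    (finite_subsets_at_top V)"
proof (rule Lim_transform_eventually)
  show "((\<lambda>\<Lambda>. \<Sum>z\<in>PiE W A. f (override_on top z W) * spec \<Lambda> (indicator (cyl W z)) top)
      \<longlongrightarrow> (\<Sum>z\<in>PiE W A. f (override_on top z W) * top_limit (indicator (cyl W z)))) (finite_subsets_at_top V)"
    by (intro tendsto_sum tendsto_mult tendsto_const top_limit_cyl W)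
  show "\<forall>\<^sub>F \<Lambda> in finite_subsets_at_top V.
      (\<Sum>z\<in>PiE W A. f (override_on top z W) * spec \<Lambda> (indicator (cyl W z)) top) = spec \<Lambda> f top"
    using spec_eq_sum_cyl[OF _ _ W f] by (intro eventually_finite_superset[of "{}"]) simp_all
qed

lemma top_limit_tendsto:
  assumes "local_fun f"
  shows "((\<lambda>\<Lambda>. spec \<Lambda> f top) \<longlongrightarrow> top_limit f) (finite_subsets_at_top V)"
proof -
  obtain W where "finite W" "W \<subseteq> V" "determined_by W f" using assms by (auto simp: local_fun_def)
  note lim = top_limit_sum_cyl[OF this]
  show ?thesis using lim top_limitI[OF lim] by simp
qed

text \<open>This invariance of the limit functional is the Gibbs property of the measure that it defines.\<close>

lemma top_limit_spec:
  assumes \<Lambda>: "finite \<Lambda>" "\<Lambda> \<subseteq> V" and f: "local_fun f"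
  shows "top_limit (spec \<Lambda> f) = top_limit f"
proof (rule top_limitI, rule Lim_transform_eventually[OF top_limit_tendsto[OF f]])
  show "\<forall>\<^sub>F \<Lambda>' in finite_subsets_at_top V. spec \<Lambda>' f top = spec \<Lambda>' (spec \<Lambda> f) top"
    by (intro eventually_finite_superset[OF \<Lambda>]) (simp add: spec_spec top)
qed

lemma consistent_marginals_top_limit: "consistent_marginals (\<lambda>W z. top_limit (indicator (cyl W z)))"
  unfolding consistent_marginals_def
proof (intro conjI allI impI; elim conjE)
  fix W z assume W: "finite W" "W \<subseteq> V"
  show "0 \<le> top_limit (indicator (cyl W z))"
  proof (rule tendsto_lowerbound[OF top_limit_cyl[OF W]])
    show "\<forall>\<^sub>F \<Lambda> in finite_subsets_at_top V. 0 \<le> spec \<Lambda> (indicator (cyl W z)) top"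
      by (intro eventually_finite_superset[of "{}"] spec_ge_const top) auto
  qed simp
next
  fix W assume W: "finite W" "W \<subseteq> V"
  have "top_limit (\<lambda>_. 1) = (\<Sum>z\<in>PiE W A. top_limit (indicator (cyl W z)))"
    using top_limitI[OF top_limit_sum_cyl[OF W, of "\<lambda>_. 1"]] by (simp add: determined_by_def)
  moreover have "top_limit (\<lambda>_. 1) = 1"
  proof (rule top_limitI, rule tendsto_eventually)
    show "\<forall>\<^sub>F \<Lambda> in finite_subsets_at_top V. spec \<Lambda> (\<lambda>_. 1) top = 1"
      by (intro eventually_finite_superset[of "{}"] spec_const top) auto
  qed
  ultimately show "(\<Sum>z\<in>PiE W A. top_limit (indicator (cyl W z))) = 1" by simp
next
  fix J W y assume W: "finite W" "W \<subseteq> V" and J: "J \<subseteq> W" and y: "y \<in> PiE J A"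
  let ?h = "indicator (cyl J y) :: _ \<Rightarrow> real"
  have det: "determined_by W ?h"
    using determined_by_mono[OF determined_by_indicator_cyl J] .
  have h: "?h (override_on top z W) = (if restrict z J = y then 1 else 0)" if z: "z \<in> PiE W A" for z
  proof -
    have "override_on top z W \<in> cyl J y \<longleftrightarrow> (\<forall>v\<in>J. z v = y v)"
      using override_in_\<Omega>[OF top z W(2)] J by (auto simp: cyl_def subset_eq)
    also have "\<dots> \<longleftrightarrow> restrict z J = y"
      using y by (auto simp: fun_eq_iff PiE_iff extensional_def)
    finally show ?thesis by (simp add: indicator_def)
  qed
  have "top_limit ?h = (\<Sum>z\<in>PiE W A. ?h (override_on top z W) * top_limit (indicator (cyl W z)))"
    by (rule top_limitI[OF top_limit_sum_cyl[OF W det]])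
  also have "\<dots> = (\<Sum>z\<in>PiE W A. if restrict z J = y then top_limit (indicator (cyl W z)) else 0)"
    using h by (intro sum.cong) auto
  also have "\<dots> = (\<Sum>z\<in>{z \<in> PiE W A. restrict z J = y}. top_limit (indicator (cyl W z)))"
    using finite_PiE_alphabets[OF W] by (simp add: sum.inter_filter)
  finally show "top_limit ?h = (\<Sum>z\<in>{z \<in> PiE W A. restrict z J = y}. top_limit (indicator (cyl W z)))" .
qed

lemma gibbs_measure_top_limit:
  obtains \<mu> where "gibbs_measure V A \<Phi> \<mu>" "\<forall>f. local_fun f \<longrightarrow> (\<integral>x. f x \<partial>\<mu>) = top_limit f"
proof -
  obtain \<mu> where \<mu>: "\<mu> \<in> config_measures V A"
    and cyl: "\<forall>W z. finite W \<longrightarrow> W \<subseteq> V \<longrightarrow> z \<in> PiE W A \<longrightarrow>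
      emeasure \<mu> (cyl W z) = ennreal (top_limit (indicator (cyl W z)))"
    by (rule projective_limit[OF consistent_marginals_top_limit])
  note \<mu>' = config_measuresD[OF \<mu>]
  interpret prob_space \<mu> by (rule \<mu>')
  have int_eq: "(\<integral>x. f x \<partial>\<mu>) = top_limit f" if f: "local_fun f" for f
  proof -
    obtain W where W: "finite W" "W \<subseteq> V" "determined_by W f" using f by (auto simp: local_fun_def)
    have meas: "measure \<mu> (cyl W z) = top_limit (indicator (cyl W z))" if "z \<in> PiE W A" for z
      using cyl W(1,2) that consistent_marginalsD(1)[OF consistent_marginals_top_limit W(1,2) that]
      by (simp add: measure_def)
    have cyl\<mu>: "cyl W z \<in> sets \<mu>" for z using cyl_in_sets[OF W(1,2)] \<mu>'(2) by simp
    have "(\<integral>x. f x \<partial>\<mu>) = (\<integral>x. (\<Sum>z\<in>PiE W A. f (override_on top z W) * indicator (cyl W z) x) \<partial>\<mu>)"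
      using local_expansion[OF W _ top] \<mu>'(3) by (intro Bochner_Integration.integral_cong) auto
    also have "\<dots> = (\<Sum>z\<in>PiE W A. f (override_on top z W) * measure \<mu> (cyl W z))"
      using cyl\<mu> by (subst Bochner_Integration.integral_sum) (auto simp: emeasure_eq_measure)
    also have "\<dots> = (\<Sum>z\<in>PiE W A. f (override_on top z W) * top_limit (indicator (cyl W z)))"
      using meas by simp
    also have "\<dots> = top_limit f" by (rule top_limitI[OF top_limit_sum_cyl[OF W], symmetric])
    finally show ?thesis .
  qed
  have "averaged V A \<Phi> \<Lambda> \<mu> = \<mu>" if \<Lambda>: "finite \<Lambda>" "\<Lambda> \<subseteq> V" for \<Lambda>
  proof (rule measure_eqI_cyl[symmetric])
    fix W z assume W: "finite W" "W \<subseteq> V" and z: "z \<in> PiE W A"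
    note loc = local_fun_indicator_cyl[OF W, of z]
    have "emeasure (averaged V A \<Phi> \<Lambda> \<mu>) (cyl W z) = ennreal (\<integral>x. spec \<Lambda> (indicator (cyl W z)) x \<partial>\<mu>)"
      by (rule emeasure_averaged[OF \<mu> \<Lambda> cyl_in_sets[OF W]])
    also have "\<dots> = ennreal (top_limit (indicator (cyl W z)))"
      using int_eq[OF local_fun_spec[OF \<Lambda> loc]] top_limit_spec[OF \<Lambda> loc] by simp
    also have "\<dots> = emeasure \<mu> (cyl W z)" using cyl W z by simp
    finally show "emeasure \<mu> (cyl W z) = emeasure (averaged V A \<Phi> \<Lambda> \<mu>) (cyl W z)" by simp
  qed (use \<mu>'(2) sets_averaged[OF \<mu> \<Lambda>] finite_measure_axioms in auto)
  then have "gibbs_measure V A \<Phi> \<mu>" using \<mu> by (simp add: gibbs_measure_def)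
  then show ?thesis using that int_eq by blast
qed

text \<open>
  Uniqueness enters through the identification of the limit with the integral over \<open>\<nu>\<close>. As the
  two functions to be compared are ordered, closeness of their integrals gives closeness in mean.
\<close>

proposition unique_imp_screened:
  assumes \<nu>: "gibbs_measure V A \<Phi> \<nu>" and unique: "\<And>\<nu>'. gibbs_measure V A \<Phi> \<nu>' \<Longrightarrow> \<nu>' = \<nu>"
    and f: "local_fun f" "increasing R f" and S: "S \<subseteq> V"
  shows "screened \<nu> S f"
proof -
  note \<nu>c = gibbs_measureD(1)[OF \<nu>]
  note \<nu>' = config_measuresD[OF \<nu>c]
  interpret prob_space \<nu> by (rule \<nu>')
  obtain \<mu> where "gibbs_measure V A \<Phi> \<mu>" "\<forall>f. local_fun f \<longrightarrow> (\<integral>x. f x \<partial>\<mu>) = top_limit f"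
    by (rule gibbs_measure_top_limit)
  with unique f(1) have lim: "(\<integral>x. f x \<partial>\<nu>) = top_limit f" by blast
  obtain b where b: "\<And>x. x \<in> \<Omega> \<Longrightarrow> \<bar>f x\<bar> \<le> b" using local_fun_bounded[OF f(1)] by blast
  note fM = local_fun_measurable[OF f(1)]
  have "\<exists>\<Lambda>. finite \<Lambda> \<and> \<Lambda> \<subseteq> V - S \<and>
     (\<integral>x. \<bar>spec \<Lambda> f x - spec \<Lambda> f (override_on top x S)\<bar> \<partial>\<nu>) \<le> e" if e: "e > 0" for e
  proof -
    have "\<forall>\<^sub>F \<Lambda> in finite_subsets_at_top V. spec \<Lambda> f top < top_limit f + e"
      using e by (intro order_tendstoD(2)[OF top_limit_tendsto[OF f(1)]]) simp
    then obtain \<Lambda>\<^sub>0 where \<Lambda>0: "finite \<Lambda>\<^sub>0" "\<Lambda>\<^sub>0 \<subseteq> V" "spec \<Lambda>\<^sub>0 f top < top_limit f + e"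
      unfolding eventually_finite_subsets_at_top by blast
    define \<Lambda> where "\<Lambda> = \<Lambda>\<^sub>0 - S"
    have \<Lambda>: "finite \<Lambda>" "\<Lambda> \<subseteq> V" "\<Lambda> \<subseteq> \<Lambda>\<^sub>0" "\<Lambda> \<subseteq> V - S" using \<Lambda>0 by (auto simp: \<Lambda>_def)
    let ?h = "spec \<Lambda> f"
    let ?g = "\<lambda>x. ?h (override_on top x S)"
    note h_loc = local_fun_spec[OF \<Lambda>(1,2) f(1)]
    note h_inc = spec_increasing[OF \<Lambda>(1,2) f]
    note fill = fill_in_\<Omega>[OF top]
    have refl: "(x v, x v) \<in> R v" if "x \<in> \<Omega>" "v \<in> V" for x v
      using partial_order_onD(1)[OF order[OF that(2)]] that by (auto simp: refl_on_def)
    have h_le_g: "?h x \<le> ?g x" if x: "x \<in> \<Omega>" for x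
    proof (rule increasingD[OF h_inc x fill[OF x]])
      show "config_le V R x (override_on top x S)"
        using le_top[OF x] refl[OF x] by (auto simp: config_le_def override_on_def)
    qed
    have g_inc: "increasing R ?g"
      unfolding increasing_def
    proof (intro ballI impI)
      fix x y assume xy: "x \<in> \<Omega>" "y \<in> \<Omega>" "config_le V R x y"
      then have "config_le V R (override_on top x S) (override_on top y S)"
        using refl[OF top] by (auto simp: config_le_def override_on_def)
      then show "?g x \<le> ?g y" by (rule increasingD[OF h_inc fill[OF xy(1)] fill[OF xy(2)]])
    qed
    have g_loc: "local_fun ?g" by (rule local_fun_fill[OF h_loc top])
    have hb: "\<bar>?h x\<bar> \<le> b" if "x \<in> \<Omega>" for x by (rule local_spec_bounded[OF \<Lambda>(1,2) b that])
    have gb: "\<bar>?g x\<bar> \<le> b" if "x \<in> \<Omega>" for x by (rule hb[OF fill[OF that]])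
    note hM = local_fun_measurable[OF h_loc] and gM = local_fun_measurable[OF g_loc]
    note int = integrable_bounded[OF \<nu>c hM hb] integrable_bounded[OF \<nu>c gM gb]
    have "(\<integral>x. ?g x \<partial>\<nu>) = (\<integral>x. spec \<Lambda>\<^sub>0 ?g x \<partial>\<nu>)"
      by (rule gibbs_integral[OF \<nu> \<Lambda>0(1,2) gM gb])
    also have "\<dots> \<le> (\<integral>x. spec \<Lambda>\<^sub>0 ?g top \<partial>\<nu>)"
    proof (rule integral_mono)
      show "integrable \<nu> (spec \<Lambda>\<^sub>0 ?g)"
        by (rule integrable_bounded[OF \<nu>c spec_measurable[OF \<Lambda>0(1,2) gM] local_spec_bounded[OF \<Lambda>0(1,2) gb]])
      show "spec \<Lambda>\<^sub>0 ?g x \<le> spec \<Lambda>\<^sub>0 ?g top" if "x \<in> space \<nu>" for x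
        using that \<nu>'(3) by (intro increasingD[OF spec_increasing[OF \<Lambda>0(1,2) g_loc g_inc]] top le_top) auto
    qed simp
    also have "\<dots> = spec \<Lambda>\<^sub>0 ?g top" by (simp add: prob_space)
    also have "\<dots> = spec \<Lambda>\<^sub>0 ?h top"
    proof -
      \<comment> \<open>Under the boundary condition \<open>top\<close>, filling up with \<open>top\<close> off \<open>S\<close> changes only sites of \<open>\<Lambda>\<close>.\<close>
      have "?g y = ?h y" if y: "y \<in> agree \<Lambda>\<^sub>0 top" for y
      proof (rule spec_boundary_cong)
        fix v assume "v \<in> V - \<Lambda>"
        then show "override_on top y S v = y v"
          using y by (cases "v \<in> S") (auto simp: \<Lambda>_def agreeing_off_def)
      qed
      then show ?thesis unfolding spec_def[of \<Lambda>\<^sub>0] by simp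
    qed
    also have "\<dots> = spec \<Lambda>\<^sub>0 f top" by (rule spec_spec[OF \<Lambda>0(1,2) \<Lambda>(3) top])
    finally have g_le: "(\<integral>x. ?g x \<partial>\<nu>) \<le> (\<integral>x. f x \<partial>\<nu>) + e" using \<Lambda>0(3) lim by simp
    have "(\<integral>x. \<bar>?h x - ?g x\<bar> \<partial>\<nu>) = (\<integral>x. ?g x - ?h x \<partial>\<nu>)"
      using h_le_g \<nu>'(3) by (intro Bochner_Integration.integral_cong) auto
    also have "\<dots> = (\<integral>x. ?g x \<partial>\<nu>) - (\<integral>x. ?h x \<partial>\<nu>)"
      by (rule Bochner_Integration.integral_diff[OF int(2,1)])
    also have "(\<integral>x. ?h x \<partial>\<nu>) = (\<integral>x. f x \<partial>\<nu>)"
      by (rule gibbs_integral[OF \<nu> \<Lambda>(1,2) fM b, symmetric])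
    finally have "(\<integral>x. \<bar>?h x - ?g x\<bar> \<partial>\<nu>) \<le> e" using g_le by simp
    then show ?thesis using \<Lambda> by blast
  qed
  then show ?thesis unfolding screened_def using top by blast
qed

end


section \<open>Saturated sets and the group structure\<close>

context gibbs_specification
begin

theorem saturated_sets_equivalent:
  assumes \<nu>: "gibbs_measure V A \<Phi> \<nu>" and unique: "\<And>\<nu>'. gibbs_measure V A \<Phi> \<nu>' \<Longrightarrow> \<nu>' = \<nu>"
    and cond: "dobrushin_condition V A \<Phi> \<or> attractive V A \<Phi>" and S: "S \<subseteq> V"
  shows "equivalent_mod_0 \<nu> (saturated_sets \<nu> S) (coordinate_algebra S)"
proof (rule screening_imp_saturated[OF \<nu> S])
  fix W z assume W: "finite W" "W \<subseteq> V" "z \<in> PiE W A"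
  note \<nu>c = gibbs_measureD(1)[OF \<nu>]
  show "\<exists>f g. local_fun f \<and> local_fun g \<and> screened \<nu> S f \<and> screened \<nu> S g \<and>
    (\<forall>x\<in>\<Omega>. indicator (cyl W z) x = f x - g x)"
    using cond
  proof
    assume D: "dobrushin_condition V A \<Phi>"
    have "local_fun (\<lambda>_. 0)" by (auto simp: local_fun_def determined_by_def)
    then show ?thesis
      using local_fun_indicator_cyl[OF W(1,2), of z] dobrushin_screened[OF D \<nu>c _ S]
      by (intro exI[of _ "indicator (cyl W z)"] exI[of _ "\<lambda>_. 0"]) auto
  next
    assume "attractive V A \<Phi>"
    then obtain R where R: "\<And>v. v \<in> V \<Longrightarrow> order_with_extremes (A v) (R v)"
      and mono: "\<And>\<Lambda>. finite \<Lambda> \<Longrightarrow> \<Lambda> \<subseteq> V \<Longrightarrow>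
        monotone_on (config_measures V A) (stochastic_le V A R) (stochastic_le V A R) (averaged V A \<Phi> \<Lambda>)"
      unfolding attractive_def by blast
    have order: "partial_order_on (A v) (R v)" if "v \<in> V" for v
      using R[OF that] by (simp add: order_with_extremes_def)
    have "\<exists>t\<in>A v. \<forall>a\<in>A v. (a, t) \<in> R v" if v: "v \<in> V" for v
      using R[OF v] unique_maximal_is_greatest[OF finite_alphabet[OF v] order[OF v]]
      by (simp add: order_with_extremes_def)
    then obtain t where t: "\<And>v. v \<in> V \<Longrightarrow> t v \<in> A v" "\<And>v a. v \<in> V \<Longrightarrow> a \<in> A v \<Longrightarrow> (a, t v) \<in> R v"
      by metis
    interpret attractive_specification V A \<Phi> R "restrict t V"
    proof
      show "spec_preserves_increasing R" by (rule attractive_imp_spec_preserves_increasing[OF mono])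
      show "config_le V R x (restrict t V)" if "x \<in> \<Omega>" for x
        using that t(2) by (auto simp: config_le_def)
    qed (use order t(1) in auto)
    obtain f g where "local_fun f" "local_fun g" "increasing R f" "increasing R g"
      "\<And>x. x \<in> \<Omega> \<Longrightarrow> indicator (cyl W z) x = f x - g x"
      using cyl_diff_increasing[OF order W(1,2)] by blast
    then show ?thesis using unique_imp_screened[OF \<nu> unique _ _ S] by blast
  qed
qed

end

lemma translated_partition_eq:
  assumes "group G" "g \<in> carrier G"
  shows "translated_partition G A g = (\<lambda>a. {x \<in> carrier G \<rightarrow>\<^sub>E A. x g = a}) ` A"
proof -
  interpret group G by fact
  have "shift G g -` {x \<in> carrier G \<rightarrow>\<^sub>E A. x \<one>\<^bsub>G\<^esub> = a} \<inter> (carrier G \<rightarrow>\<^sub>E A)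
      = {x \<in> carrier G \<rightarrow>\<^sub>E A. x g = a}" for a
    using assms(2) by (auto simp: shift_def)
  then show ?thesis
    by (simp add: translated_partition_def alphabet_partition_def image_image)
qed

theorem proposition1p4:
  fixes G :: "('g, 'm) monoid_scheme" and A :: "'a set"
    and \<Phi> :: "('g, 'a) potential" and \<nu> :: "('g \<Rightarrow> 'a) measure" and S :: "'g set"
  assumes "group G" and "countable (carrier G)" and "finite A"
    and "gibbs_structure (carrier G) (\<lambda>_. A) \<Phi>"
    and "gibbs_measure (carrier G) (\<lambda>_. A) \<Phi> \<nu>"
    and "\<And>\<nu>'. gibbs_measure (carrier G) (\<lambda>_. A) \<Phi> \<nu>' \<Longrightarrow> \<nu>' = \<nu>"
    and "dobrushin_condition (carrier G) (\<lambda>_. A) \<Phi> \<or> attractive (carrier G) (\<lambda>_. A) \<Phi>"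
    and "S \<subseteq> carrier G"
  shows "equivalent_mod_0 \<nu> (saturation G A \<nu> (alphabet_algebra G A S)) (alphabet_algebra G A S)"
proof -
  interpret group G by fact
  \<comment> \<open>Over an empty alphabet there is no configuration, hence no probability measure.\<close>
  have "A \<noteq> {}"
  proof
    assume "A = {}"
    moreover have "prob_space \<nu>" "sets \<nu> = sets (config_space (carrier G) (\<lambda>_. A))"
      using assms(5) by (auto simp: gibbs_measure_def config_measures_def)
    moreover have "space (config_space (carrier G) (\<lambda>_. A)) = (carrier G \<rightarrow>\<^sub>E A)"
      by (simp add: config_space_def space_PiM)
    moreover have "space \<nu> = space (config_space (carrier G) (\<lambda>_. A))"
      by (rule sets_eq_imp_space_eq) fact
    ultimately show False
      using one_closed prob_space.not_empty[of \<nu>] by (auto simp: PiE_eq_empty_iff)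
  qed
  then interpret gibbs_specification "carrier G" "\<lambda>_. A" \<Phi>
    by unfold_locales (use assms(4) in auto)
  have alg: "alphabet_algebra G A T = coordinate_algebra T" if "T \<subseteq> carrier G" for T
  proof -
    have "translated_partition G A g = (\<lambda>a. {x \<in> carrier G \<rightarrow>\<^sub>E A. x g = a}) ` A" if "g \<in> T" for g
      using translated_partition_eq[OF assms(1)] that \<open>T \<subseteq> carrier G\<close> by blast
    then show ?thesis unfolding alphabet_algebra_def coordinate_algebra_def by simp
  qed
  have "saturation G A \<nu> (alphabet_algebra G A S) = saturated_sets \<nu> S"
    unfolding saturation_def saturated_sets_def using alg[OF assms(8)] alg[of "carrier G - F" for F] by simp
  then show ?thesis
    using saturated_sets_equivalent[OF assms(5) assms(6) assms(7) assms(8)] alg[OF assms(8)] by simp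
qed

end
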